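(* Let $R_{\Delta t}=\operatorname{span}\{\varrho^1,\dots,\varrho^{N_t}\}\subset H^2_{\{T\}}(I)$ and $Z_h=\operatorname{span}\{\phi_1,\dots,\phi_{N_h}\}\subset H^1_0(\Omega)\cap H^2(\Omega)$ be finite-dimensional spaces (with the given functions as bases), let $\mathbb{V}_\delta:=R_{\Delta t}\otimes Z_h\subset\mathbb{V}$ with $\delta=(\Delta t,h)$, and let $\mathbb{U}_\delta:=B^*(\mathbb{V}_\delta)\subset\mathbb{U}$. Then $$\beta_\delta:=\inf_{u_\delta\in\mathbb{U}_\delta}\sup_{v_\delta\in\mathbb{V}_\delta}\frac{b(u_\delta,v_\delta)}{\|u_\delta\|_{\mathbb{U}}\,\|v_\delta\|_{\mathbb{V}}}=1,$$ where the infimum and supremum are taken over nonzero elements.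
   Context: Setting: $T>0$, $I=(0,T)$, $\Omega\subset\mathbb{R}^d$ is a bounded convex domain, $A=-\Delta$ with homogeneous Dirichlet boundary conditions, $H=L_2(\Omega)$, $V=H^1_0(\Omega)$, $D(A)=H^2(\Omega)\cap H^1_0(\Omega)$. All spaces are real. Put $\mathcal{H}:=L_2(I;H)$ (Bochner space) with inner product $(w,v)_{\mathcal{H}}=\int_0^T(w(t),v(t))_H\,dt$. $\mathbb{U}:=\mathcal{H}$ with $\|\cdot\|_{\mathbb{U}}=\|\cdot\|_{\mathcal{H}}$. Let $\mathcal{C}^2_T:=\{v\in C^2([0,T];H)\cap C^1([0,T];V)\cap C([0,T];D(A)):\ v(T)=0,\ \dot v(T)=0\}$, and for $v\in\mathcal{C}^2_T$ put $B^*v:=\ddot v+Av$, $\|v\|_{\mathbb{V}}:=\|B^*v\|_{\mathcal{H}}$ (a norm on $\mathcal{C}^2_T$). $\mathbb{V}$ is the closure (completion) of $\mathcal{C}^2_T$ with respect to $\|\cdot\|_{\mathbb{V}}$, regarded as a subspace of $L_2(I;H)$; $B^*$ also denotes the continuous extension to $\mathbb{V}\to L_2(I;H)$, and $\|v\|_{\mathbb{V}}=\|B^*v\|_{\mathcal{H}}$ on $\mathbb{V}$. The bilinear form is $b(u,v):=(u,B^*v)_{\mathcal{H}}$ for $u\in\mathbb{U}$, $v\in\mathbb{V}$. $H^2_{\{T\}}(I):=\{\vartheta\in H^2(I):\vartheta(T)=\dot\vartheta(T)=0\}$. $R_{\Delta t}\otimes Z_h$ is the span of the functions $(\varrho^k\otimes\phi_i)(t,x)=\varrho^k(t)\phi_i(x)$,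 $1\le k\le N_t$, $1\le i\le N_h$, and on such functions $B^*(\varrho^k\otimes\phi_i)=\ddot\varrho^k\otimes\phi_i+\varrho^k\otimes A\phi_i$. *)

theory Defs
  imports "HOL-Analysis.Analysis"
begin

section \<open>Square-integrable functions modulo equality almost everywhere\<close>

text \<open>
  Strong (Bochner) measurability: pointwise limit of simple functions. For real-valued functions
  this is Borel measurability. No separability assumption on the range is needed, so the
  construction below can be iterated: \<open>L\<^sub>2(I; L\<^sub>2(\<Omega>))\<close> is obtained by taking the
  type \<open>('a, real) L2\<close> itself as the range type.
\<close>

definition strongly_measurable :: "('x::euclidean_space \<Rightarrow> 'h::real_inner) \<Rightarrow> bool" where
  "strongly_measurable f \<longleftrightarrow>
     (\<exists>s. (\<forall>n. simple_function lborel (s n)) \<and> (\<forall>x. (\<lambda>n. s n x) \<longlonglongrightarrow> f x))"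

definition square_integrable :: "('x::euclidean_space \<Rightarrow> 'h::real_inner) \<Rightarrow> bool" where
  "square_integrable f \<longleftrightarrow>
     strongly_measurable f \<and> integrable lborel (\<lambda>x. (norm (f x))\<^sup>2)"

definition ae_eq :: "('x::euclidean_space \<Rightarrow> 'h::real_inner) \<Rightarrow> ('x \<Rightarrow> 'h) \<Rightarrow> bool" where
  "ae_eq f g \<longleftrightarrow>
     square_integrable f \<and> square_integrable g \<and> (AE x in lborel. f x = g x)"

lemma strongly_measurable_const: "strongly_measurable (\<lambda>x. c)"
  unfolding strongly_measurable_def by (rule exI[of _ "\<lambda>n x. c"]) auto

lemma strongly_measurable_add:
  assumes "strongly_measurable f" "strongly_measurable g"
  shows "strongly_measurable (\<lambda>x. f x + g x)"
proof -
  obtain s r where "\<forall>n. simple_function lborel (s n)" "\<forall>x. (\<lambda>n. s n x) \<longlonglongrightarrow> f x"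
    "\<forall>n. simple_function lborel (r n)" "\<forall>x. (\<lambda>n. r n x) \<longlonglongrightarrow> g x"
    using assms unfolding strongly_measurable_def by blast
  then show ?thesis
    unfolding strongly_measurable_def
    by (intro exI[of _ "\<lambda>n x. s n x + r n x"])
       (auto intro!: tendsto_add simple_function_compose2[where h="(+)"])
qed

lemma strongly_measurable_scaleR:
  assumes "strongly_measurable f"
  shows "strongly_measurable (\<lambda>x. c *\<^sub>R f x)"
proof -
  obtain s where "\<forall>n. simple_function lborel (s n)" "\<forall>x. (\<lambda>n. s n x) \<longlonglongrightarrow> f x"
    using assms unfolding strongly_measurable_def by blast
  then show ?thesis
    unfolding strongly_measurable_def
    by (intro exI[of _ "\<lambda>n x. c *\<^sub>R s n x"])
       (auto intro!: tendsto_intros simple_function_compose1[where g="\<lambda>y. c *\<^sub>R y"])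
qed

lemma borel_measurable_inner_strongly:
  assumes "strongly_measurable f" "strongly_measurable g"
  shows "(\<lambda>x. f x \<bullet> g x) \<in> borel_measurable lborel"
proof -
  obtain s r where *: "\<forall>n. simple_function lborel (s n)" "\<forall>x. (\<lambda>n. s n x) \<longlonglongrightarrow> f x"
    "\<forall>n. simple_function lborel (r n)" "\<forall>x. (\<lambda>n. r n x) \<longlonglongrightarrow> g x"
    using assms unfolding strongly_measurable_def by blast
  show ?thesis
  proof (rule borel_measurable_LIMSEQ_metric)
    show "(\<lambda>x. s n x \<bullet> r n x) \<in> borel_measurable lborel" for n
      using * by (intro borel_measurable_simple_function
          simple_function_compose2[where h="(\<bullet>)"]) blast+
    show "(\<lambda>n. s n x \<bullet> r n x) \<longlonglongrightarrow> f x \<bullet> g x" for x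
      using * by (intro tendsto_inner) auto
  qed
qed

lemma square_integrable_inner:
  assumes "square_integrable f" "square_integrable g"
  shows "integrable lborel (\<lambda>x. f x \<bullet> g x)"
proof (rule Bochner_Integration.integrable_bound)
  show "integrable lborel (\<lambda>x. (norm (f x))\<^sup>2 + (norm (g x))\<^sup>2)"
    using assms by (auto simp: square_integrable_def)
  show "(\<lambda>x. f x \<bullet> g x) \<in> borel_measurable lborel"
    using assms by (simp add: square_integrable_def borel_measurable_inner_strongly[simplified])
  have "norm (f x \<bullet> g x) \<le> norm ((norm (f x))\<^sup>2 + (norm (g x))\<^sup>2)" for x
  proof -
    have "\<bar>f x \<bullet> g x\<bar> \<le> norm (f x) * norm (g x)" by (rule Cauchy_Schwarz_ineq2)
    also have "\<dots> \<le> (norm (f x))\<^sup>2 + (norm (g x))\<^sup>2"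
      using sum_squares_bound[of "norm (f x)" "norm (g x)"]
            mult_nonneg_nonneg[OF norm_ge_zero[of "f x"] norm_ge_zero[of "g x"]] by linarith
    finally show ?thesis by simp
  qed
  then show "AE x in lborel. norm (f x \<bullet> g x) \<le> norm ((norm (f x))\<^sup>2 + (norm (g x))\<^sup>2)"
    by simp
qed

lemma square_integrable_zero: "square_integrable (\<lambda>x. 0)"
  by (auto simp: square_integrable_def strongly_measurable_const)

lemma square_integrable_add:
  assumes "square_integrable f" "square_integrable g"
  shows "square_integrable (\<lambda>x. f x + g x)"
proof -
  have "(norm (f x + g x))\<^sup>2 = (norm (f x))\<^sup>2 + 2 * (f x \<bullet> g x) + (norm (g x))\<^sup>2" for x
    by (simp add: power2_norm_eq_inner inner_add inner_commute)
  then show ?thesis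
    using assms square_integrable_inner[OF assms]
    by (auto simp: square_integrable_def intro: strongly_measurable_add)
qed

lemma square_integrable_scaleR:
  assumes "square_integrable f"
  shows "square_integrable (\<lambda>x. c *\<^sub>R f x)"
  using assms
  by (auto simp: square_integrable_def power_mult_distrib intro: strongly_measurable_scaleR)

lemma ae_eq_part_equivp: "part_equivp ae_eq"
proof (rule part_equivpI)
  show "\<exists>f. ae_eq f f"
    by (rule exI[of _ "\<lambda>x. 0"]) (simp add: ae_eq_def square_integrable_zero)
  show "symp ae_eq"
    by (auto simp: symp_def ae_eq_def elim: eventually_mono)
  show "transp ae_eq"
    by (rule transpI) (auto simp: ae_eq_def elim: eventually_elim2)
qed

quotient_type (overloaded) ('x, 'h) L2 = "'x::euclidean_space \<Rightarrow> 'h::real_inner" / partial: ae_eq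
  by (rule ae_eq_part_equivp)

instantiation L2 :: (euclidean_space, real_inner) real_inner
begin

lift_definition zero_L2 :: "('a, 'b) L2" is "\<lambda>x. 0"
  by (simp add: ae_eq_def square_integrable_zero)

lift_definition plus_L2 :: "('a, 'b) L2 \<Rightarrow> ('a, 'b) L2 \<Rightarrow> ('a, 'b) L2" is "\<lambda>f g x. f x + g x"
  unfolding ae_eq_def by (auto intro: square_integrable_add)

lift_definition scaleR_L2 :: "real \<Rightarrow> ('a, 'b) L2 \<Rightarrow> ('a, 'b) L2" is "\<lambda>c f x. c *\<^sub>R f x"
  unfolding ae_eq_def by (auto intro: square_integrable_scaleR)

definition uminus_L2 :: "('a, 'b) L2 \<Rightarrow> ('a, 'b) L2" where
  "uminus_L2 f = (-1) *\<^sub>R f"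

definition minus_L2 :: "('a, 'b) L2 \<Rightarrow> ('a, 'b) L2 \<Rightarrow> ('a, 'b) L2" where
  "minus_L2 f g = f + (- g)"

lift_definition inner_L2 :: "('a, 'b) L2 \<Rightarrow> ('a, 'b) L2 \<Rightarrow> real" is
  "\<lambda>f g. \<integral>x. f x \<bullet> g x \<partial>lborel"
  unfolding ae_eq_def square_integrable_def
  by (intro integral_cong_AE) (auto intro: borel_measurable_inner_strongly[simplified])

definition norm_L2 :: "('a, 'b) L2 \<Rightarrow> real" where
  "norm_L2 f = sqrt (f \<bullet> f)"

definition sgn_L2 :: "('a, 'b) L2 \<Rightarrow> ('a, 'b) L2" where
  "sgn_L2 f = inverse (norm f) *\<^sub>R f"

definition dist_L2 :: "('a, 'b) L2 \<Rightarrow> ('a, 'b) L2 \<Rightarrow> real" where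
  "dist_L2 f g = norm (f - g)"

definition uniformity_L2 :: "(('a, 'b) L2 \<times> ('a, 'b) L2) filter" where
  "uniformity_L2 = (INF e\<in>{0 <..}. principal {(f, g). dist f g < e})"

definition open_L2 :: "('a, 'b) L2 set \<Rightarrow> bool" where
  "open_L2 U \<longleftrightarrow> (\<forall>f\<in>U. eventually (\<lambda>(f', g). f' = f \<longrightarrow> g \<in> U) uniformity)"

instance
proof
  fix f g h :: "('a, 'b) L2" and c d :: real
  show "f + g + h = f + (g + h)"
    by transfer (auto simp: ae_eq_def add.assoc intro!: square_integrable_add)
  show "f + g = g + f"
    by transfer (auto simp: ae_eq_def add.commute intro!: square_integrable_add)
  show "0 + f = f"
    by transfer (auto simp: ae_eq_def)
  show "- f + f = 0"
    unfolding uminus_L2_def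
    by transfer (auto simp: ae_eq_def square_integrable_zero)
  show "f - g = f + - g"
    by (rule minus_L2_def)
  show "c *\<^sub>R (f + g) = c *\<^sub>R f + c *\<^sub>R g"
    by transfer (auto simp: ae_eq_def scaleR_add_right
        intro!: square_integrable_add square_integrable_scaleR)
  show "(c + d) *\<^sub>R f = c *\<^sub>R f + d *\<^sub>R f"
    by transfer (auto simp: ae_eq_def scaleR_add_left
        intro!: square_integrable_add square_integrable_scaleR)
  show "c *\<^sub>R d *\<^sub>R f = (c * d) *\<^sub>R f"
    by transfer (auto simp: ae_eq_def intro!: square_integrable_scaleR)
  show "1 *\<^sub>R f = f"
    by transfer (auto simp: ae_eq_def)
  show "sgn f = inverse (norm f) *\<^sub>R f"
    by (rule sgn_L2_def)
  show "dist f g = norm (f - g)"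
    by (rule dist_L2_def)
  show "(uniformity :: (('a, 'b) L2 \<times> ('a, 'b) L2) filter)
      = (INF e\<in>{0 <..}. principal {(f, g). dist f g < e})"
    by (rule uniformity_L2_def)
  show "open U \<longleftrightarrow> (\<forall>f\<in>U. eventually (\<lambda>(f', g). f' = f \<longrightarrow> g \<in> U) uniformity)"
    for U :: "('a, 'b) L2 set"
    by (rule open_L2_def)
  show "f \<bullet> g = g \<bullet> f"
    by transfer (simp add: inner_commute)
  show "(f + g) \<bullet> h = f \<bullet> h + g \<bullet> h"
    by transfer (auto simp: ae_eq_def inner_add_left square_integrable_inner)
  show "(c *\<^sub>R f) \<bullet> g = c * (f \<bullet> g)"
    by transfer simp
  show "0 \<le> f \<bullet> f"
    by transfer simp
  show "f \<bullet> f = 0 \<longleftrightarrow> f = 0"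
  proof transfer
    fix f :: "'a \<Rightarrow> 'b" assume "ae_eq f f"
    then have f: "square_integrable f" by (simp add: ae_eq_def)
    have "(\<integral>x. f x \<bullet> f x \<partial>lborel) = 0 \<longleftrightarrow> (AE x in lborel. f x \<bullet> f x = 0)"
      using f by (intro integral_nonneg_eq_0_iff_AE square_integrable_inner) auto
    then show "(\<integral>x. f x \<bullet> f x \<partial>lborel) = 0 \<longleftrightarrow> ae_eq f (\<lambda>x. 0)"
      using f by (simp add: ae_eq_def square_integrable_zero)
  qed
  show "norm f = sqrt (f \<bullet> f)"
    by (rule norm_L2_def)
qed

end

text \<open>
  \<open>L\<^sub>2(S)\<close> for a subset \<open>S\<close> is realised isometrically inside the functions on the whole
  space by extension by zero; the inner product of the type then is the integral over \<open>S\<close>.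
\<close>

definition L2_on :: "'x::euclidean_space set \<Rightarrow> ('x, 'h::real_inner) L2 set" where
  "L2_on S = {f. AE x in lborel. x \<notin> S \<longrightarrow> rep_L2 f x = 0}"

definition Bochner_L2 :: "real \<Rightarrow> 'a::euclidean_space set \<Rightarrow> (real, ('a, real) L2) L2 set" where
  "Bochner_L2 T \<Omega> = {w \<in> L2_on {0<..<T}. AE t in lborel. rep_L2 w t \<in> L2_on \<Omega>}"


section \<open>Sobolev spaces and the Dirichlet Laplacian\<close>

primrec C_k :: "nat \<Rightarrow> ('x::euclidean_space \<Rightarrow> real) \<Rightarrow> bool" where
  "C_k 0 f \<longleftrightarrow> continuous_on UNIV f"
| "C_k (Suc k) f \<longleftrightarrow> (\<forall>x. f differentiable (at x)) \<and>
     (\<forall>i\<in>Basis. C_k k (\<lambda>x. frechet_derivative f (at x) i))"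

definition test_functions :: "'x::euclidean_space set \<Rightarrow> ('x \<Rightarrow> real) set" where
  "test_functions S = {\<psi>. (\<forall>k. C_k k \<psi>) \<and>
     compact (closure {x. \<psi> x \<noteq> 0}) \<and> closure {x. \<psi> x \<noteq> 0} \<subseteq> S}"

definition is_weak_partial ::
    "'x::euclidean_space set \<Rightarrow> 'x \<Rightarrow> ('x, real) L2 \<Rightarrow> ('x, real) L2 \<Rightarrow> bool" where
  "is_weak_partial S i f g \<longleftrightarrow> f \<in> L2_on S \<and> g \<in> L2_on S \<and>
     (\<forall>\<psi>\<in>test_functions S.
        (\<integral>x. rep_L2 f x * frechet_derivative \<psi> (at x) i \<partial>lborel)
          = - (\<integral>x. rep_L2 g x * \<psi> x \<partial>lborel))"

definition weak_partial ::
    "'x::euclidean_space set \<Rightarrow> 'x \<Rightarrow> ('x, real) L2 \<Rightarrow> ('x, real) L2" where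
  "weak_partial S i f = (THE g. is_weak_partial S i f g)"

definition Sobolev_H1 :: "'x::euclidean_space set \<Rightarrow> ('x, real) L2 set" where
  "Sobolev_H1 S = {f \<in> L2_on S. \<forall>i\<in>Basis. \<exists>g. is_weak_partial S i f g}"

definition H1_norm :: "'x::euclidean_space set \<Rightarrow> ('x, real) L2 \<Rightarrow> real" where
  "H1_norm S f = sqrt ((norm f)\<^sup>2 + (\<Sum>i\<in>Basis. (norm (weak_partial S i f))\<^sup>2))"

definition Sobolev_H10 :: "'x::euclidean_space set \<Rightarrow> ('x, real) L2 set" where
  "Sobolev_H10 S = {f \<in> Sobolev_H1 S.
     \<forall>\<epsilon>>0. \<exists>\<psi>\<in>test_functions S. H1_norm S (f - abs_L2 \<psi>) < \<epsilon>}"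

definition Sobolev_H2 :: "'x::euclidean_space set \<Rightarrow> ('x, real) L2 set" where
  "Sobolev_H2 S = {f \<in> Sobolev_H1 S. \<forall>i\<in>Basis. weak_partial S i f \<in> Sobolev_H1 S}"

definition domain_A :: "'a::euclidean_space set \<Rightarrow> ('a, real) L2 set" where
  "domain_A \<Omega> = Sobolev_H2 \<Omega> \<inter> Sobolev_H10 \<Omega>"

definition op_A :: "'a::euclidean_space set \<Rightarrow> ('a, real) L2 \<Rightarrow> ('a, real) L2" where
  "op_A \<Omega> f = - (\<Sum>i\<in>Basis. weak_partial \<Omega> i (weak_partial \<Omega> i f))"

text \<open>Graph norm; equivalent to the \<open>H\<^sup>2\<close>-norm on \<open>domain_A \<Omega>\<close> for bounded convex \<open>\<Omega>\<close>.\<close>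

definition graph_norm :: "'a::euclidean_space set \<Rightarrow> ('a, real) L2 \<Rightarrow> real" where
  "graph_norm \<Omega> f = sqrt ((norm f)\<^sup>2 + (norm (op_A \<Omega> f))\<^sup>2)"


section \<open>The spaces and forms of the ultra-weak formulation\<close>

text \<open>
  \<open>C_k_into k T X N v\<close>: the curve \<open>v\<close> belongs to \<open>C\<^sup>k([0,T]; X)\<close>, where the subspace \<open>X\<close> carries
  the norm \<open>N\<close>; derivatives at \<open>0\<close> and \<open>T\<close> are one-sided.
\<close>

primrec C_k_into ::
    "nat \<Rightarrow> real \<Rightarrow> 'h::real_normed_vector set \<Rightarrow> ('h \<Rightarrow> real) \<Rightarrow> (real \<Rightarrow> 'h) \<Rightarrow> bool" where
  "C_k_into 0 T X N v \<longleftrightarrow>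
     (\<forall>t\<in>{0..T}. v t \<in> X \<and> ((\<lambda>s. N (v s - v t)) \<longlongrightarrow> 0) (at t within {0..T}))"
| "C_k_into (Suc k) T X N v \<longleftrightarrow> (\<forall>t\<in>{0..T}. v t \<in> X) \<and>
     (\<exists>v'. (\<forall>t\<in>{0..T}.
              ((\<lambda>s. N ((v s - v t) /\<^sub>R (s - t) - v' t)) \<longlongrightarrow> 0) (at t within {0..T})) \<and>
           C_k_into k T X N v')"

definition tderiv :: "real \<Rightarrow> (real \<Rightarrow> 'h::real_normed_vector) \<Rightarrow> real \<Rightarrow> 'h" where
  "tderiv T v t = vector_derivative v (at t within {0..T})"

definition C2_T :: "real \<Rightarrow> 'a::euclidean_space set \<Rightarrow> (real \<Rightarrow> ('a, real) L2) set" where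
  "C2_T T \<Omega> = {v.
     C_k_into 2 T (L2_on \<Omega>) norm v \<and>
     C_k_into 1 T (Sobolev_H10 \<Omega>) (H1_norm \<Omega>) v \<and>
     C_k_into 0 T (domain_A \<Omega>) (graph_norm \<Omega>) v \<and>
     v T = 0 \<and> tderiv T v T = 0}"

text \<open>The class of a curve on \<open>(0,T)\<close>; its values outside \<open>(0,T)\<close> are irrelevant.\<close>

definition curve_class :: "real \<Rightarrow> (real \<Rightarrow> 'h::real_inner) \<Rightarrow> (real, 'h) L2" where
  "curve_class T v = abs_L2 (\<lambda>t. indicator {0<..<T} t *\<^sub>R v t)"

definition Bstar_C2 ::
    "real \<Rightarrow> 'a::euclidean_space set \<Rightarrow> (real \<Rightarrow> ('a, real) L2) \<Rightarrow> (real, ('a, real) L2) L2" where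
  "Bstar_C2 T \<Omega> v = curve_class T (\<lambda>t. tderiv T (tderiv T v) t + op_A \<Omega> (v t))"

text \<open>
  The completion of \<open>C2_T T \<Omega>\<close> for the norm \<open>\<lambda>v. norm (Bstar_C2 T \<Omega> v)\<close>, realised inside
  \<open>Bochner_L2 T \<Omega>\<close>: limits of sequences that are Cauchy for that norm. The continuous extension
  of \<open>B\<^sup>*\<close> sends such a limit to the limit of the images.
\<close>

definition V_space :: "real \<Rightarrow> 'a::euclidean_space set \<Rightarrow> (real, ('a, real) L2) L2 set" where
  "V_space T \<Omega> = {w \<in> Bochner_L2 T \<Omega>. \<exists>v. (\<forall>n. v n \<in> C2_T T \<Omega>) \<and>
     Cauchy (\<lambda>n. Bstar_C2 T \<Omega> (v n)) \<and>
     (\<lambda>n. curve_class T (v n)) \<longlonglongrightarrow> w}"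

definition Bstar ::
    "real \<Rightarrow> 'a::euclidean_space set \<Rightarrow> (real, ('a, real) L2) L2 \<Rightarrow> (real, ('a, real) L2) L2" where
  "Bstar T \<Omega> w = (THE g. \<exists>v. (\<forall>n. v n \<in> C2_T T \<Omega>) \<and>
     (\<lambda>n. curve_class T (v n)) \<longlonglongrightarrow> w \<and>
     (\<lambda>n. Bstar_C2 T \<Omega> (v n)) \<longlonglongrightarrow> g)"

abbreviation U_space :: "real \<Rightarrow> 'a::euclidean_space set \<Rightarrow> (real, ('a, real) L2) L2 set" where
  "U_space \<equiv> Bochner_L2"

definition V_norm :: "real \<Rightarrow> 'a::euclidean_space set \<Rightarrow> (real, ('a, real) L2) L2 \<Rightarrow> real" where
  "V_norm T \<Omega> v = norm (Bstar T \<Omega> v)"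

definition form_b ::
    "real \<Rightarrow> 'a::euclidean_space set \<Rightarrow>
     (real, ('a, real) L2) L2 \<Rightarrow> (real, ('a, real) L2) L2 \<Rightarrow> real" where
  "form_b T \<Omega> u v = u \<bullet> Bstar T \<Omega> v"


section \<open>Discrete spaces\<close>

text \<open>
  \<open>H\<^sup>2\<close> functions on \<open>(0,T)\<close> and their first weak derivatives have continuous representatives
  on \<open>[0,T]\<close>; the end conditions are understood for these.
\<close>

definition end_value :: "real \<Rightarrow> (real, real) L2 \<Rightarrow> real \<Rightarrow> bool" where
  "end_value T \<theta> c \<longleftrightarrow> (\<exists>f. continuous_on {0..T} f \<and>
     (AE t in lborel. t \<in> {0<..<T} \<longrightarrow> rep_L2 \<theta> t = f t) \<and> f T = c)"

definition H2_end :: "real \<Rightarrow> (real, real) L2 set" where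
  "H2_end T = {\<theta> \<in> Sobolev_H2 {0<..<T}.
     end_value T \<theta> 0 \<and> end_value T (weak_partial {0<..<T} 1 \<theta>) 0}"

definition tensor ::
    "(real, real) L2 \<Rightarrow> ('a::euclidean_space, real) L2 \<Rightarrow> (real, ('a, real) L2) L2" where
  "tensor \<theta> \<phi> = abs_L2 (\<lambda>t. rep_L2 \<theta> t *\<^sub>R \<phi>)"

definition tensor_space ::
    "nat \<Rightarrow> (nat \<Rightarrow> (real, real) L2) \<Rightarrow> nat \<Rightarrow> (nat \<Rightarrow> ('a::euclidean_space, real) L2) \<Rightarrow>
     (real, ('a, real) L2) L2 set" where
  "tensor_space Nt \<rho> Nh \<phi> = span {tensor (\<rho> k) (\<phi> i) | k i. k \<in> {1..Nt} \<and> i \<in> {1..Nh}}"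

definition inf_sup_constant ::
    "('u::real_vector \<Rightarrow> 'v::real_vector \<Rightarrow> real) \<Rightarrow> ('u \<Rightarrow> real) \<Rightarrow> ('v \<Rightarrow> real) \<Rightarrow>
     'u set \<Rightarrow> 'v set \<Rightarrow> real" where
  "inf_sup_constant b NU NV U V = (INF u\<in>U - {0}. SUP v\<in>V - {0}. b u v / (NU u * NV v))"

end

theory Submission
  imports Defs
begin

text \<open>
  The value 1 itself is a matter of norms. The norm on the trial space is the norm of \<open>L\<^sub>2(I;H)\<close>, and
  \<open>\<parallel>v\<parallel>\<^sub>V = \<parallel>B\<^sup>* v\<parallel>\<close>, so the quotient in question is
  \<open>(u, B\<^sup>* v) / (\<parallel>u\<parallel> \<parallel>B\<^sup>* v\<parallel>)\<close>. By Cauchy-Schwarz it is at most 1, and since \<open>u\<close> lies in the image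
  of the discrete test space, \<open>u = B\<^sup>* v\<close> for some discrete \<open>v\<close>, for which it equals 1. This is
  \<open>inf_sup_constant_image\<close>. The analysis goes into showing that \<open>B\<^sup>*\<close> is a well-defined linear operator
  on the discrete space and that its image is not trivial.

  \<^item> \<open>B\<^sup>*\<close> is closable (\<open>Bstar_limit_unique\<close>). Integration by parts gives
    \<open>(B\<^sup>* v, \<eta> \<otimes> \<psi>) = (v, \<eta>'' \<otimes> \<psi> - \<eta> \<otimes> \<Delta>\<psi>)\<close> for test functions \<open>\<eta>\<close> in time and \<open>\<psi>\<close> in space
    (\<open>Bstar_C2_inner_test\<close>), hence the limit of \<open>B\<^sup>* v\<^sub>n\<close> tested with \<open>\<eta> \<otimes> \<psi>\<close> depends only on the
    limit of \<open>v\<^sub>n\<close>. Tensor products of test functions are total in \<open>L\<^sub>2(I;L\<^sub>2(\<Omega>))\<close>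
    (\<open>tensor_test_functions_total\<close>), by the fundamental lemma of the calculus of variations
    in a version with countably many test functions (\<open>cutoff_family_total\<close>).

  \<^item> Each \<open>\<rho> \<otimes> \<phi>\<close> belongs to the completion, and \<open>B\<^sup>*(\<rho> \<otimes> \<phi>) = \<rho>'' \<otimes> \<phi> + \<rho> \<otimes> A\<phi>\<close>
    (\<open>Bstar_limit_tensor\<close>). By Du Bois-Reymond, \<open>\<rho>\<close> is the twofold primitive from \<open>T\<close> of its
    second weak derivative (\<open>H2_end_primitive\<close>). Replacing this derivative by continuous
    approximants yields curves in \<open>C2_T\<close> that converge together with their images.

  \<^item> The image is nontrivial (\<open>Bstar_tensor_nonzero\<close>). If \<open>\<rho>'' \<otimes> \<phi> + \<rho> \<otimes> A\<phi> = 0\<close> with \<open>\<phi> \<noteq> 0\<close>,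
    pairing with \<open>\<phi>\<close> gives \<open>\<rho>'' = \<mu> \<rho>\<close> with zero data at \<open>T\<close>, and
    Gronwall's inequality forces \<open>\<rho> = 0\<close>.
\<close>

section \<open>Square-integrable functions and their classes\<close>

lemma square_integrable_rep: "square_integrable (rep_L2 f)"
  using Quotient3_rep_reflp[OF Quotient3_L2, of f] by (simp add: ae_eq_def)

lemma abs_rep_L2: "abs_L2 (rep_L2 f) = f"
  by (rule Quotient3_abs_rep[OF Quotient3_L2])

lemma rep_abs_L2_AE:
  assumes "square_integrable f"
  shows "AE x in lborel. rep_L2 (abs_L2 f) x = f x"
  using Quotient3_rep_abs[OF Quotient3_L2, of f] assms by (simp add: ae_eq_def)

lemma abs_L2_eqI:
  assumes "square_integrable f" "square_integrable g" "AE x in lborel. f x = g x"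
  shows "abs_L2 f = abs_L2 g"
  using Quotient3_rel_abs[OF Quotient3_L2, of f g] assms by (simp add: ae_eq_def)

lemma L2_eqI:
  assumes "AE x in lborel. rep_L2 f x = rep_L2 g x"
  shows "f = g"
  using abs_L2_eqI[OF square_integrable_rep square_integrable_rep assms] by (simp add: abs_rep_L2)

lemma L2_eq_absI:
  assumes "square_integrable g" "AE x in lborel. rep_L2 f x = g x"
  shows "f = abs_L2 g"
  using abs_L2_eqI[OF square_integrable_rep assms] by (simp add: abs_rep_L2)

lemma abs_L2_add:
  "square_integrable f \<Longrightarrow> square_integrable g \<Longrightarrow> abs_L2 f + abs_L2 g = abs_L2 (\<lambda>x. f x + g x)"
  by (rule plus_L2.abs_eq) (simp_all add: ae_eq_def)

lemma abs_L2_scaleR: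
  "square_integrable f \<Longrightarrow> c *\<^sub>R abs_L2 f = abs_L2 (\<lambda>x. c *\<^sub>R f x)"
  by (rule scaleR_L2.abs_eq) (simp_all add: ae_eq_def)

lemma square_integrable_diff:
  assumes "square_integrable f" "square_integrable g"
  shows "square_integrable (\<lambda>x. f x - g x)"
  using square_integrable_add[OF assms(1) square_integrable_scaleR[OF assms(2), of "-1"]] by simp

lemma abs_L2_diff:
  assumes "square_integrable f" "square_integrable g" 
  shows "abs_L2 f - abs_L2 g = abs_L2 (\<lambda>x. f x - g x)"
proof -
  have "abs_L2 f - abs_L2 g = abs_L2 f + (-1) *\<^sub>R abs_L2 g" by simp
  also have "\<dots> = abs_L2 (\<lambda>x. f x - g x)"
    using abs_L2_add[OF assms(1) square_integrable_scaleR[OF assms(2), of "-1"]]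
    by (simp only: abs_L2_scaleR[OF assms(2)]) simp
  finally show ?thesis .
qed

lemma inner_abs_L2:
  "square_integrable f \<Longrightarrow> square_integrable g \<Longrightarrow>
    abs_L2 f \<bullet> abs_L2 g = (\<integral>x. f x \<bullet> g x \<partial>lborel)"
  by (rule inner_L2.abs_eq) (simp_all add: ae_eq_def)

lemma inner_L2_eq: "f \<bullet> g = (\<integral>x. rep_L2 f x \<bullet> rep_L2 g x \<partial>lborel)"
  using inner_abs_L2[OF square_integrable_rep square_integrable_rep, of f g]
  by (simp add: abs_rep_L2)

lemma inner_L2_abs:
  "square_integrable g \<Longrightarrow> f \<bullet> abs_L2 g = (\<integral>x. rep_L2 f x \<bullet> g x \<partial>lborel)"
  using inner_abs_L2[OF square_integrable_rep, of g f] by (simp add: abs_rep_L2)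

lemma norm_L2_eq: "(norm f)\<^sup>2 = (\<integral>x. (norm (rep_L2 f x))\<^sup>2 \<partial>lborel)"
  by (simp add: power2_norm_eq_inner inner_L2_eq)

lemma norm_abs_L2:
  "square_integrable f \<Longrightarrow> (norm (abs_L2 f))\<^sup>2 = (\<integral>x. (norm (f x))\<^sup>2 \<partial>lborel)"
  by (simp add: power2_norm_eq_inner inner_abs_L2)

lemma rep_L2_add_AE: "AE x in lborel. rep_L2 (f + g) x = rep_L2 f x + rep_L2 g x"
  using rep_abs_L2_AE[OF square_integrable_add[OF square_integrable_rep[of f] square_integrable_rep[of g]]]
  by (simp add: abs_L2_add[symmetric] square_integrable_rep abs_rep_L2)

lemma rep_L2_scaleR_AE: "AE x in lborel. rep_L2 (c *\<^sub>R f) x = c *\<^sub>R rep_L2 f x"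
  using rep_abs_L2_AE[OF square_integrable_scaleR[OF square_integrable_rep[of f]], of c]
  by (simp add: abs_L2_scaleR[symmetric] square_integrable_rep abs_rep_L2)

lemma rep_L2_diff_AE: "AE x in lborel. rep_L2 (f - g) x = rep_L2 f x - rep_L2 g x"
  using rep_abs_L2_AE[OF square_integrable_diff[OF square_integrable_rep[of f] square_integrable_rep[of g]]]
  by (simp add: abs_L2_diff[symmetric] square_integrable_rep abs_rep_L2)

lemma zero_L2_abs: "0 = abs_L2 (\<lambda>x. 0)"
proof -
  have "abs_L2 (\<lambda>x. 0) + abs_L2 (\<lambda>x. 0) = abs_L2 (\<lambda>x::'a. 0::'b)"
    by (simp add: abs_L2_add square_integrable_zero)
  then show ?thesis by simp
qed

lemma rep_L2_zero_AE: "AE x in lborel. rep_L2 0 x = 0"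
  using rep_abs_L2_AE[OF square_integrable_zero] by (simp add: zero_L2_abs)

lemma strongly_measurable_borel:
  assumes "f \<in> borel_measurable (borel :: 'a::euclidean_space measure)"
  shows "strongly_measurable (f :: 'a \<Rightarrow> real)"
proof -
  obtain s where "\<And>i. simple_function lborel (s i)" "\<And>x. x \<in> space lborel \<Longrightarrow> (\<lambda>i. s i x) \<longlonglongrightarrow> f x"
    using borel_measurable_implies_sequence_metric[of f lborel 0] assms by auto
  then show ?thesis unfolding strongly_measurable_def by auto
qed

lemma borel_measurable_strongly:
  assumes "strongly_measurable (f :: 'a::euclidean_space \<Rightarrow> real)"
  shows "f \<in> borel_measurable borel"
  using borel_measurable_inner_strongly[OF assms strongly_measurable_const[of 1]] by simp

lemma square_integrable_real_iff:
  "square_integrable (f :: 'a::euclidean_space \<Rightarrow> real) \<longleftrightarrow>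
     f \<in> borel_measurable borel \<and> integrable lborel (\<lambda>x. (f x)\<^sup>2)"
proof -
  have "strongly_measurable f \<longleftrightarrow> f \<in> borel_measurable borel"
    using borel_measurable_strongly strongly_measurable_borel by blast
  then show ?thesis by (simp add: square_integrable_def)
qed

lemma rep_L2_measurable [measurable]:
  "rep_L2 (f :: ('a::euclidean_space, real) L2) \<in> borel_measurable borel"
  using square_integrable_rep[of f] by (simp add: square_integrable_real_iff)

lemma square_integrable_bounded_support:
  fixes f :: "'a::euclidean_space \<Rightarrow> real"
  assumes "f \<in> borel_measurable borel" "bounded S" "\<And>x. x \<notin> S \<Longrightarrow> f x = 0" "\<And>x. \<bar>f x\<bar> \<le> M"
  shows "square_integrable f"
proof -
  obtain a where S: "S \<subseteq> cbox (-a) a" using bounded_subset_cbox_symmetric[OF assms(2)] by blast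
  have "integrable lborel (\<lambda>x. M\<^sup>2 *\<^sub>R indicat_real (cbox (-a) a) x)"
    by (intro integrable_scaleR_right integrable_real_indicator) (auto simp: emeasure_lborel_cbox_eq)
  then have "integrable lborel (\<lambda>x. (f x)\<^sup>2)"
  proof (rule Bochner_Integration.integrable_bound)
    show "AE x in lborel. norm ((f x)\<^sup>2) \<le> norm (M\<^sup>2 *\<^sub>R indicat_real (cbox (-a) a) x)"
    proof (rule AE_I2)
      fix x
      have "(f x)\<^sup>2 \<le> M\<^sup>2" using assms(4)[of x] by (intro abs_le_square_iff[THEN iffD1]) linarith
      then show "norm ((f x)\<^sup>2) \<le> norm (M\<^sup>2 *\<^sub>R indicat_real (cbox (-a) a) x)"
        using S assms(3)[of x] by (cases "x \<in> cbox (-a) a") auto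
    qed
  qed (use assms(1) in measurable)
  then show ?thesis using assms(1) by (simp add: square_integrable_real_iff)
qed

text \<open>
  The usual subsequence argument, applied to the real functions \<open>\<parallel>w\<^sub>n(x) - l(x)\<parallel>\<^sup>2\<close>, which tend to zero
  in \<open>L\<^sub>1\<close>. The values may therefore lie in any inner product space, in particular in
  \<open>L\<^sub>2(\<Omega>)\<close>.
\<close>

lemma L2_convergence_AE_subseq:
  assumes "w \<longlonglongrightarrow> (l :: ('x::euclidean_space, 'h::real_inner) L2)"
  obtains r where "strict_mono r"
    "AE x in lborel. (\<lambda>n. rep_L2 (w (r n)) x) \<longlonglongrightarrow> rep_L2 l x"
proof -
  let ?u = "\<lambda>n x. (norm (rep_L2 (w n - l) x))\<^sup>2"
  have "(\<lambda>n. (norm (w n - l))\<^sup>2) \<longlonglongrightarrow> 0\<^sup>2"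
    by (intro tendsto_power) (use assms in \<open>simp add: LIM_zero tendsto_norm_zero\<close>)
  then have lim: "(\<lambda>n. \<integral>x. norm (?u n x) \<partial>lborel) \<longlonglongrightarrow> 0"
    by (simp add: norm_L2_eq)
  have int: "integrable lborel (?u n)" for n
    using square_integrable_rep[of "w n - l"] by (simp add: square_integrable_def)
  obtain r where r: "strict_mono r" "AE x in lborel. (\<lambda>n. ?u (r n) x) \<longlonglongrightarrow> 0"
    using tendsto_L1_AE_subseq[OF int lim] by blast
  have "AE x in lborel. \<forall>n. rep_L2 (w n - l) x = rep_L2 (w n) x - rep_L2 l x"
    by (simp add: AE_all_countable rep_L2_diff_AE)
  then have "AE x in lborel. (\<lambda>n. rep_L2 (w (r n)) x) \<longlonglongrightarrow> rep_L2 l x"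
    using r(2)
  proof eventually_elim
    case (elim x)
    then have "(\<lambda>n. sqrt (?u (r n) x)) \<longlonglongrightarrow> sqrt 0" by (intro tendsto_real_sqrt) simp
    then have "(\<lambda>n. norm (rep_L2 (w (r n)) x - rep_L2 l x)) \<longlonglongrightarrow> 0" using elim by simp
    then show ?case using LIM_zero_iff tendsto_norm_zero_iff by blast
  qed
  then show ?thesis using r(1) that by blast
qed

lemma subspace_L2_on: "subspace (L2_on S)"
  unfolding subspace_def L2_on_def
proof (intro conjI ballI allI)
  show "0 \<in> {f. AE x in lborel. x \<notin> S \<longrightarrow> rep_L2 f x = 0}"
    using rep_L2_zero_AE by (auto elim: eventually_mono)
next
  fix f g :: "('a, 'b) L2"
  assume "f \<in> {f. AE x in lborel. x \<notin> S \<longrightarrow> rep_L2 f x = 0}" "g \<in> {f. AE x in lborel. x \<notin> S \<longrightarrow> rep_L2 f x = 0}"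
  then have "AE x in lborel. x \<notin> S \<longrightarrow> rep_L2 f x = 0" "AE x in lborel. x \<notin> S \<longrightarrow> rep_L2 g x = 0" by auto
  then have "AE x in lborel. x \<notin> S \<longrightarrow> rep_L2 (f + g) x = 0"
    using rep_L2_add_AE[of f g] by eventually_elim auto
  then show "f + g \<in> {f. AE x in lborel. x \<notin> S \<longrightarrow> rep_L2 f x = 0}" by simp
next
  fix c :: real and f :: "('a, 'b) L2"
  assume "f \<in> {f. AE x in lborel. x \<notin> S \<longrightarrow> rep_L2 f x = 0}"
  then have "AE x in lborel. x \<notin> S \<longrightarrow> rep_L2 f x = 0" by auto
  then have "AE x in lborel. x \<notin> S \<longrightarrow> rep_L2 (c *\<^sub>R f) x = 0"
    using rep_L2_scaleR_AE[of c f] by eventually_elim auto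
  then show "c *\<^sub>R f \<in> {f. AE x in lborel. x \<notin> S \<longrightarrow> rep_L2 f x = 0}" by simp
qed

text \<open>
  Vanishing outside \<open>S\<close> passes to almost everywhere limits, hence to \<open>L\<^sub>2\<close> limits.
\<close>

lemma L2_on_LIMSEQ:
  assumes "\<And>n. w n \<in> L2_on S" "w \<longlonglongrightarrow> l"
  shows "l \<in> L2_on S"
proof -
  obtain r where r: "AE x in lborel. (\<lambda>n. rep_L2 (w (r n)) x) \<longlonglongrightarrow> rep_L2 l x"
    using L2_convergence_AE_subseq[OF assms(2)] by blast
  have "AE x in lborel. \<forall>n. x \<notin> S \<longrightarrow> rep_L2 (w n) x = 0"
    using assms(1) unfolding L2_on_def mem_Collect_eq AE_all_countable by blast
  with r have "AE x in lborel. x \<notin> S \<longrightarrow> rep_L2 l x = 0"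
    by eventually_elim (auto simp: LIMSEQ_const_iff)
  then show ?thesis by (simp add: L2_on_def)
qed

lemma subspace_Bochner_L2: "subspace (Bochner_L2 T \<Omega>)"
proof -
  have "subspace {w :: (real, ('a, real) L2) L2. AE t in lborel. rep_L2 w t \<in> L2_on \<Omega>}"
    unfolding subspace_def mem_Collect_eq
  proof (intro conjI ballI allI)
    show "AE t in lborel. rep_L2 (0 :: (real, ('a, real) L2) L2) t \<in> L2_on \<Omega>"
      using rep_L2_zero_AE[where 'a=real and 'b="('a, real) L2"]
      by eventually_elim (simp add: subspace_0[OF subspace_L2_on])
  next
    fix f g :: "(real, ('a, real) L2) L2"
    assume "f \<in> {w. AE t in lborel. rep_L2 w t \<in> L2_on \<Omega>}" "g \<in> {w. AE t in lborel. rep_L2 w t \<in> L2_on \<Omega>}"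
    then have "AE t in lborel. rep_L2 f t \<in> L2_on \<Omega>" "AE t in lborel. rep_L2 g t \<in> L2_on \<Omega>" by auto
    then show "AE t in lborel. rep_L2 (f + g) t \<in> L2_on \<Omega>"
      using rep_L2_add_AE[of f g] by eventually_elim (auto intro: subspace_add[OF subspace_L2_on])
  next
    fix c :: real and f :: "(real, ('a, real) L2) L2"
    assume "f \<in> {w. AE t in lborel. rep_L2 w t \<in> L2_on \<Omega>}"
    then have "AE t in lborel. rep_L2 f t \<in> L2_on \<Omega>" by auto
    then show "AE t in lborel. rep_L2 (c *\<^sub>R f) t \<in> L2_on \<Omega>"
      using rep_L2_scaleR_AE[of c f] by eventually_elim (auto intro: subspace_scale[OF subspace_L2_on])
  qed
  moreover have "Bochner_L2 T \<Omega> = L2_on {0<..<T} \<inter> {w. AE t in lborel. rep_L2 w t \<in> L2_on \<Omega>}"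
    by (auto simp: Bochner_L2_def)
  ultimately show ?thesis by (simp add: subspace_inter subspace_L2_on)
qed

text \<open>
  The same argument one level up: almost every value of the limit is an \<open>L\<^sub>2\<close> limit of values in
  \<open>L\<^sub>2(\<Omega>)\<close>.
\<close>

lemma Bochner_L2_LIMSEQ:
  assumes "\<And>n. w n \<in> Bochner_L2 T \<Omega>" "w \<longlonglongrightarrow> l"
  shows "l \<in> Bochner_L2 T \<Omega>"
proof -
  obtain r where r: "AE t in lborel. (\<lambda>n. rep_L2 (w (r n)) t) \<longlonglongrightarrow> rep_L2 l t"
    using L2_convergence_AE_subseq[OF assms(2)] by blast
  have "AE t in lborel. \<forall>n. rep_L2 (w n) t \<in> L2_on \<Omega>"
    using assms(1) by (simp add: AE_all_countable Bochner_L2_def)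
  with r have "AE t in lborel. rep_L2 l t \<in> L2_on \<Omega>"
    by eventually_elim (auto intro: L2_on_LIMSEQ)
  moreover have "l \<in> L2_on {0<..<T}"
    by (rule L2_on_LIMSEQ[OF _ assms(2)]) (use assms(1) in \<open>simp add: Bochner_L2_def\<close>)
  ultimately show ?thesis by (simp add: Bochner_L2_def)
qed

text \<open>
  The range space need not be separable, so Borel measurability would not be enough here.
  Continuity is used to exhibit simple approximants: the curve is sampled at the grid points \<open>\<lfloor>(n+1)t\<rfloor>/(n+1)\<close>.
\<close>

lemma strongly_measurable_interval_curve:
  fixes f :: "real \<Rightarrow> 'h::real_inner"
  assumes f: "continuous_on {0..T} f"
  shows "strongly_measurable (\<lambda>t. indicator {0<..<T} t *\<^sub>R f t)"
proof -
  define h :: "nat \<Rightarrow> real \<Rightarrow> int" where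
    "h n t = (if t \<in> {0<..<T} then \<lfloor>real (Suc n) * t\<rfloor> else -1)" for n t
  define s where "s n t = (if h n t = -1 then 0 else f (real_of_int (h n t) / real (Suc n)))" for n t
  \<comment> \<open>The value -1 marks points outside the interval, where the sample is set to zero.\<close>
  have h_range: "h n ` UNIV \<subseteq> insert (-1) {0..\<lfloor>real (Suc n) * T\<rfloor>}" for n
  proof (rule image_subsetI)
    fix t
    have "real (Suc n) * t \<le> real (Suc n) * T" "0 \<le> real (Suc n) * t" if "t \<in> {0<..<T}"
      using that by (auto intro: mult_left_mono simp del: of_nat_Suc)
    then show "h n t \<in> insert (-1) {0..\<lfloor>real (Suc n) * T\<rfloor>}"
      unfolding h_def by (cases "t \<in> {0<..<T}") (simp_all add: floor_mono del: of_nat_Suc)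
  qed
  have "simple_function lborel (h n)" for n
    unfolding simple_function_def
  proof (intro conjI ballI)
    show "finite (h n ` space lborel)"
      using finite_subset[OF h_range] by simp
    have [measurable]: "h n \<in> measurable borel (count_space UNIV)"
      unfolding h_def by measurable
    show "h n -` {k} \<inter> space lborel \<in> sets lborel" for k
      using measurable_sets[of "h n" borel "count_space UNIV" "{k}"] by simp
  qed
  then have "simple_function lborel (s n)" for n
    unfolding s_def by (rule simple_function_compose1[where g="\<lambda>k. if k = -1 then 0 else f (real_of_int k / real (Suc n))"])
  moreover have "(\<lambda>n. s n t) \<longlonglongrightarrow> indicator {0<..<T} t *\<^sub>R f t" for t
  proof (cases "t \<in> {0<..<T}")
    case False
    then have "s n t = indicator {0<..<T} t *\<^sub>R f t" for n by (auto simp: s_def h_def indicator_def)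
    then show ?thesis by simp
  next
    case True
    define k where "k n = real_of_int \<lfloor>real (Suc n) * t\<rfloor> / real (Suc n)" for n
    have h0: "\<lfloor>real (Suc n) * t\<rfloor> \<ge> 0" for n using True by simp
    have s_eq: "s n t = f (k n)" for n
    proof -
      have "h n t = \<lfloor>real (Suc n) * t\<rfloor>" using True by (simp add: h_def del: of_nat_Suc)
      then have "h n t \<noteq> -1" "k n = real_of_int (h n t) / real (Suc n)" using h0[of n] by (linarith, simp add: k_def)
      then show ?thesis by (simp add: s_def)
    qed
    have k_le: "k n \<le> t" for n
      using of_int_floor_le[of "real (Suc n) * t"] by (simp add: k_def divide_le_eq mult.commute del: of_nat_Suc)
    have k_ge: "k n \<ge> t - 1 / real (Suc n)" for n
    proof -
      have "real (Suc n) * t - 1 \<le> real_of_int \<lfloor>real (Suc n) * t\<rfloor>" by linarith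
      then have "(real (Suc n) * t - 1) / real (Suc n) \<le> k n" unfolding k_def by (rule divide_right_mono) simp
      then show ?thesis by (simp add: diff_divide_distrib del: of_nat_Suc)
    qed
    have "(\<lambda>n. t - 1 / real (Suc n)) \<longlonglongrightarrow> t - 0"
      by (intro tendsto_diff tendsto_const) (rule LIMSEQ_Suc[OF lim_1_over_n])
    then have "k \<longlonglongrightarrow> t"
      by (intro tendsto_sandwich[of "\<lambda>n. t - 1 / real (Suc n)" k _ "\<lambda>_. t"]) (auto simp: k_ge k_le simp del: of_nat_Suc)
    moreover have "k n \<in> {0..T}" for n using h0[of n] k_le[of n] True by (auto simp: k_def)
    ultimately have "(\<lambda>n. f (k n)) \<longlonglongrightarrow> f t"
      using f True by (auto intro!: continuous_on_tendsto_compose[OF f])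
    then show ?thesis using True by (simp add: s_eq)
  qed
  ultimately show ?thesis unfolding strongly_measurable_def by blast
qed

lemma square_integrable_interval_curve:
  fixes f :: "real \<Rightarrow> 'h::real_inner"
  assumes f: "continuous_on {0..T} f"
  shows "square_integrable (\<lambda>t. indicator {0<..<T} t *\<^sub>R f t)"
proof -
  let ?g = "\<lambda>t. indicator {0<..<T} t *\<^sub>R f t"
  have sm: "strongly_measurable ?g" by (rule strongly_measurable_interval_curve[OF f])
  obtain M where M: "\<And>t. t \<in> {0..T} \<Longrightarrow> norm (f t) \<le> M"
    using compact_imp_bounded[OF compact_continuous_image[OF f compact_Icc]]
    unfolding bounded_iff by (metis imageI)
  have "integrable lborel (\<lambda>t. M\<^sup>2 *\<^sub>R indicat_real {0<..<T} t)"
    by (intro integrable_scaleR_right integrable_real_indicator)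
       (use emeasure_bounded_finite[of "{0<..<T}"] in auto)
  then have "integrable lborel (\<lambda>t. (norm (?g t))\<^sup>2)"
  proof (rule Bochner_Integration.integrable_bound)
    show "(\<lambda>t. (norm (?g t))\<^sup>2) \<in> borel_measurable lborel"
      using borel_measurable_inner_strongly[OF sm sm] by (simp only: power2_norm_eq_inner)
    show "AE t in lborel. norm ((norm (?g t))\<^sup>2) \<le> norm (M\<^sup>2 *\<^sub>R indicat_real {0<..<T} t)"
      using M by (intro AE_I2) (auto simp: indicator_def intro!: power_mono)
  qed
  with sm show ?thesis by (simp add: square_integrable_def)
qed

section \<open>Smooth cutoff functions\<close>

lemma C_k_SucI:
  assumes "\<And>x. (f has_derivative f' x) (at x)" "\<And>i. i \<in> Basis \<Longrightarrow> C_k k (\<lambda>x. f' x i)"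
  shows "C_k (Suc k) f"
proof -
  have "frechet_derivative f (at x) = f' x" for x
    using frechet_derivative_at[OF assms(1)] by simp
  then show ?thesis using assms by (auto simp: differentiable_def)
qed

lemma C_k_has_derivative:
  "C_k (Suc k) f \<Longrightarrow> (f has_derivative frechet_derivative f (at x)) (at x)"
  by (simp add: frechet_derivative_works)

lemma C_k_continuous: "C_k k f \<Longrightarrow> continuous_on UNIV f"
  by (cases k) (auto intro!: differentiable_imp_continuous_on simp: differentiable_on_def)

lemma C_k_Suc_imp: "C_k (Suc k) f \<Longrightarrow> C_k k f"
proof (induction k arbitrary: f)
  case 0
  show ?case using C_k_continuous[OF 0] by simp
next
  case (Suc k)
  then show ?case by simp
qed

lemma C_k_const: "C_k k (\<lambda>x. c)"
  by (induction k arbitrary: c) (auto intro!: C_k_SucI[where f'="\<lambda>x h. 0"] derivative_eq_intros simp del: C_k.simps(2))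

lemma C_k_add: "C_k k f \<Longrightarrow> C_k k g \<Longrightarrow> C_k k (\<lambda>x. f x + g x)"
proof (induction k arbitrary: f g)
  case 0
  then show ?case by (auto intro: continuous_intros)
next
  case (Suc k)
  show ?case
  proof (rule C_k_SucI)
    show "((\<lambda>x. f x + g x) has_derivative
        (\<lambda>h. frechet_derivative f (at x) h + frechet_derivative g (at x) h)) (at x)" for x
      by (intro has_derivative_add C_k_has_derivative[OF Suc.prems(1)] C_k_has_derivative[OF Suc.prems(2)])
    show "C_k k (\<lambda>x. frechet_derivative f (at x) i + frechet_derivative g (at x) i)" if "i \<in> Basis" for i
      using Suc.prems that by (intro Suc.IH) auto
  qed
qed

lemma C_k_mult: "C_k k f \<Longrightarrow> C_k k g \<Longrightarrow> C_k k (\<lambda>x. f x * g x)"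
proof (induction k arbitrary: f g)
  case 0
  then show ?case by (auto intro: continuous_intros)
next
  case (Suc k)
  show ?case
  proof (rule C_k_SucI)
    show "((\<lambda>x. f x * g x) has_derivative
        (\<lambda>h. f x * frechet_derivative g (at x) h + frechet_derivative f (at x) h * g x)) (at x)" for x
      by (intro has_derivative_mult C_k_has_derivative[OF Suc.prems(1)] C_k_has_derivative[OF Suc.prems(2)])
    show "C_k k (\<lambda>x. f x * frechet_derivative g (at x) i + frechet_derivative f (at x) i * g x)"
      if "i \<in> Basis" for i
      using Suc.prems[THEN C_k_Suc_imp] Suc.prems that by (intro C_k_add Suc.IH) auto
  qed
qed

lemma C_k_prod: "(\<And>i. i \<in> I \<Longrightarrow> C_k k (f i)) \<Longrightarrow> C_k k (\<lambda>x. \<Prod>i\<in>I. f i x)"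
  by (induction I rule: infinite_finite_induct) (auto intro: C_k_const C_k_mult)

text \<open>
  The derivative of \<open>exp \<circ> f\<close> again contains the factor \<open>exp \<circ> f\<close>, so the product rule closes
  the induction.
\<close>

lemma C_k_exp: "C_k k f \<Longrightarrow> C_k k (\<lambda>x. exp (f x))"
proof (induction k arbitrary: f)
  case 0
  then show ?case by (auto intro: continuous_intros)
next
  case (Suc k)
  show ?case
  proof (rule C_k_SucI)
    show "((\<lambda>x. exp (f x)) has_derivative (\<lambda>h. exp (f x) * frechet_derivative f (at x) h)) (at x)" for x
      by (auto intro!: derivative_eq_intros C_k_has_derivative[OF Suc.prems] simp del: C_k.simps)
    show "C_k k (\<lambda>x. exp (f x) * frechet_derivative f (at x) i)" if "i \<in> Basis" for i
      using C_k_Suc_imp[OF Suc.prems] Suc.prems that by (intro C_k_mult Suc.IH) auto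
  qed
qed

text \<open>
  The functions \<open>x\<^sup>-\<^sup>n exp(-1/x)\<close>, extended by zero to \<open>x \<le> 0\<close>. The span of the family is
  closed under differentiation, which makes every member smooth.
\<close>

definition flat :: "nat \<Rightarrow> real \<Rightarrow> real" where
  "flat n x = (if x > 0 then inverse x ^ n / exp (inverse x) else 0)"

lemma flat_tendsto_0: "(flat n \<longlongrightarrow> 0) (at 0)"
proof -
  have "(flat n \<longlongrightarrow> 0) (at_left 0)"
    by (rule tendsto_eventually) (auto simp: flat_def eventually_at_filter)
  moreover have "(flat n \<longlongrightarrow> 0) (at_right 0)"
  proof (rule Lim_transform_eventually)
    show "((\<lambda>x. inverse x ^ n / exp (inverse x)) \<longlongrightarrow> (0::real)) (at_right 0)"
      by (rule filterlim_compose[OF tendsto_power_div_exp_0 filterlim_inverse_at_top_right])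
    show "\<forall>\<^sub>F x in at_right 0. inverse x ^ n / exp (inverse x) = flat n x"
      by (auto simp: flat_def eventually_at_filter)
  qed
  ultimately show ?thesis by (simp add: filterlim_at_split)
qed

lemma flat_DERIV: "(flat n has_real_derivative flat (n + 2) x - n * flat (n + 1) x) (at x)"
proof (cases x "0::real" rule: linorder_cases)
  case equal
  \<comment> \<open>The difference quotient at zero is the next member of the family.\<close>
  have "(\<lambda>y. (flat n y - flat n 0) / (y - 0)) = flat (n + 1)"
    by (auto simp: flat_def fun_eq_iff field_simps)
  then show ?thesis using equal flat_tendsto_0[of "n + 1"]
    by (simp add: has_field_derivative_iff flat_def[of _ 0])
next
  case less
  have "(flat n has_real_derivative 0) (at x)"
  proof (rule DERIV_cong_ev[THEN iffD2, OF refl _ refl])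
    show "((\<lambda>_. 0) has_real_derivative 0) (at x)" by simp
    show "\<forall>\<^sub>F y in nhds x. flat n y = 0"
      using less by (auto simp: flat_def eventually_nhds intro!: exI[of _ "{..<0}"])
  qed
  then show ?thesis using less by (simp add: flat_def[of _ x])
next
  case greater
  have "((\<lambda>x. inverse x ^ n / exp (inverse x)) has_real_derivative flat (n + 2) x - n * flat (n + 1) x) (at x)"
    using greater
  proof (cases n)
    case 0
    then show ?thesis using greater
      by (auto intro!: derivative_eq_intros simp: flat_def divide_simps power2_eq_square)
  next
    case (Suc m)
    show ?thesis unfolding Suc using greater
      by (auto intro!: derivative_eq_intros simp: flat_def divide_simps power2_eq_square)
         (cases m; simp add: algebra_simps)
  qed
  moreover have ev: "\<forall>\<^sub>F y in nhds x. flat n y = inverse y ^ n / exp (inverse y)"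
    using greater by (auto simp: flat_def eventually_nhds intro!: exI[of _ "{0<..}"])
  ultimately show ?thesis using DERIV_cong_ev[OF refl ev refl] by blast
qed

lemma C_k_flat_affine: "C_k k (\<lambda>x. flat n (s * (x \<bullet> j) + c))"
proof (induction k arbitrary: n)
  case 0
  have "continuous_on UNIV (flat n)"
    by (intro continuous_at_imp_continuous_on ballI DERIV_isCont[OF flat_DERIV])
  then have "continuous_on UNIV (\<lambda>x. flat n (s * (x \<bullet> j) + c))"
    by (rule continuous_on_compose2) (auto intro!: continuous_intros)
  then show ?case by simp
next
  case (Suc k)
  show ?case
  proof (rule C_k_SucI)
    show "((\<lambda>x. flat n (s * (x \<bullet> j) + c)) has_derivative
       (\<lambda>h. (flat (n + 2) (s * (x \<bullet> j) + c) + - real n * flat (n + 1) (s * (x \<bullet> j) + c)) * (s * (h \<bullet> j)))) (at x)" for x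
      by (rule has_derivative_eq_rhs, rule DERIV_compose_FDERIV[OF flat_DERIV])
         (auto intro!: derivative_eq_intros simp: fun_eq_iff algebra_simps)
    show "C_k k (\<lambda>x. (flat (n + 2) (s * (x \<bullet> j) + c) + - real n * flat (n + 1) (s * (x \<bullet> j) + c)) * (s * (i \<bullet> j)))" for i
      by (intro C_k_mult C_k_add C_k_const Suc.IH)
  qed
qed

definition box_bump :: "'a::euclidean_space \<Rightarrow> 'a \<Rightarrow> 'a \<Rightarrow> real" where
  "box_bump a b x = (\<Prod>i\<in>Basis. flat 0 (x \<bullet> i - a \<bullet> i) * flat 0 (b \<bullet> i - x \<bullet> i))"

text \<open>
  For \<open>n \<longrightarrow> \<infinity>\<close> these smooth functions increase to the indicator function of the open box and
  vanish outside it.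
\<close>

definition box_cutoff :: "nat \<Rightarrow> 'a::euclidean_space \<Rightarrow> 'a \<Rightarrow> 'a \<Rightarrow> real" where
  "box_cutoff n a b x = 1 - exp (- real n * box_bump a b x)"

lemma box_bump_pos: "x \<in> box a b \<Longrightarrow> box_bump a b x > 0"
  unfolding box_bump_def by (intro prod_pos) (auto simp: flat_def mem_box)

lemma box_bump_outside: "x \<notin> box a b \<Longrightarrow> box_bump a b x = 0"
  unfolding box_bump_def by (rule prod_zero) (auto simp: flat_def mem_box)

lemma box_bump_nonneg: "box_bump a b x \<ge> 0"
  by (cases "x \<in> box a b") (auto simp: box_bump_outside less_imp_le box_bump_pos)

lemma C_k_box_cutoff: "C_k k (box_cutoff n a b)"
proof -
  have "C_k k (\<lambda>x. flat 0 (x \<bullet> i - a \<bullet> i) * flat 0 (b \<bullet> i - x \<bullet> i))" for i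
    using C_k_mult[OF C_k_flat_affine[of k 0 1 i "- (a \<bullet> i)"] C_k_flat_affine[of k 0 "-1" i "b \<bullet> i"]]
    by simp
  then have "C_k k (box_bump a b)" unfolding box_bump_def[abs_def] by (rule C_k_prod)
  then have "C_k k (\<lambda>x. 1 + (- 1) * exp (- real n * box_bump a b x))"
    by (intro C_k_add C_k_mult C_k_const C_k_exp)
  then show ?thesis by (simp add: box_cutoff_def[abs_def])
qed

lemma box_cutoff_bounds: "0 \<le> box_cutoff n a b x" "box_cutoff n a b x \<le> 1"
  using box_bump_nonneg[of a b x] by (auto simp: box_cutoff_def)

lemma box_cutoff_outside: "x \<notin> box a b \<Longrightarrow> box_cutoff n a b x = 0"
  by (simp add: box_cutoff_def box_bump_outside)

lemma box_cutoff_tendsto: "(\<lambda>n. box_cutoff n a b x) \<longlonglongrightarrow> indicator (box a b) x"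
proof (cases "x \<in> box a b")
  case True
  then have pos: "box_bump a b x > 0" by (rule box_bump_pos)
  have "filterlim (\<lambda>n. box_bump a b x * real n) at_top sequentially"
    by (rule filterlim_tendsto_pos_mult_at_top[OF tendsto_const pos filterlim_real_sequentially])
  then have "(\<lambda>n. exp (- (box_bump a b x * real n))) \<longlonglongrightarrow> 0"
    by (intro filterlim_compose[OF exp_at_bot]) (simp add: filterlim_uminus_at_bot)
  then have "(\<lambda>n. 1 - exp (- (box_bump a b x * real n))) \<longlonglongrightarrow> 1 - 0"
    by (intro tendsto_intros)
  then show ?thesis using True by (simp add: box_cutoff_def mult.commute)
qed (simp add: box_cutoff_outside)

section \<open>Test functions\<close>

lemma test_functionI:
  assumes "\<And>k. C_k k \<psi>" "compact K" "K \<subseteq> S" "\<And>x. x \<notin> K \<Longrightarrow> \<psi> x = 0"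
  shows "\<psi> \<in> test_functions S"
proof -
  have "closure {x. \<psi> x \<noteq> 0} \<subseteq> K"
    using assms(2,4) by (intro closure_minimal compact_imp_closed) auto
  moreover from this have "compact (closure {x. \<psi> x \<noteq> 0})"
    using assms(2) by (meson bounded_subset closed_closure compact_eq_bounded_closed)
  ultimately show ?thesis using assms(1,3) by (auto simp: test_functions_def)
qed

text \<open>
  Off the support not only the function but also its derivatives vanish, since the complement of
  the support is open.
\<close>

lemma test_functionE:
  assumes "\<psi> \<in> test_functions S"
  obtains K where "compact K" "K \<subseteq> S" "\<And>x. x \<notin> K \<Longrightarrow> \<psi> x = 0"
    "\<And>x i. x \<notin> K \<Longrightarrow> frechet_derivative \<psi> (at x) i = 0"
proof
  let ?K = "closure {x. \<psi> x \<noteq> 0}"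
  show "compact ?K" "?K \<subseteq> S" using assms by (auto simp: test_functions_def)
  show "\<psi> x = 0" if "x \<notin> ?K" for x using that closure_subset[of "{x. \<psi> x \<noteq> 0}"] by auto
  show "frechet_derivative \<psi> (at x) i = 0" if "x \<notin> ?K" for x i
  proof -
    have "(\<psi> has_derivative (\<lambda>h. 0)) (at x)"
    proof (rule has_derivative_transform_within_open)
      show "((\<lambda>_. 0) has_derivative (\<lambda>h. 0)) (at x)" by simp
      show "open (- ?K)" by auto
      show "x \<in> - ?K" using that by simp
      show "0 = \<psi> y" if "y \<in> - ?K" for y
        using that closure_subset[of "{x. \<psi> x \<noteq> 0}"] by auto
    qed
    then show ?thesis by (simp add: frechet_derivative_at[symmetric])
  qed
qed

lemma box_cutoff_test_function:
  "cbox a b \<subseteq> S \<Longrightarrow> box_cutoff n a b \<in> test_functions S"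
  by (rule test_functionI[of _ "cbox a b"])
     (use box_subset_cbox[of a b] in \<open>auto intro!: C_k_box_cutoff box_cutoff_outside\<close>)

lemma test_function_C_k: "\<psi> \<in> test_functions S \<Longrightarrow> C_k k \<psi>"
  by (simp add: test_functions_def)

lemma test_function_has_derivative:
  "\<psi> \<in> test_functions S \<Longrightarrow> (\<psi> has_derivative frechet_derivative \<psi> (at x)) (at x)"
  by (rule C_k_has_derivative[OF test_function_C_k])

lemma test_function_partial:
  assumes "\<psi> \<in> test_functions S" "i \<in> Basis"
  shows "(\<lambda>x. frechet_derivative \<psi> (at x) i) \<in> test_functions S"
proof -
  obtain K where K: "compact K" "K \<subseteq> S" "\<And>x. x \<notin> K \<Longrightarrow> \<psi> x = 0"
    "\<And>x i. x \<notin> K \<Longrightarrow> frechet_derivative \<psi> (at x) i = 0"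
    using test_functionE[OF assms(1)] by blast
  show ?thesis
  proof (rule test_functionI)
    show "C_k k (\<lambda>x. frechet_derivative \<psi> (at x) i)" for k
      using test_function_C_k[OF assms(1), of "Suc k"] assms(2) by simp
  qed (use K in auto)
qed

lemma test_function_add:
  assumes "\<psi> \<in> test_functions S" "\<eta> \<in> test_functions S"
  shows "(\<lambda>x. \<psi> x + \<eta> x) \<in> test_functions S"
proof -
  obtain K L where "compact K" "K \<subseteq> S" "\<And>x. x \<notin> K \<Longrightarrow> \<psi> x = 0"
    "compact L" "L \<subseteq> S" "\<And>x. x \<notin> L \<Longrightarrow> \<eta> x = 0"
    using test_functionE[OF assms(1)] test_functionE[OF assms(2)] by metis
  then show ?thesis
    using assms by (intro test_functionI[of _ "K \<union> L"] C_k_add) (auto simp: test_function_C_k)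
qed

lemma test_function_scale:
  assumes "\<psi> \<in> test_functions S"
  shows "(\<lambda>x. c * \<psi> x) \<in> test_functions S"
proof -
  obtain K where "compact K" "K \<subseteq> S" "\<And>x. x \<notin> K \<Longrightarrow> \<psi> x = 0"
    using test_functionE[OF assms(1)] by metis
  then show ?thesis
    using assms by (intro test_functionI[of _ K] C_k_mult C_k_const) (auto simp: test_function_C_k)
qed

lemma test_function_continuous: "\<psi> \<in> test_functions S \<Longrightarrow> continuous_on A \<psi>"
  using C_k_continuous[OF test_function_C_k] continuous_on_subset by blast

lemma test_function_bounded:
  assumes "\<psi> \<in> test_functions S"
  obtains M where "M \<ge> 0" "\<And>x. \<bar>\<psi> x\<bar> \<le> M"
proof -
  obtain K where K: "compact K" "\<And>x. x \<notin> K \<Longrightarrow> \<psi> x = 0"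
    using test_functionE[OF assms(1)] by metis
  have "bounded (\<psi> ` K)"
    by (intro compact_imp_bounded compact_continuous_image test_function_continuous[OF assms] K)
  then obtain M where "\<forall>x\<in>K. \<bar>\<psi> x\<bar> \<le> M" by (auto simp: bounded_iff)
  then have "\<bar>\<psi> x\<bar> \<le> max M 0" for x by (cases "x \<in> K") (auto simp: K)
  then show ?thesis using that[of "max M 0"] by simp
qed

lemma test_function_measurable: "\<psi> \<in> test_functions S \<Longrightarrow> \<psi> \<in> borel_measurable borel"
  by (rule borel_measurable_continuous_onI[OF test_function_continuous])

lemma test_function_square_integrable:
  assumes "\<psi> \<in> test_functions S"
  shows "square_integrable \<psi>"
proof -
  obtain K where K: "compact K" "\<And>x. x \<notin> K \<Longrightarrow> \<psi> x = 0"
    using test_functionE[OF assms(1)] by metis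
  obtain M where "\<And>x. \<bar>\<psi> x\<bar> \<le> M" using test_function_bounded[OF assms] by blast
  then show ?thesis
    using K by (intro square_integrable_bounded_support[of _ K M] test_function_measurable[OF assms])
      (auto intro: compact_imp_bounded)
qed

lemma test_function_L2_on:
  assumes "\<psi> \<in> test_functions S"
  shows "abs_L2 \<psi> \<in> L2_on S"
proof -
  obtain K where K: "K \<subseteq> S" "\<And>x. x \<notin> K \<Longrightarrow> \<psi> x = 0"
    using test_functionE[OF assms(1)] by metis
  have "AE x in lborel. x \<notin> S \<longrightarrow> rep_L2 (abs_L2 \<psi>) x = 0"
    using rep_abs_L2_AE[OF test_function_square_integrable[OF assms]]
    by eventually_elim (use K in auto)
  then show ?thesis by (simp add: L2_on_def)
qed

text \<open>
  Weak derivatives as an identity between inner products in \<open>L\<^sub>2\<close>: in this form it is visibly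
  linear and continuous in the pair of functions.
\<close>

lemma is_weak_partial_iff:
  assumes "i \<in> Basis"
  shows "is_weak_partial S i f g \<longleftrightarrow> f \<in> L2_on S \<and> g \<in> L2_on S \<and>
    (\<forall>\<psi>\<in>test_functions S.
      f \<bullet> abs_L2 (\<lambda>x. frechet_derivative \<psi> (at x) i) = - (g \<bullet> abs_L2 \<psi>))"
proof -
  have "f \<bullet> abs_L2 (\<lambda>x. frechet_derivative \<psi> (at x) i)
      = (\<integral>x. rep_L2 f x * frechet_derivative \<psi> (at x) i \<partial>lborel)"
    "g \<bullet> abs_L2 \<psi> = (\<integral>x. rep_L2 g x * \<psi> x \<partial>lborel)" if "\<psi> \<in> test_functions S" for \<psi>
    using inner_L2_abs[OF test_function_square_integrable[OF test_function_partial[OF that assms]], of f]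
      inner_L2_abs[OF test_function_square_integrable[OF that], of g] by simp_all
  then show ?thesis by (simp add: is_weak_partial_def cong: conj_cong)
qed

section \<open>The fundamental lemma of the calculus of variations\<close>

definition rational_points :: "'a::euclidean_space set" where
  "rational_points = {a. \<forall>i\<in>Basis. a \<bullet> i \<in> \<rat>}"

lemma countable_rational_points: "countable (rational_points :: 'a::euclidean_space set)"
proof (rule countable_subset)
  show "rational_points \<subseteq> (\<lambda>f. \<Sum>i\<in>Basis. f i *\<^sub>R i) ` (Basis \<rightarrow>\<^sub>E \<rat> :: ('a \<Rightarrow> real) set)"
  proof
    fix a :: 'a assume a: "a \<in> rational_points"
    have "a = (\<Sum>i\<in>Basis. restrict (\<lambda>i. a \<bullet> i) Basis i *\<^sub>R i)" by (simp add: euclidean_representation)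
    moreover have "restrict (\<lambda>i. a \<bullet> i) Basis \<in> Basis \<rightarrow>\<^sub>E \<rat>" using a by (auto simp: rational_points_def)
    ultimately show "a \<in> (\<lambda>f. \<Sum>i\<in>Basis. f i *\<^sub>R i) ` (Basis \<rightarrow>\<^sub>E \<rat> :: ('a \<Rightarrow> real) set)" by blast
  qed
  show "countable ((\<lambda>f. \<Sum>i\<in>Basis. f i *\<^sub>R i) ` (Basis \<rightarrow>\<^sub>E \<rat> :: ('a \<Rightarrow> real) set))"
    by (intro countable_image countable_PiE finite_Basis countable_rat)
qed

definition rational_boxes_in :: "'a::euclidean_space set \<Rightarrow> ('a \<times> 'a) set" where
  "rational_boxes_in S = {(a, b). a \<in> rational_points \<and> b \<in> rational_points \<and> cbox a b \<subseteq> S}"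

lemma countable_rational_boxes_in: "countable (rational_boxes_in S)"
  by (rule countable_subset[of _ "rational_points \<times> rational_points"])
     (auto simp: rational_boxes_in_def countable_rational_points)

text \<open>
  A countable family of test functions that still determines an element of \<open>L\<^sub>2(S)\<close>.
  Countability is needed for functions with values in \<open>L\<^sub>2(\<Omega>)\<close>: an identity that holds for almost
  every \<open>t\<close>, for each test function separately, then holds for almost every \<open>t\<close> for all members of
  the family at once.
\<close>

definition cutoff_family :: "'a::euclidean_space set \<Rightarrow> ('a \<Rightarrow> real) set" where
  "cutoff_family S = (\<lambda>(n, a, b). box_cutoff n a b) ` (UNIV \<times> rational_boxes_in S)"

lemma countable_cutoff_family: "countable (cutoff_family S)"
  by (simp add: cutoff_family_def countable_rational_boxes_in)

lemma cutoff_family_test_functions: "cutoff_family S \<subseteq> test_functions S"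
  by (auto simp: cutoff_family_def rational_boxes_in_def box_cutoff_test_function)

lemma rational_box_around:
  assumes "open S" "x \<in> S"
  obtains a b where "(a, b) \<in> rational_boxes_in S" "x \<in> box a b"
proof -
  obtain e where e: "e > 0" "cball x e \<subseteq> S" using assms open_contains_cball by blast
  obtain a b where ab: "\<forall>i\<in>Basis. a \<bullet> i \<in> \<rat> \<and> b \<bullet> i \<in> \<rat>" "x \<in> box a b" "box a b \<subseteq> ball x e"
    using rational_boxes[OF e(1)] by metis
  have "closure (box a b) \<subseteq> cball x e" using ab(3) by (intro closure_minimal) auto
  moreover have "closure (box a b) = cbox a b" using ab(2) by (intro closure_box) auto
  ultimately have "cbox a b \<subseteq> S" using e(2) by auto
  then show ?thesis using ab that[of a b] by (auto simp: rational_boxes_in_def rational_points_def)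
qed

lemma borel_eq_rational_boxes:
  "(borel :: 'a::euclidean_space measure)
     = sigma UNIV ((\<lambda>(a, b). box a b) ` (rational_points \<times> rational_points))"
proof (rule borel_eq_countable_basis)
  show "countable ((\<lambda>(a, b). box a b) ` (rational_points \<times> rational_points :: ('a \<times> 'a) set))"
    by (simp add: countable_rational_points)
  show "topological_basis ((\<lambda>(a, b). box a b) ` (rational_points \<times> rational_points :: ('a \<times> 'a) set))"
  proof (rule topological_basisI)
    fix B :: "'a set"
    assume "B \<in> (\<lambda>(a, b). box a b) ` (rational_points \<times> rational_points)"
    then show "open B" by (auto simp: open_box)
  next
    fix U :: "'a set" and x assume "open U" "x \<in> U"
    then obtain a b where "(a, b) \<in> rational_boxes_in U" "x \<in> box a b" using rational_box_around by metis
    then show "\<exists>B\<in>(\<lambda>(a, b). box a b) ` (rational_points \<times> rational_points). x \<in> B \<and> B \<subseteq> U"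
      using box_subset_cbox[of a b]
      by (intro bexI[of _ "box a b"]) (auto simp: rational_boxes_in_def)
  qed
qed

lemma rational_box_Int:
  fixes a b c d :: "'a::euclidean_space"
  assumes "a \<in> rational_points" "b \<in> rational_points" "c \<in> rational_points" "d \<in> rational_points"
  obtains p q where "p \<in> rational_points" "q \<in> rational_points" "box a b \<inter> box c d = box p q"
proof
  show "box a b \<inter> box c d =
    box (\<Sum>i\<in>Basis. max (a\<bullet>i) (c\<bullet>i) *\<^sub>R i) (\<Sum>i\<in>Basis. min (b\<bullet>i) (d\<bullet>i) *\<^sub>R i)"
    by (rule box_Int_box)
qed (use assms in \<open>auto simp: rational_points_def max_def min_def\<close>)

text \<open>
  Fundamental lemma of the calculus of variations. Dominated convergence replaces the cutoffs by
  indicators of rational boxes; such boxes form an intersection-stable generator of the Borel sets,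
  so inside each of them the function has integral zero over every Borel set and vanishes almost
  everywhere. Countably many of these boxes cover the open set.
\<close>

lemma cutoff_family_total:
  fixes f :: "('a::euclidean_space, real) L2"
  assumes "open S" "f \<in> L2_on S" and zero: "\<And>\<psi>. \<psi> \<in> cutoff_family S \<Longrightarrow> f \<bullet> abs_L2 \<psi> = 0"
  shows "f = 0"
proof -
  let ?F = "rep_L2 f"
  have sqi_box: "square_integrable (indicat_real (box a b))" for a b :: 'a
    by (rule square_integrable_bounded_support[of _ "box a b" 1]) (auto simp: indicator_def)
  have int_box: "integrable lborel (\<lambda>x. ?F x * indicator (box a b) x)" for a b
    using square_integrable_inner[OF square_integrable_rep[of f] sqi_box] by simp
  have box_zero: "(\<integral>x. ?F x * indicator (box a b) x \<partial>lborel) = 0" if ab: "(a, b) \<in> rational_boxes_in S" for a b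
  proof -
    have tf: "box_cutoff n a b \<in> test_functions S" for n
      using ab by (auto simp: rational_boxes_in_def box_cutoff_test_function)
    have "(\<lambda>n. \<integral>x. ?F x * box_cutoff n a b x \<partial>lborel) \<longlonglongrightarrow> (\<integral>x. ?F x * indicator (box a b) x \<partial>lborel)"
    proof (rule integral_dominated_convergence)
      show "integrable lborel (\<lambda>x. \<bar>?F x * indicator (box a b) x\<bar>)"
        using int_box[of a b] by (rule integrable_abs)
      show "(\<lambda>x. ?F x * box_cutoff n a b x) \<in> borel_measurable lborel" for n
        using test_function_measurable[OF tf[of n]] by simp
      show "AE x in lborel. norm (?F x * box_cutoff n a b x) \<le> \<bar>?F x * indicator (box a b) x\<bar>" for n
      proof (rule AE_I2)
        fix x
        show "norm (?F x * box_cutoff n a b x) \<le> \<bar>?F x * indicator (box a b) x\<bar>"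
          using box_cutoff_bounds[of n a b x] box_cutoff_outside[of x a b n]
          by (cases "x \<in> box a b") (auto simp: abs_mult mult_left_le)
      qed
      show "AE x in lborel. (\<lambda>n. ?F x * box_cutoff n a b x) \<longlonglongrightarrow> ?F x * indicator (box a b) x"
        by (intro AE_I2 tendsto_mult tendsto_const box_cutoff_tendsto)
    qed simp
    moreover have "(\<integral>x. ?F x * box_cutoff n a b x \<partial>lborel) = 0" for n
    proof -
      have "f \<bullet> abs_L2 (box_cutoff n a b) = 0"
        unfolding cutoff_family_def using ab by (intro zero[unfolded cutoff_family_def] image_eqI[of _ _ "(n, a, b)"]) auto
      then show ?thesis
        using inner_L2_abs[OF test_function_square_integrable[OF tf[of n]], of f] by simp
    qed
    ultimately show ?thesis by (simp add: LIMSEQ_const_iff)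
  qed
  have "AE x in lborel. x \<in> box a b \<longrightarrow> ?F x = 0" if ab: "(a, b) \<in> rational_boxes_in S" for a b
  proof -
    let ?g = "\<lambda>x. ?F x * indicator (box a b) x"
    let ?G = "(\<lambda>(a, b). box a b) ` (rational_points \<times> rational_points) :: 'a set set"
    have sets_eq: "sigma_sets UNIV ?G = sets borel"
      by (subst borel_eq_rational_boxes) (simp add: sets_measure_of)
    have "(\<integral>x\<in>A. ?g x \<partial>lborel) = 0" if A: "A \<in> sets borel" for A
    proof -
      have stable: "Int_stable ?G"
      proof (rule Int_stableI)
        fix A B assume "A \<in> ?G" "B \<in> ?G"
        then obtain a b c d where "A = box a b" "B = box c d" "a \<in> rational_points"
          "b \<in> rational_points" "c \<in> rational_points" "d \<in> rational_points" by auto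
        moreover from this obtain p q where "p \<in> rational_points" "q \<in> rational_points"
          "box a b \<inter> box c d = box p q" using rational_box_Int by metis
        ultimately show "A \<inter> B \<in> ?G" by (auto intro!: image_eqI[of _ _ "(p, q)"])
      qed
      have sub: "?G \<subseteq> Pow UNIV" by simp
      show ?thesis
        using stable sub A[folded sets_eq]
      proof (induction rule: sigma_sets_induct_disjoint)
        case (basic A)
        then obtain c d where cd: "A = box c d" "c \<in> rational_points" "d \<in> rational_points" by auto
        obtain p q where pq: "p \<in> rational_points" "q \<in> rational_points" "box a b \<inter> box c d = box p q"
          using rational_box_Int[of a b c d] ab cd by (auto simp: rational_boxes_in_def)
        have eq: "(\<integral>x\<in>A. ?g x \<partial>lborel) = (\<integral>x. ?F x * indicator (box p q) x \<partial>lborel)"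
          unfolding set_lebesgue_integral_def pq(3)[symmetric] cd(1)
          by (intro Bochner_Integration.integral_cong) (auto simp: indicator_def)
        show ?case
        proof (cases "box p q = {}")
          case True
          then show ?thesis unfolding eq by simp
        next
          case False
          have "closure (box p q) \<subseteq> cbox a b"
            using pq(3) box_subset_cbox[of a b] by (intro closure_minimal) auto
          then have "(p, q) \<in> rational_boxes_in S"
            using ab pq(1,2) closure_box[OF False] by (auto simp: rational_boxes_in_def)
          then show ?thesis unfolding eq by (rule box_zero)
        qed
      next
        case empty
        show ?case by (simp add: set_lebesgue_integral_def)
      next
        case (compl A)
        have meas: "A \<in> sets borel" using compl.hyps sets_eq by simp
        have "(\<integral>x\<in>UNIV - A. ?g x \<partial>lborel) = (\<integral>x. ?g x - indicator A x *\<^sub>R ?g x \<partial>lborel)"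
          unfolding set_lebesgue_integral_def
          by (intro Bochner_Integration.integral_cong) (auto simp: indicator_def)
        also have "\<dots> = (\<integral>x. ?g x \<partial>lborel) - (\<integral>x\<in>A. ?g x \<partial>lborel)"
          unfolding set_lebesgue_integral_def
          by (intro Bochner_Integration.integral_diff int_box integrable_mult_indicator) (simp add: meas)
        finally show ?case using compl.IH box_zero[OF ab] by simp
      next
        case (union A)
        have meas: "A i \<in> sets borel" for i using union.hyps(2) sets_eq by auto
        have "(\<integral>x\<in>(\<Union>i. A i). ?g x \<partial>lborel) = (\<Sum>i. (\<integral>x\<in>A i. ?g x \<partial>lborel))"
        proof (rule lebesgue_integral_countable_add)
          show "A i \<in> sets lborel" for i using meas by simp
          show "A i \<inter> A j = {}" if "i \<noteq> j" for i j
            using union.hyps(1) that by (auto simp: disjoint_family_on_def)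
          show "set_integrable lborel (\<Union>i. A i) ?g"
            unfolding set_integrable_def by (intro integrable_mult_indicator int_box) (use meas in auto)
        qed
        then show ?case using union.IH by simp
      qed
    qed
    then have "AE x in lborel. ?g x = 0"
      by (intro density_unique_real int_box) (auto simp: set_lebesgue_integral_def)
    then show ?thesis by eventually_elim (auto simp: indicator_def)
  qed
  then have "AE x in lborel. \<forall>p\<in>rational_boxes_in S. x \<in> box (fst p) (snd p) \<longrightarrow> ?F x = 0"
    by (subst AE_ball_countable[OF countable_rational_boxes_in]) auto
  moreover have "AE x in lborel. x \<notin> S \<longrightarrow> ?F x = 0"
    using assms(2) by (simp add: L2_on_def)
  moreover have "AE x in lborel. rep_L2 (0 :: ('a, real) L2) x = 0" by (rule rep_L2_zero_AE)
  ultimately have "AE x in lborel. ?F x = rep_L2 0 x"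
  proof eventually_elim
    case (elim x)
    show ?case
    proof (cases "x \<in> S")
      case True
      then obtain a b where "(a, b) \<in> rational_boxes_in S" "x \<in> box a b"
        using rational_box_around[OF assms(1)] by metis
      then show ?thesis using elim(1,3) by force
    qed (use elim in simp)
  qed
  then show ?thesis by (rule L2_eqI)
qed

lemma test_functions_total:
  fixes f :: "('a::euclidean_space, real) L2"
  assumes "open S" "f \<in> L2_on S" "\<And>\<psi>. \<psi> \<in> test_functions S \<Longrightarrow> f \<bullet> abs_L2 \<psi> = 0"
  shows "f = 0"
  by (rule cutoff_family_total[OF assms(1,2)]) (use assms(3) cutoff_family_test_functions in blast)

section \<open>Integration by parts for test functions\<close>

lemma lborel_integral_translate:
  fixes F :: "'a::euclidean_space \<Rightarrow> real"
  assumes "F \<in> borel_measurable borel"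
  shows "(\<integral>x. F (c + x) \<partial>lborel) = (\<integral>x. F x \<partial>lborel)"
  using integral_distr[of "(+) c" lborel borel F] assms by (simp add: lborel_distr_plus)

text \<open>
  Difference quotients have integral zero by translation invariance of Lebesgue measure, and they
  converge to the derivative, uniformly bounded and supported in a fixed ball.
\<close>

lemma integral_partial_compact_support:
  fixes F :: "'a::euclidean_space \<Rightarrow> real"
  assumes der: "\<And>x. (F has_derivative F' x) (at x)"
    and cont: "continuous_on UNIV (\<lambda>x. F' x i)"
    and K: "compact K" "\<And>x. x \<notin> K \<Longrightarrow> F x = 0" "\<And>x. x \<notin> K \<Longrightarrow> F' x i = 0"
    and i: "norm i = 1"
  shows "(\<integral>x. F' x i \<partial>lborel) = 0"
proof -
  define h where "h n = inverse (real (Suc n))" for n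
  have h: "h n > 0" "h n \<le> 1" for n by (auto simp: h_def inverse_le_1_iff)
  have h0: "h \<longlonglongrightarrow> 0" unfolding h_def by (rule LIMSEQ_inverse_real_of_nat)
  have F_cont: "continuous_on UNIV F"
    using der by (intro has_derivative_continuous_on[of UNIV F F']) (auto intro: has_derivative_at_withinI)
  then have F_meas [measurable]: "F \<in> borel_measurable borel" by (rule borel_measurable_continuous_onI)
  have "bounded ((\<lambda>x. F' x i) ` K)"
    using cont K(1) by (intro compact_imp_bounded compact_continuous_image) (auto intro: continuous_on_subset)
  then obtain M0 where M0: "\<And>x. x \<in> K \<Longrightarrow> \<bar>F' x i\<bar> \<le> M0" by (auto simp: bounded_iff)
  define M where "M = max M0 0"
  have M: "\<bar>F' x i\<bar> \<le> M" for x using M0[of x] K(3)[of x] by (cases "x \<in> K") (auto simp: M_def)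
  obtain R where R: "K \<subseteq> cball 0 R" using compact_imp_bounded[OF K(1)] by (auto simp: bounded_iff subset_iff)
  have line: "((\<lambda>t. F (x + t *\<^sub>R i)) has_real_derivative F' (x + t *\<^sub>R i) i) (at t)" for x t
  proof -
    have "((\<lambda>t. F (x + t *\<^sub>R i)) has_derivative (\<lambda>s. F' (x + t *\<^sub>R i) (s *\<^sub>R i))) (at t)"
      by (rule has_derivative_compose[OF _ der]) (auto intro!: derivative_eq_intros)
    moreover have "linear (F' (x + t *\<^sub>R i))" using der has_derivative_linear by blast
    ultimately show ?thesis
      by (simp add: has_field_derivative_def linear_scale mult.commute[of _ "F' (x + t *\<^sub>R i) i"])
  qed
  define d where "d n x = (F (h n *\<^sub>R i + x) - F x) / h n" for n x
  have d_bound: "\<bar>d n x\<bar> \<le> M" for n x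
  proof -
    obtain z where "F (x + h n *\<^sub>R i) - F (x + 0 *\<^sub>R i) = (h n - 0) * F' (x + z *\<^sub>R i) i"
      using MVT2[of 0 "h n" "\<lambda>t. F (x + t *\<^sub>R i)" "\<lambda>t. F' (x + t *\<^sub>R i) i"] line h by blast
    then have "d n x = F' (x + z *\<^sub>R i) i" using h(1)[of n] by (simp add: d_def add.commute)
    then show ?thesis using M by simp
  qed
  have d_zero: "d n x = 0" if "x \<notin> cball 0 (R + 1)" for n x
  proof -
    have "norm x > R + 1" using that by simp
    moreover have "norm x \<le> norm (h n *\<^sub>R i + x) + norm (h n *\<^sub>R i)"
      using norm_triangle_ineq4[of "h n *\<^sub>R i + x" "h n *\<^sub>R i"] by simp
    moreover have "norm (h n *\<^sub>R i) \<le> 1" using h[of n] i by simp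
    ultimately have "x \<notin> K" "h n *\<^sub>R i + x \<notin> K" using R by auto
    then show ?thesis by (simp add: d_def K(2))
  qed
  have "(\<lambda>x. indicator K x *\<^sub>R F x) = F" by (auto simp: fun_eq_iff indicator_def K)
  then have F_int: "integrable lborel F"
    using borel_integrable_compact[OF K(1) continuous_on_subset[OF F_cont]] by simp
  have "(\<lambda>n. \<integral>x. d n x \<partial>lborel) \<longlonglongrightarrow> (\<integral>x. F' x i \<partial>lborel)"
  proof (rule integral_dominated_convergence)
    show "integrable lborel (\<lambda>x. M *\<^sub>R indicat_real (cball 0 (R + 1)) (x::'a))"
      by (intro integrable_scaleR_right integrable_real_indicator) (use emeasure_bounded_finite[of "cball 0 (R + 1) :: 'a set"] in auto)
    show "(\<lambda>x. F' x i) \<in> borel_measurable lborel" using cont by (simp add: borel_measurable_continuous_onI)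
    show "d n \<in> borel_measurable lborel" for n unfolding d_def by measurable
    show "AE x in lborel. norm (d n x) \<le> M *\<^sub>R indicat_real (cball 0 (R + 1)) x" for n
    proof (rule AE_I2)
      fix x show "norm (d n x) \<le> M *\<^sub>R indicat_real (cball 0 (R + 1)) x"
        using d_bound[of n x] d_zero[of x n] by (cases "x \<in> cball 0 (R + 1)") auto
    qed
    show "AE x in lborel. (\<lambda>n. d n x) \<longlonglongrightarrow> F' x i"
    proof (rule AE_I2)
      fix x
      have "((\<lambda>t. (F (x + t *\<^sub>R i) - F x) / t) \<longlongrightarrow> F' x i) (at 0)"
        using line[of x 0] by (simp add: has_field_derivative_iff)
      moreover have "filterlim h (at 0) sequentially"
        using h0 h by (auto simp: filterlim_at less_imp_neq[symmetric] eventually_sequentially)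
      ultimately have "(\<lambda>n. (F (x + h n *\<^sub>R i) - F x) / h n) \<longlonglongrightarrow> F' x i" by (rule filterlim_compose)
      then show "(\<lambda>n. d n x) \<longlonglongrightarrow> F' x i" by (simp add: d_def add.commute)
    qed
  qed
  moreover have "(\<integral>x. d n x \<partial>lborel) = 0" for n
  proof -
    have "integrable lborel (\<lambda>x. F (h n *\<^sub>R i + x))"
      using integrable_distr_eq[of "(+) (h n *\<^sub>R i)" lborel borel F] F_int
      by (simp add: lborel_distr_plus)
    then have "(\<integral>x. d n x \<partial>lborel) = ((\<integral>x. F (h n *\<^sub>R i + x) \<partial>lborel) - (\<integral>x. F x \<partial>lborel)) / h n"
      unfolding d_def using F_int by simp
    then show ?thesis by (simp add: lborel_integral_translate)
  qed
  ultimately show ?thesis by (simp add: LIMSEQ_const_iff)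
qed

text \<open>
  Integration by parts, that is, the vanishing of the integral of the partial derivative of a product.
\<close>

lemma test_function_is_weak_partial:
  assumes \<psi>: "\<psi> \<in> test_functions S" and i: "i \<in> Basis"
  shows "is_weak_partial S i (abs_L2 \<psi>) (abs_L2 (\<lambda>x. frechet_derivative \<psi> (at x) i))"
  unfolding is_weak_partial_iff[OF i]
proof (intro conjI ballI)
  show "abs_L2 \<psi> \<in> L2_on S" by (rule test_function_L2_on[OF \<psi>])
  show "abs_L2 (\<lambda>x. frechet_derivative \<psi> (at x) i) \<in> L2_on S"
    by (rule test_function_L2_on[OF test_function_partial[OF \<psi> i]])
  fix \<eta> assume \<eta>: "\<eta> \<in> test_functions S"
  let ?D = "\<lambda>f x. frechet_derivative f (at x)"
  note sqi = test_function_square_integrable[OF \<psi>] test_function_square_integrable[OF \<eta>]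
    test_function_square_integrable[OF test_function_partial[OF \<psi> i]]
    test_function_square_integrable[OF test_function_partial[OF \<eta> i]]
  obtain K where K: "compact K" "\<And>x. x \<notin> K \<Longrightarrow> \<psi> x = 0" "\<And>x i. x \<notin> K \<Longrightarrow> ?D \<psi> x i = 0"
    using test_functionE[OF \<psi>] by metis
  have "(\<integral>x. \<psi> x * ?D \<eta> x i + ?D \<psi> x i * \<eta> x \<partial>lborel) = 0"
  proof (rule integral_partial_compact_support[where F="\<lambda>x. \<psi> x * \<eta> x" and K=K])
    show "((\<lambda>x. \<psi> x * \<eta> x) has_derivative (\<lambda>h. \<psi> x * ?D \<eta> x h + ?D \<psi> x h * \<eta> x)) (at x)" for x
      by (intro has_derivative_mult test_function_has_derivative[OF \<psi>] test_function_has_derivative[OF \<eta>])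
    show "continuous_on UNIV (\<lambda>x. \<psi> x * ?D \<eta> x i + ?D \<psi> x i * \<eta> x)"
      by (intro continuous_intros test_function_continuous[OF \<psi>] test_function_continuous[OF \<eta>]
          test_function_continuous[OF test_function_partial[OF \<psi> i]]
          test_function_continuous[OF test_function_partial[OF \<eta> i]])
  qed (use K i in auto)
  moreover have "(\<integral>x. \<psi> x * ?D \<eta> x i + ?D \<psi> x i * \<eta> x \<partial>lborel)
      = (\<integral>x. \<psi> x \<bullet> ?D \<eta> x i \<partial>lborel) + (\<integral>x. ?D \<psi> x i \<bullet> \<eta> x \<partial>lborel)"
    using square_integrable_inner[OF sqi(1,4)] square_integrable_inner[OF sqi(3,2)] by simp
  ultimately show "abs_L2 \<psi> \<bullet> abs_L2 (\<lambda>x. ?D \<eta> x i) = - (abs_L2 (\<lambda>x. ?D \<psi> x i) \<bullet> abs_L2 \<eta>)"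
    using sqi by (simp add: inner_abs_L2)
qed

section \<open>Weak derivatives and the Dirichlet Laplacian\<close>

lemma is_weak_partial_unique:
  assumes S: "open S" and i: "i \<in> Basis" and "is_weak_partial S i f g" "is_weak_partial S i f g'"
  shows "g = g'"
proof -
  have "g - g' = 0"
  proof (rule test_functions_total[OF S])
    show "g - g' \<in> L2_on S"
      using assms(3,4) by (intro subspace_diff[OF subspace_L2_on]) (auto simp: is_weak_partial_def)
    show "(g - g') \<bullet> abs_L2 \<psi> = 0" if "\<psi> \<in> test_functions S" for \<psi>
      using assms(3,4) that unfolding is_weak_partial_iff[OF i] by (auto simp: inner_diff_left)
  qed
  then show ?thesis by simp
qed

lemma weak_partial_eqI:
  assumes "open S" "i \<in> Basis" "is_weak_partial S i f g"
  shows "weak_partial S i f = g"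
  unfolding weak_partial_def
  using is_weak_partial_unique[OF assms(1,2)] assms(3) by blast

lemma is_weak_partial_weak_partial:
  assumes "open S" "i \<in> Basis" "f \<in> Sobolev_H1 S"
  shows "is_weak_partial S i f (weak_partial S i f)"
proof -
  obtain g where "is_weak_partial S i f g" using assms by (auto simp: Sobolev_H1_def)
  with weak_partial_eqI[OF assms(1,2) this] show ?thesis by simp
qed

lemma is_weak_partial_add:
  assumes i: "i \<in> Basis" and "is_weak_partial S i f g" "is_weak_partial S i f' g'"
  shows "is_weak_partial S i (f + f') (g + g')"
  using assms unfolding is_weak_partial_iff[OF i]
  by (auto simp: inner_add_left intro: subspace_add[OF subspace_L2_on])

lemma is_weak_partial_scaleR:
  assumes i: "i \<in> Basis" and "is_weak_partial S i f g"
  shows "is_weak_partial S i (c *\<^sub>R f) (c *\<^sub>R g)"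
  using assms unfolding is_weak_partial_iff[OF i]
  by (auto intro: subspace_scale[OF subspace_L2_on])

lemma is_weak_partial_zero: "i \<in> Basis \<Longrightarrow> is_weak_partial S i 0 0"
  by (simp add: is_weak_partial_iff subspace_0[OF subspace_L2_on])

lemma subspace_Sobolev_H1: "subspace (Sobolev_H1 S)"
proof (rule subspaceI)
  show "0 \<in> Sobolev_H1 S"
    using is_weak_partial_zero by (auto simp: Sobolev_H1_def subspace_0[OF subspace_L2_on])
  show "f + g \<in> Sobolev_H1 S" if "f \<in> Sobolev_H1 S" "g \<in> Sobolev_H1 S" for f g
    using that is_weak_partial_add subspace_add[OF subspace_L2_on]
    unfolding Sobolev_H1_def mem_Collect_eq by metis
  show "c *\<^sub>R f \<in> Sobolev_H1 S" if "f \<in> Sobolev_H1 S" for c f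
    using that is_weak_partial_scaleR subspace_scale[OF subspace_L2_on]
    unfolding Sobolev_H1_def mem_Collect_eq by metis
qed

lemma weak_partial_add:
  assumes "open S" "i \<in> Basis" "f \<in> Sobolev_H1 S" "g \<in> Sobolev_H1 S"
  shows "weak_partial S i (f + g) = weak_partial S i f + weak_partial S i g"
  by (intro weak_partial_eqI is_weak_partial_add is_weak_partial_weak_partial assms)

lemma weak_partial_scaleR:
  assumes "open S" "i \<in> Basis" "f \<in> Sobolev_H1 S"
  shows "weak_partial S i (c *\<^sub>R f) = c *\<^sub>R weak_partial S i f"
  by (intro weak_partial_eqI is_weak_partial_scaleR is_weak_partial_weak_partial assms)

lemma test_function_H1: "\<psi> \<in> test_functions S \<Longrightarrow> abs_L2 \<psi> \<in> Sobolev_H1 S"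
  using test_function_is_weak_partial test_function_L2_on
  unfolding Sobolev_H1_def mem_Collect_eq by metis

text \<open>
  The properties are required on a subspace only: the \<open>H\<^sup>1\<close> norm and the graph norm have them where
  weak derivatives exist, while elsewhere the definite description in \<open>weak_partial\<close> is arbitrary.
\<close>

definition seminorm_on :: "'v::real_vector set \<Rightarrow> ('v \<Rightarrow> real) \<Rightarrow> bool" where
  "seminorm_on X N \<longleftrightarrow> subspace X \<and> (\<forall>x\<in>X. 0 \<le> N x) \<and>
     (\<forall>x\<in>X. \<forall>y\<in>X. N (x + y) \<le> N x + N y) \<and> (\<forall>c. \<forall>x\<in>X. N (c *\<^sub>R x) = \<bar>c\<bar> * N x)"

lemma seminorm_on_subset:
  "seminorm_on X N \<Longrightarrow> subspace Y \<Longrightarrow> Y \<subseteq> X \<Longrightarrow> seminorm_on Y N"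
  unfolding seminorm_on_def by (meson subsetD)

lemma seminorm_on_norm: "subspace X \<Longrightarrow> seminorm_on X norm"
  by (simp add: seminorm_on_def norm_triangle_ineq)

text \<open>
  The triangle inequality is that of the Euclidean combination of \<open>\<parallel>f\<parallel>\<close> and the norms of the partial
  derivatives. The index \<open>0\<close>, which is not a basis vector, stands for the function itself.
\<close>

lemma seminorm_on_H1_norm:
  assumes S: "open S"
  shows "seminorm_on (Sobolev_H1 S) (H1_norm S)"
proof -
  define D where "D j f = (if j = 0 then f else weak_partial S j f)" for j f
  let ?I = "insert 0 Basis :: 'a set"
  have eq: "H1_norm S f = L2_set (\<lambda>j. norm (D j f)) ?I" for f
  proof -
    have "(\<Sum>j\<in>Basis. (norm (D j f))\<^sup>2) = (\<Sum>i\<in>Basis. (norm (weak_partial S i f))\<^sup>2)"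
      by (intro sum.cong) (auto simp: D_def)
    then show ?thesis by (simp add: L2_set_def H1_norm_def D_def)
  qed
  have add: "D j (f + g) = D j f + D j g" if "f \<in> Sobolev_H1 S" "g \<in> Sobolev_H1 S" "j \<in> ?I" for f g j
    using that weak_partial_add[OF S] by (auto simp: D_def)
  have scale: "D j (c *\<^sub>R f) = c *\<^sub>R D j f" if "f \<in> Sobolev_H1 S" "j \<in> ?I" for f c j
    using that weak_partial_scaleR[OF S] by (auto simp: D_def)
  show ?thesis
    unfolding seminorm_on_def
  proof (intro conjI ballI allI subspace_Sobolev_H1)
    show "0 \<le> H1_norm S f" for f by (simp add: eq)
  next
    fix f g assume fg: "f \<in> Sobolev_H1 S" "g \<in> Sobolev_H1 S"
    have "L2_set (\<lambda>j. norm (D j (f + g))) ?I \<le> L2_set (\<lambda>j. norm (D j f) + norm (D j g)) ?I"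
      by (intro L2_set_mono) (auto simp: add[OF fg] norm_triangle_ineq)
    also have "\<dots> \<le> L2_set (\<lambda>j. norm (D j f)) ?I + L2_set (\<lambda>j. norm (D j g)) ?I"
      by (rule L2_set_triangle_ineq)
    finally show "H1_norm S (f + g) \<le> H1_norm S f + H1_norm S g" by (simp add: eq)
  next
    fix c f assume f: "f \<in> Sobolev_H1 S"
    have "L2_set (\<lambda>j. norm (D j (c *\<^sub>R f))) ?I = L2_set (\<lambda>j. \<bar>c\<bar> * norm (D j f)) ?I"
      by (intro L2_set_cong) (auto simp: scale[OF f])
    also have "\<dots> = \<bar>c\<bar> * L2_set (\<lambda>j. norm (D j f)) ?I"
      by (rule L2_set_right_distrib[symmetric]) simp
    finally show "H1_norm S (c *\<^sub>R f) = \<bar>c\<bar> * H1_norm S f" by (simp add: eq)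
  qed
qed

lemma Sobolev_H10_subset: "Sobolev_H10 S \<subseteq> Sobolev_H1 S"
  by (auto simp: Sobolev_H10_def)

text \<open>
  Approximants are added; this needs the triangle inequality for the \<open>H\<^sup>1\<close> norm of
  \<open>f - \<psi>\<close>, so that test functions have to be known to lie in \<open>H\<^sup>1\<close>.
\<close>

lemma subspace_Sobolev_H10:
  assumes S: "open S"
  shows "subspace (Sobolev_H10 S)"
proof (rule subspaceI)
  note H1 = seminorm_on_H1_norm[OF S, unfolded seminorm_on_def]
  have diff: "f - abs_L2 \<psi> \<in> Sobolev_H1 S" if "f \<in> Sobolev_H1 S" "\<psi> \<in> test_functions S" for f \<psi>
    using that by (intro subspace_diff[OF subspace_Sobolev_H1] test_function_H1)
  have H1_zero: "H1_norm S 0 = 0"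
  proof -
    have "H1_norm S (0 *\<^sub>R 0) = \<bar>0\<bar> * H1_norm S 0" using H1 subspace_0[OF subspace_Sobolev_H1] by blast
    then show ?thesis by simp
  qed
  have zero: "(\<lambda>x. 0) \<in> test_functions S" by (auto simp: test_functions_def C_k_const)
  show "0 \<in> Sobolev_H10 S"
    using zero H1_zero zero_L2_abs[where 'a='a and 'b=real]
    by (auto simp: Sobolev_H10_def subspace_0[OF subspace_Sobolev_H1] intro!: bexI[of _ "\<lambda>x. 0"])
  show "f + g \<in> Sobolev_H10 S" if f: "f \<in> Sobolev_H10 S" and g: "g \<in> Sobolev_H10 S" for f g
    unfolding Sobolev_H10_def mem_Collect_eq
  proof (intro conjI allI impI)
    show "f + g \<in> Sobolev_H1 S"
      using f g Sobolev_H10_subset by (intro subspace_add[OF subspace_Sobolev_H1]) auto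
    fix e :: real assume "e > 0"
    then have "e / 2 > 0" by simp
    then obtain \<psi> \<eta> where \<psi>: "\<psi> \<in> test_functions S" "H1_norm S (f - abs_L2 \<psi>) < e / 2"
      and \<eta>: "\<eta> \<in> test_functions S" "H1_norm S (g - abs_L2 \<eta>) < e / 2"
      using f g unfolding Sobolev_H10_def by blast
    have "abs_L2 (\<lambda>x. \<psi> x + \<eta> x) = abs_L2 \<psi> + abs_L2 \<eta>"
      using \<psi> \<eta> by (simp add: abs_L2_add test_function_square_integrable)
    then have eq: "f + g - abs_L2 (\<lambda>x. \<psi> x + \<eta> x) = (f - abs_L2 \<psi>) + (g - abs_L2 \<eta>)" by simp
    have "H1_norm S ((f - abs_L2 \<psi>) + (g - abs_L2 \<eta>)) \<le> H1_norm S (f - abs_L2 \<psi>) + H1_norm S (g - abs_L2 \<eta>)"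
      using H1 diff \<psi>(1) \<eta>(1) f g Sobolev_H10_subset by blast
    then have "H1_norm S (f + g - abs_L2 (\<lambda>x. \<psi> x + \<eta> x)) < e"
      unfolding eq using \<psi>(2) \<eta>(2) by linarith
    then show "\<exists>\<psi>\<in>test_functions S. H1_norm S (f + g - abs_L2 \<psi>) < e"
      using test_function_add[OF \<psi>(1) \<eta>(1)] by blast
  qed
  show "c *\<^sub>R f \<in> Sobolev_H10 S" if f: "f \<in> Sobolev_H10 S" for c f
    unfolding Sobolev_H10_def mem_Collect_eq
  proof (intro conjI allI impI)
    show "c *\<^sub>R f \<in> Sobolev_H1 S"
      using f Sobolev_H10_subset by (intro subspace_scale[OF subspace_Sobolev_H1]) auto
    fix e :: real assume e: "e > 0"
    then have "e / (\<bar>c\<bar> + 1) > 0" by simp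
    then obtain \<psi> where \<psi>: "\<psi> \<in> test_functions S" "H1_norm S (f - abs_L2 \<psi>) < e / (\<bar>c\<bar> + 1)"
      using f unfolding Sobolev_H10_def by blast
    have "abs_L2 (\<lambda>x. c * \<psi> x) = c *\<^sub>R abs_L2 \<psi>"
      using abs_L2_scaleR[OF test_function_square_integrable[OF \<psi>(1)], of c] by simp
    then have eq: "c *\<^sub>R f - abs_L2 (\<lambda>x. c * \<psi> x) = c *\<^sub>R (f - abs_L2 \<psi>)" by (simp add: scaleR_diff_right)
    have "H1_norm S (c *\<^sub>R (f - abs_L2 \<psi>)) = \<bar>c\<bar> * H1_norm S (f - abs_L2 \<psi>)"
      using H1 diff \<psi>(1) f Sobolev_H10_subset by blast
    moreover have "\<bar>c\<bar> * H1_norm S (f - abs_L2 \<psi>) \<le> \<bar>c\<bar> * (e / (\<bar>c\<bar> + 1))"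
      using \<psi>(2) by (intro mult_left_mono) auto
    moreover have "\<bar>c\<bar> * (e / (\<bar>c\<bar> + 1)) < e" using e by (simp add: field_simps)
    ultimately have "H1_norm S (c *\<^sub>R f - abs_L2 (\<lambda>x. c * \<psi> x)) < e"
      unfolding eq by linarith
    then show "\<exists>\<psi>\<in>test_functions S. H1_norm S (c *\<^sub>R f - abs_L2 \<psi>) < e"
      using test_function_scale[OF \<psi>(1)] by blast
  qed
qed

lemma seminorm_on_Sobolev_H10: "open S \<Longrightarrow> seminorm_on (Sobolev_H10 S) (H1_norm S)"
  by (rule seminorm_on_subset[OF seminorm_on_H1_norm subspace_Sobolev_H10 Sobolev_H10_subset])

lemma subspace_Sobolev_H2:
  assumes S: "open S"
  shows "subspace (Sobolev_H2 S)"
proof (rule subspaceI)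
  show "0 \<in> Sobolev_H2 S"
    using weak_partial_eqI[OF S _ is_weak_partial_zero]
    by (auto simp: Sobolev_H2_def subspace_0[OF subspace_Sobolev_H1])
  show "f + g \<in> Sobolev_H2 S" if "f \<in> Sobolev_H2 S" "g \<in> Sobolev_H2 S" for f g
    using that by (auto simp: Sobolev_H2_def weak_partial_add[OF S] intro: subspace_add[OF subspace_Sobolev_H1])
  show "c *\<^sub>R f \<in> Sobolev_H2 S" if "f \<in> Sobolev_H2 S" for c f
    using that by (auto simp: Sobolev_H2_def weak_partial_scaleR[OF S] intro: subspace_scale[OF subspace_Sobolev_H1])
qed

lemma subspace_domain_A: "open \<Omega> \<Longrightarrow> subspace (domain_A \<Omega>)"
  unfolding domain_A_def by (intro subspace_inter subspace_Sobolev_H2 subspace_Sobolev_H10)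

lemma op_A_add:
  assumes S: "open \<Omega>" and "f \<in> domain_A \<Omega>" "g \<in> domain_A \<Omega>"
  shows "op_A \<Omega> (f + g) = op_A \<Omega> f + op_A \<Omega> g"
  using assms(2,3)
  by (simp add: op_A_def domain_A_def Sobolev_H2_def weak_partial_add[OF S] sum.distrib)

lemma op_A_scaleR:
  assumes S: "open \<Omega>" and "f \<in> domain_A \<Omega>"
  shows "op_A \<Omega> (c *\<^sub>R f) = c *\<^sub>R op_A \<Omega> f"
  using assms(2)
  by (simp add: op_A_def domain_A_def Sobolev_H2_def weak_partial_scaleR[OF S] scaleR_sum_right)

lemma op_A_L2_on:
  assumes S: "open \<Omega>" and "f \<in> domain_A \<Omega>"
  shows "op_A \<Omega> f \<in> L2_on \<Omega>"
  unfolding op_A_def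
proof (intro subspace_neg[OF subspace_L2_on] subspace_sum[OF subspace_L2_on])
  fix i :: 'a assume i: "i \<in> Basis"
  then have "weak_partial \<Omega> i f \<in> Sobolev_H1 \<Omega>" using assms(2) by (auto simp: domain_A_def Sobolev_H2_def)
  from is_weak_partial_weak_partial[OF S i this]
  show "weak_partial \<Omega> i (weak_partial \<Omega> i f) \<in> L2_on \<Omega>" by (simp add: is_weak_partial_def)
qed

lemma seminorm_on_graph_norm:
  assumes S: "open \<Omega>"
  shows "seminorm_on (domain_A \<Omega>) (graph_norm \<Omega>)"
  unfolding seminorm_on_def
proof (intro conjI ballI allI subspace_domain_A[OF S])
  show "0 \<le> graph_norm \<Omega> f" for f by (simp add: graph_norm_def)
next
  fix f g assume fg: "f \<in> domain_A \<Omega>" "g \<in> domain_A \<Omega>"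
  have "graph_norm \<Omega> (f + g) \<le> sqrt ((norm f + norm g)\<^sup>2 + (norm (op_A \<Omega> f) + norm (op_A \<Omega> g))\<^sup>2)"
    unfolding graph_norm_def op_A_add[OF S fg]
    by (intro real_sqrt_le_mono add_mono power_mono norm_triangle_ineq norm_ge_zero)
  also have "\<dots> \<le> graph_norm \<Omega> f + graph_norm \<Omega> g"
    unfolding graph_norm_def by (rule real_sqrt_sum_squares_triangle_ineq)
  finally show "graph_norm \<Omega> (f + g) \<le> graph_norm \<Omega> f + graph_norm \<Omega> g" .
next
  fix c f assume "f \<in> domain_A \<Omega>"
  then show "graph_norm \<Omega> (c *\<^sub>R f) = \<bar>c\<bar> * graph_norm \<Omega> f"
    by (simp add: graph_norm_def op_A_scaleR[OF S] power_mult_distrib real_sqrt_mult flip: distrib_left)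
qed

definition laplacian :: "('a::euclidean_space \<Rightarrow> real) \<Rightarrow> 'a \<Rightarrow> real" where
  "laplacian \<psi> x = (\<Sum>i\<in>Basis. frechet_derivative (\<lambda>y. frechet_derivative \<psi> (at y) i) (at x) i)"

lemma laplacian_test_function:
  assumes "\<psi> \<in> test_functions S"
  shows "square_integrable (laplacian \<psi>)" 
    "abs_L2 (laplacian \<psi>) = (\<Sum>i\<in>Basis. abs_L2 (\<lambda>x. frechet_derivative (\<lambda>y. frechet_derivative \<psi> (at y) i) (at x) i))"
proof -
  have *: "square_integrable (\<lambda>x. \<Sum>i\<in>I. h i x) \<and> abs_L2 (\<lambda>x. \<Sum>i\<in>I. h i x) = (\<Sum>i\<in>I. abs_L2 (h i))"
    if "\<And>i. i \<in> I \<Longrightarrow> square_integrable (h i)" "finite I" for I :: "'a set" and h :: "'a \<Rightarrow> 'a \<Rightarrow> real"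
    using that(2,1)
    by (induction I) (auto simp: square_integrable_zero zero_L2_abs square_integrable_add abs_L2_add[symmetric])
  have "square_integrable (\<lambda>x. frechet_derivative (\<lambda>y. frechet_derivative \<psi> (at y) i) (at x) i)"
    if "i \<in> Basis" for i
    by (rule test_function_square_integrable[OF test_function_partial[OF
            test_function_partial[OF assms that] that]])
  from *[OF this finite_Basis] show "square_integrable (laplacian \<psi>)" 
    "abs_L2 (laplacian \<psi>) = (\<Sum>i\<in>Basis. abs_L2 (\<lambda>x. frechet_derivative (\<lambda>y. frechet_derivative \<psi> (at y) i) (at x) i))"
    by (simp_all add: laplacian_def[abs_def])
qed

text \<open>
  The defining identity of weak derivatives is applied twice, the second time to the test function
  \<open>\<partial>\<^sub>i\<psi>\<close>, which again has compact support in \<open>\<Omega>\<close>.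
\<close>

lemma op_A_inner_test_function:
  assumes S: "open \<Omega>" and f: "f \<in> domain_A \<Omega>" and \<psi>: "\<psi> \<in> test_functions \<Omega>"
  shows "op_A \<Omega> f \<bullet> abs_L2 \<psi> = - (f \<bullet> abs_L2 (laplacian \<psi>))"
proof -
  have "weak_partial \<Omega> i (weak_partial \<Omega> i f) \<bullet> abs_L2 \<psi>
      = f \<bullet> abs_L2 (\<lambda>x. frechet_derivative (\<lambda>y. frechet_derivative \<psi> (at y) i) (at x) i)"
    if i: "i \<in> Basis" for i
  proof -
    have "f \<in> Sobolev_H1 \<Omega>" "weak_partial \<Omega> i f \<in> Sobolev_H1 \<Omega>"
      using f i by (auto simp: domain_A_def Sobolev_H2_def)
    then show ?thesis
      using is_weak_partial_weak_partial[OF S i, of f] is_weak_partial_weak_partial[OF S i, of "weak_partial \<Omega> i f"]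
        \<psi> test_function_partial[OF \<psi> i] unfolding is_weak_partial_iff[OF i] by simp
  qed
  then show ?thesis
    by (simp add: op_A_def laplacian_test_function(2)[OF \<psi>] inner_sum_left inner_sum_right)
qed

section \<open>Classes of continuous curves\<close>

lemma rep_curve_class_AE:
  "continuous_on {0..T} f \<Longrightarrow>
    AE t in lborel. rep_L2 (curve_class T f) t = indicator {0<..<T} t *\<^sub>R f t"
  unfolding curve_class_def by (rule rep_abs_L2_AE[OF square_integrable_interval_curve])

lemma curve_class_L2_on:
  assumes "continuous_on {0..T} f"
  shows "curve_class T f \<in> L2_on {0<..<T}"
  unfolding L2_on_def mem_Collect_eq
  using rep_curve_class_AE[OF assms] by eventually_elim auto

lemma curve_class_cong: "(\<And>t. t \<in> {0<..<T} \<Longrightarrow> f t = g t) \<Longrightarrow> curve_class T f = curve_class T g"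
  unfolding curve_class_def by (intro arg_cong[where f=abs_L2] ext) (auto simp: indicator_def)

lemma curve_class_add:
  assumes "continuous_on {0..T} f" "continuous_on {0..T} g"
  shows "curve_class T (\<lambda>t. f t + g t) = curve_class T f + curve_class T g"
  unfolding curve_class_def
  using abs_L2_add[OF square_integrable_interval_curve[OF assms(1)] square_integrable_interval_curve[OF assms(2)]]
  by (simp add: scaleR_add_right)

lemma curve_class_scaleR:
  assumes "continuous_on {0..T} f"
  shows "curve_class T (\<lambda>t. c *\<^sub>R f t) = c *\<^sub>R curve_class T f"
  unfolding curve_class_def
  using abs_L2_scaleR[OF square_integrable_interval_curve[OF assms(1)], of c]
  by (simp add: mult.commute)

lemma norm_curve_class_le:
  assumes f: "continuous_on {0..T} f" and M: "\<And>t. t \<in> {0..T} \<Longrightarrow> norm (f t) \<le> M" "0 \<le> M" and T: "0 \<le> T"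
  shows "norm (curve_class T f) \<le> sqrt T * M"
proof -
  have "(norm (curve_class T f))\<^sup>2 = (\<integral>t. (norm (indicator {0<..<T} t *\<^sub>R f t))\<^sup>2 \<partial>lborel)"
    unfolding curve_class_def by (rule norm_abs_L2[OF square_integrable_interval_curve[OF f]])
  also have "\<dots> \<le> (\<integral>t. M\<^sup>2 * indicat_real {0<..<T} t \<partial>lborel)"
  proof (rule integral_mono)
    show "integrable lborel (\<lambda>t. (norm (indicator {0<..<T} t *\<^sub>R f t))\<^sup>2)"
      using square_integrable_interval_curve[OF f] by (simp add: square_integrable_def)
    show "integrable lborel (\<lambda>t. M\<^sup>2 * indicat_real {0<..<T} t)"
      using T by simp
    show "(norm (indicator {0<..<T} t *\<^sub>R f t))\<^sup>2 \<le> M\<^sup>2 * indicat_real {0<..<T} t" for t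
    proof (cases "t \<in> {0<..<T}")
      case True
      then have "(norm (f t))\<^sup>2 \<le> M\<^sup>2" by (intro power_mono M) auto
      then show ?thesis using True by simp
    qed simp
  qed
  also have "\<dots> = (sqrt T * M)\<^sup>2" using T by (simp add: power_mult_distrib)
  finally show ?thesis by (rule power2_le_imp_le) (use M(2) T in simp)
qed

text \<open>
  The set where the functions differ is open in \<open>(0,T)\<close> and null, hence empty; the end points
  follow by continuity.
\<close>

lemma continuous_AE_eq:
  fixes f g :: "real \<Rightarrow> 'h::real_normed_vector"
  assumes T: "0 < T" and f: "continuous_on {0..T} f" and g: "continuous_on {0..T} g"
    and ae: "AE t in lborel. t \<in> {0<..<T} \<longrightarrow> f t = g t" and t: "t \<in> {0..T}"
  shows "f t = g t"
proof -
  have d: "continuous_on {0..T} (\<lambda>t. f t - g t)" using f g by (intro continuous_intros)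
  define U where "U = {t \<in> {0<..<T}. f t - g t \<in> - {0}}"
  have U: "open U"
  proof -
    have "continuous_on {0<..<T} (\<lambda>t. f t - g t)" by (rule continuous_on_subset[OF d]) auto
    then have "open ({0<..<T} \<inter> (\<lambda>t. f t - g t) -` (- {0}))"
      by (rule continuous_open_preimage) auto
    moreover have "U = {0<..<T} \<inter> (\<lambda>t. f t - g t) -` (- {0})" by (auto simp: U_def)
    ultimately show ?thesis by simp
  qed
  have "AE t in lborel. t \<notin> U" using ae by eventually_elim (auto simp: U_def)
  then have "U \<in> null_sets lborel" using U by (subst AE_iff_null_sets) auto
  then have "negligible U" by (simp add: negligible_iff_null_sets null_sets_completionI)
  then have "U = {}" using open_not_negligible[OF U] by blast
  then have zero: "f s - g s = 0" if "s \<in> {0<..<T}" for s using that by (auto simp: U_def)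
  have "f t - g t = 0"
    by (rule continuous_constant_on_closure[where S="{0<..<T}"]) (use d t T zero in simp_all)
  then show ?thesis by simp
qed

section \<open>Density of continuous functions\<close>

lemma abs_L2_dominated_tendsto:
  fixes f :: "nat \<Rightarrow> real \<Rightarrow> real"
  assumes f: "\<And>n. square_integrable (f n)" and g: "square_integrable g" and w: "square_integrable w"
    and lim: "AE x in lborel. (\<lambda>n. f n x) \<longlonglongrightarrow> g x"
    and dom: "\<And>n x. \<bar>f n x - g x\<bar> \<le> w x"
  shows "(\<lambda>n. abs_L2 (f n)) \<longlonglongrightarrow> abs_L2 g"
proof -
  have sqi: "square_integrable (\<lambda>x. f n x - g x)" for n by (intro square_integrable_diff f g)
  have "(\<lambda>n. \<integral>x. (f n x - g x)\<^sup>2 \<partial>lborel) \<longlonglongrightarrow> (\<integral>x. 0 \<partial>(lborel :: real measure))"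
  proof (rule integral_dominated_convergence)
    show "integrable lborel (\<lambda>x. (w x)\<^sup>2)" using w by (simp add: square_integrable_real_iff)
    show "(\<lambda>x. (f n x - g x)\<^sup>2) \<in> borel_measurable lborel" for n
      using sqi[of n] by (auto simp: square_integrable_real_iff)
    show "AE x in lborel. norm ((f n x - g x)\<^sup>2) \<le> (w x)\<^sup>2" for n
    proof (rule AE_I2)
      fix x
      have "\<bar>f n x - g x\<bar> \<le> \<bar>w x\<bar>" using dom[of n x] by linarith
      then show "norm ((f n x - g x)\<^sup>2) \<le> (w x)\<^sup>2" by (simp add: abs_le_square_iff)
    qed
    show "AE x in lborel. (\<lambda>n. (f n x - g x)\<^sup>2) \<longlonglongrightarrow> 0"
      using lim
    proof eventually_elim
      case (elim x)
      have "(\<lambda>n. (f n x - g x)\<^sup>2) \<longlonglongrightarrow> (g x - g x)\<^sup>2" by (intro tendsto_intros elim)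
      then show ?case by simp
    qed
  qed simp
  then have "(\<lambda>n. sqrt ((norm (abs_L2 (f n) - abs_L2 g))\<^sup>2)) \<longlonglongrightarrow> sqrt 0"
    by (intro tendsto_real_sqrt) (simp add: abs_L2_diff[OF f g] norm_abs_L2[OF sqi])
  then show ?thesis by (simp add: LIM_zero_iff tendsto_norm_zero_iff)
qed

definition clip :: "real \<Rightarrow> real \<Rightarrow> real" where
  "clip M x = max (- M) (min M x)"

text \<open>
  Two approximations: truncation makes the function bounded, and a measurable function is an almost
  everywhere limit of continuous functions, which may be truncated at the same height. Both steps
  converge in \<open>L\<^sub>2\<close> by dominated convergence.
\<close>

lemma continuous_dense_L2_interval:
  assumes q: "q \<in> L2_on {0<..<T}" and T: "0 < T" and e: "0 < e"
  shows "\<exists>g :: real \<Rightarrow> real. continuous_on UNIV g \<and> norm (q - curve_class T g) < e"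
proof -
  let ?I = "indicat_real {0<..<T}"
  have clip_bound: "\<bar>clip M x\<bar> \<le> M" if "0 \<le> M" for M x using that by (auto simp: clip_def)
  have clip_meas: "(\<lambda>x. clip M (h x)) \<in> borel_measurable borel" if "h \<in> borel_measurable borel" for M h
    using that unfolding clip_def by measurable
  have sqi_clip: "square_integrable (\<lambda>t. ?I t * clip M (h t))"
    if "h \<in> borel_measurable borel" "0 \<le> M" for M h
    using clip_bound[of M] that clip_meas[OF that(1), of M]
    by (intro square_integrable_bounded_support[of _ "{0<..<T}" M]) (auto simp: indicator_def)
  have q_supp: "AE t in lborel. rep_L2 q t = ?I t * rep_L2 q t"
    using q unfolding L2_on_def mem_Collect_eq by eventually_elim (auto simp: indicator_def)
  have sqi_q: "square_integrable (\<lambda>t. ?I t * rep_L2 q t)"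
    unfolding square_integrable_real_iff
  proof
    show "integrable lborel (\<lambda>t. (?I t * rep_L2 q t)\<^sup>2)"
    proof (rule Bochner_Integration.integrable_bound)
      show "integrable lborel (\<lambda>t. (rep_L2 q t)\<^sup>2)"
        using square_integrable_rep[of q] by (simp add: square_integrable_real_iff)
    qed (auto simp: indicator_def)
  qed measurable
  have q_eq: "q = abs_L2 (\<lambda>t. ?I t * rep_L2 q t)"
    by (rule L2_eq_absI[OF sqi_q q_supp])
  have "(\<lambda>n. abs_L2 (\<lambda>t. ?I t * clip (real n) (rep_L2 q t))) \<longlonglongrightarrow> abs_L2 (\<lambda>t. ?I t * rep_L2 q t)"
  proof (rule abs_L2_dominated_tendsto)
    show "square_integrable (\<lambda>t. \<bar>?I t * rep_L2 q t\<bar>)"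
      using sqi_q by (auto simp: square_integrable_real_iff)
    show "\<bar>?I t * clip (real n) (rep_L2 q t) - ?I t * rep_L2 q t\<bar> \<le> \<bar>?I t * rep_L2 q t\<bar>" for n t
      by (auto simp: indicator_def clip_def)
    show "AE t in lborel. (\<lambda>n. ?I t * clip (real n) (rep_L2 q t)) \<longlonglongrightarrow> ?I t * rep_L2 q t"
    proof (intro AE_I2 tendsto_mult tendsto_const tendsto_eventually)
      fix t
      obtain N :: nat where "\<bar>rep_L2 q t\<bar> \<le> real N" using real_arch_simple by blast
      then show "\<forall>\<^sub>F n in sequentially. clip (real n) (rep_L2 q t) = rep_L2 q t"
        by (intro eventually_sequentiallyI[of N]) (auto simp: clip_def)
    qed
  qed (auto intro: sqi_clip sqi_q)
  from LIMSEQ_D[OF this[folded q_eq] half_gt_zero[OF e]]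
  obtain M :: nat where M: "norm (abs_L2 (\<lambda>t. ?I t * clip (real M) (rep_L2 q t)) - q) < e / 2" by blast
  have "rep_L2 q measurable_on UNIV"
    by (rule lebesgue_measurable_imp_measurable_on_real) (auto intro: measurable_completion)
  then obtain N g where N: "negligible N" and g: "\<And>n::nat. continuous_on UNIV (g n)"
    and g_lim: "\<And>x. x \<notin> N \<Longrightarrow> (\<lambda>n. g n x) \<longlonglongrightarrow> rep_L2 q x"
    unfolding measurable_on_def by auto
  have g_clip: "continuous_on UNIV (\<lambda>t. clip (real M) (g n t))" for n
    unfolding clip_def by (intro continuous_intros g)
  have "(\<lambda>n. abs_L2 (\<lambda>t. ?I t * clip (real M) (g n t))) \<longlonglongrightarrow> abs_L2 (\<lambda>t. ?I t * clip (real M) (rep_L2 q t))"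
  proof (rule abs_L2_dominated_tendsto)
    show "square_integrable (\<lambda>t. ?I t * (2 * real M))"
      by (rule square_integrable_bounded_support[of _ "{0<..<T}" "2 * real M"]) (auto simp: indicator_def)
    show "\<bar>?I t * clip (real M) (g n t) - ?I t * clip (real M) (rep_L2 q t)\<bar> \<le> ?I t * (2 * real M)" for n t
      using clip_bound[of "real M" "g n t"] clip_bound[of "real M" "rep_L2 q t"]
      by (auto simp: indicator_def)
    have "AE t in lebesgue. t \<notin> N" using N by (intro AE_not_in) (simp add: negligible_iff_null_sets)
    then have "AE t in lborel. t \<notin> N" by (simp add: AE_completion_iff)
    then show "AE t in lborel. (\<lambda>n. ?I t * clip (real M) (g n t)) \<longlonglongrightarrow> ?I t * clip (real M) (rep_L2 q t)"
    proof eventually_elim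
      case (elim t)
      then show ?case unfolding clip_def by (intro tendsto_intros g_lim)
    qed
    show "square_integrable (\<lambda>t. ?I t * clip (real M) (g n t))" for n
      by (intro sqi_clip borel_measurable_continuous_onI g) simp
  qed (auto intro: sqi_clip)
  from LIMSEQ_D[OF this half_gt_zero[OF e]]
  obtain n where n: "norm (abs_L2 (\<lambda>t. ?I t * clip (real M) (g n t))
      - abs_L2 (\<lambda>t. ?I t * clip (real M) (rep_L2 q t))) < e / 2" by blast
  have "curve_class T (\<lambda>t. clip (real M) (g n t)) = abs_L2 (\<lambda>t. ?I t * clip (real M) (g n t))"
    by (simp add: curve_class_def)
  then have "norm (q - curve_class T (\<lambda>t. clip (real M) (g n t))) < e"
    using M n norm_triangle_ineq4[of "abs_L2 (\<lambda>t. ?I t * clip (real M) (g n t))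
      - abs_L2 (\<lambda>t. ?I t * clip (real M) (rep_L2 q t))" "q - abs_L2 (\<lambda>t. ?I t * clip (real M) (rep_L2 q t))"]
    by (simp add: norm_minus_commute algebra_simps)
  with g_clip show ?thesis by blast
qed

lemma continuous_seq_L2_interval:
  assumes q: "q \<in> L2_on {0<..<T}" and T: "0 < T"
  obtains g :: "nat \<Rightarrow> real \<Rightarrow> real" where "\<And>n. continuous_on UNIV (g n)"
    "(\<lambda>n. curve_class T (g n)) \<longlonglongrightarrow> q"
proof -
  have "\<forall>n. \<exists>g :: real \<Rightarrow> real. continuous_on UNIV g \<and> norm (q - curve_class T g) < inverse (real (Suc n))"
    by (intro allI continuous_dense_L2_interval[OF q T]) simp
  from choice[OF this] obtain g :: "nat \<Rightarrow> real \<Rightarrow> real" where g: "\<And>n. continuous_on UNIV (g n)"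
    "\<And>n. norm (q - curve_class T (g n)) < inverse (real (Suc n))" by blast
  have "norm (curve_class T (g n) - q) \<le> inverse (real (Suc n))" for n
    using less_imp_le[OF g(2)[of n]] by (subst norm_minus_commute)
  then have "(\<lambda>n. curve_class T (g n) - q) \<longlonglongrightarrow> 0"
    by (intro Lim_null_comparison[OF _ LIMSEQ_inverse_real_of_nat] always_eventually allI)
  from that[OF g(1) LIM_zero_cancel[OF this]] show ?thesis .
qed

section \<open>Primitives vanishing at the final time\<close>

text \<open>
  The primitive \<open>-\<integral>\<^sub>t\<^sup>T q\<close> that vanishes at \<open>T\<close>. It is written as an inner product so
  that linearity and the Cauchy-Schwarz bounds come for free.
\<close>

definition end_primitive :: "real \<Rightarrow> (real, real) L2 \<Rightarrow> real \<Rightarrow> real" where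
  "end_primitive T q t = - (q \<bullet> abs_L2 (indicat_real {t<..<T}))"

definition end_primitive_class :: "real \<Rightarrow> (real, real) L2 \<Rightarrow> (real, real) L2" where
  "end_primitive_class T q = curve_class T (end_primitive T q)"

lemma square_integrable_indicator:
  "bounded A \<Longrightarrow> A \<in> sets borel \<Longrightarrow> square_integrable (indicat_real A)"
  by (rule square_integrable_bounded_support[of _ A 1]) (auto simp: indicator_def)

lemma norm_indicator_Ioc:
  assumes "s \<le> t"
  shows "norm (abs_L2 (indicat_real {s<..t})) = sqrt (t - s)"
proof -
  have eq: "(\<lambda>x. (norm (indicat_real {s<..t} x))\<^sup>2) = indicat_real {s<..t}"
    by (auto simp: fun_eq_iff indicator_def)
  have "(norm (abs_L2 (indicat_real {s<..t})))\<^sup>2 = (\<integral>x. indicat_real {s<..t} x \<partial>lborel)"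
    by (rule trans[OF norm_abs_L2[OF square_integrable_indicator]]) (simp, simp, simp only: eq)
  also have "\<dots> = t - s" using assms by simp
  finally show ?thesis by (intro real_sqrt_unique[symmetric]) auto
qed

text \<open>
  The Hoelder bound of exponent one half from the Cauchy-Schwarz inequality; it gives continuity and,
  with the zero at \<open>T\<close>, boundedness.
\<close>

lemma end_primitive_diff_le:
  assumes st: "s \<le> t" "t \<le> T"
  shows "\<bar>end_primitive T q t - end_primitive T q s\<bar> \<le> norm q * sqrt (t - s)"
proof -
  have "abs_L2 (indicat_real {s<..<T}) - abs_L2 (indicat_real {t<..<T}) = abs_L2 (indicat_real {s<..t})"
    (is "?l = _")
  proof -
    have "?l = abs_L2 (\<lambda>x. indicat_real {s<..<T} x - indicat_real {t<..<T} x)"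
      by (intro abs_L2_diff square_integrable_indicator) auto
    also have "\<dots> = abs_L2 (indicat_real {s<..t})"
    proof (rule abs_L2_eqI)
      show "AE x in lborel. indicat_real {s<..<T} x - indicat_real {t<..<T} x = indicat_real {s<..t} x"
        using AE_lborel_singleton[of T] by eventually_elim (use st in \<open>auto simp: indicator_def\<close>)
    qed (intro square_integrable_diff square_integrable_indicator; simp)+
    finally show ?thesis .
  qed
  then have "end_primitive T q t - end_primitive T q s = q \<bullet> abs_L2 (indicat_real {s<..t})"
    by (simp add: end_primitive_def inner_diff_right[symmetric])
  then show ?thesis
    using Cauchy_Schwarz_ineq2[of q "abs_L2 (indicat_real {s<..t})"] by (simp add: norm_indicator_Ioc[OF st(1)])
qed

lemma end_primitive_end: "end_primitive T q T = 0"
proof -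
  have "indicat_real {T<..<T} = (\<lambda>x. 0)" by (simp add: fun_eq_iff)
  then show ?thesis by (simp only: end_primitive_def zero_L2_abs[symmetric]) simp
qed

lemma end_primitive_bound:
  assumes "t \<in> {0..T}"
  shows "\<bar>end_primitive T q t\<bar> \<le> norm q * sqrt T"
proof -
  have "\<bar>end_primitive T q t\<bar> \<le> norm q * sqrt (T - t)"
    using end_primitive_diff_le[of t T T q] assms by (simp add: end_primitive_end)
  also have "\<dots> \<le> norm q * sqrt T" using assms by (intro mult_left_mono) auto
  finally show ?thesis .
qed

lemma end_primitive_continuous: "continuous_on {0..T} (end_primitive T q)"
  unfolding continuous_on_def
proof
  fix t assume t: "t \<in> {0..T}"
  have "((\<lambda>s. end_primitive T q s - end_primitive T q t) \<longlongrightarrow> 0) (at t within {0..T})"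
  proof (rule Lim_null_comparison)
    show "\<forall>\<^sub>F s in at t within {0..T}. norm (end_primitive T q s - end_primitive T q t) \<le> norm q * sqrt \<bar>s - t\<bar>"
    proof (unfold eventually_at_filter, intro always_eventually allI impI)
      fix s assume "s \<noteq> t" "s \<in> {0..T}"
      then show "norm (end_primitive T q s - end_primitive T q t) \<le> norm q * sqrt \<bar>s - t\<bar>"
        using end_primitive_diff_le[of s t T q] end_primitive_diff_le[of t s T q] t
        by (cases "s \<le> t") (auto simp: abs_minus_commute)
    qed
    have "((\<lambda>s. norm q * sqrt \<bar>s - t\<bar>) \<longlongrightarrow> norm q * sqrt \<bar>t - t\<bar>) (at t within {0..T})"
      by (intro tendsto_intros)
    then show "((\<lambda>s. norm q * sqrt \<bar>s - t\<bar>) \<longlongrightarrow> 0) (at t within {0..T})" by simp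
  qed
  then show "(end_primitive T q \<longlongrightarrow> end_primitive T q t) (at t within {0..T})" by (rule LIM_zero_cancel)
qed

lemma end_primitive_class_diff:
  "end_primitive_class T (p - q) = end_primitive_class T p - end_primitive_class T q"
proof -
  have "end_primitive T (p - q) = (\<lambda>t. end_primitive T p t + (-1) *\<^sub>R end_primitive T q t)"
    by (simp add: fun_eq_iff end_primitive_def inner_diff_left)
  then show ?thesis
    unfolding end_primitive_class_def
    by (simp only: curve_class_add[OF end_primitive_continuous continuous_on_scaleR[OF continuous_on_const end_primitive_continuous]]
        curve_class_scaleR[OF end_primitive_continuous]) simp
qed

lemma end_primitive_class_tendsto:
  assumes T: "0 < T" and "q \<longlonglongrightarrow> l"
  shows "(\<lambda>n. end_primitive_class T (q n)) \<longlonglongrightarrow> end_primitive_class T l"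
proof -
  have "(\<lambda>n. end_primitive_class T (q n - l)) \<longlonglongrightarrow> 0"
  proof (rule Lim_null_comparison)
    show "\<forall>\<^sub>F n in sequentially. norm (end_primitive_class T (q n - l)) \<le> sqrt T * (norm (q n - l) * sqrt T)"
      unfolding end_primitive_class_def
      using T by (intro always_eventually allI norm_curve_class_le end_primitive_continuous)
        (auto intro: end_primitive_bound)
    have "(\<lambda>n. sqrt T * (norm (q n - l) * sqrt T)) \<longlonglongrightarrow> sqrt T * (norm (l - l) * sqrt T)"
      by (intro tendsto_intros assms)
    then show "(\<lambda>n. sqrt T * (norm (q n - l) * sqrt T)) \<longlonglongrightarrow> 0" by simp
  qed
  then show ?thesis unfolding end_primitive_class_diff by (rule LIM_zero_cancel)
qed

lemma integral_FTC_Ioo: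
  fixes F f :: "real \<Rightarrow> real"
  assumes "a \<le> b" "\<And>x. x \<in> {a..b} \<Longrightarrow> (F has_vector_derivative f x) (at x within {a..b})"
    "continuous_on {a..b} f"
  shows "(\<integral>x. indicator {a<..<b} x * f x \<partial>lborel) = F b - F a"
proof -
  have eq: "(\<integral>x. indicator {a..b} x * f x \<partial>lborel) = F b - F a"
    using integral_FTC_Icc[of a b F f] assms by auto
  have int: "integrable lborel (\<lambda>x. indicator {a..b} x * f x)"
    using borel_integrable_compact[OF compact_Icc assms(3)] by simp
  have "(\<lambda>x. indicator {a<..<b} x *\<^sub>R (indicator {a..b} x * f x)) \<in> borel_measurable lborel"
    using int by (intro borel_measurable_scaleR) auto
  moreover have "(\<lambda>x. indicator {a<..<b} x *\<^sub>R (indicator {a..b} x * f x)) = (\<lambda>x. indicator {a<..<b} x * f x)"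
    by (auto simp: indicator_def fun_eq_iff)
  ultimately have meas: "(\<lambda>x. indicator {a<..<b} x * f x) \<in> borel_measurable lborel" by simp
  have "(\<integral>x. indicator {a<..<b} x * f x \<partial>lborel) = (\<integral>x. indicator {a..b} x * f x \<partial>lborel)"
  proof (rule integral_cong_AE[OF meas borel_measurable_integrable[OF int]])
    show "AE x in lborel. indicator {a<..<b} x * f x = indicator {a..b} x * f x"
      using AE_lborel_singleton[of a] AE_lborel_singleton[of b]
      by eventually_elim (auto simp: indicator_def)
  qed
  with eq show ?thesis by simp
qed

lemma end_primitive_curve_class:
  assumes T: "0 < T" and g: "continuous_on {0..T} g" and t: "t \<in> {0..T}"
  shows "(end_primitive T (curve_class T g) has_vector_derivative g t) (at t within {0..T})"
proof -
  obtain G where G: "\<And>x. x \<in> {0..T} \<Longrightarrow> (G has_vector_derivative g x) (at x within {0..T})"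
    using antiderivative_continuous[OF g] by blast
  have eq: "end_primitive T (curve_class T g) x = G x - G T" if x: "x \<in> {0..T}" for x
  proof -
    have "curve_class T g \<bullet> abs_L2 (indicat_real {x<..<T})
        = (\<integral>s. (indicator {0<..<T} s *\<^sub>R g s) \<bullet> indicat_real {x<..<T} s \<partial>lborel)"
      unfolding curve_class_def
      by (intro inner_abs_L2 square_integrable_interval_curve square_integrable_indicator g) auto
    also have "\<dots> = (\<integral>s. indicator {x<..<T} s * g s \<partial>lborel)"
      using x by (intro Bochner_Integration.integral_cong) (auto simp: indicator_def)
    also have "\<dots> = G T - G x"
    proof (rule integral_FTC_Ioo)
      show "(G has_vector_derivative g s) (at s within {x..T})" if "s \<in> {x..T}" for s
        using G[of s] that x by (auto intro: has_vector_derivative_within_subset)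
    qed (use x g in \<open>auto intro: continuous_on_subset\<close>)
    finally show ?thesis by (simp add: end_primitive_def)
  qed
  have "((\<lambda>x. G x - G T) has_vector_derivative g t) (at t within {0..T})"
    using has_vector_derivative_diff[OF G[OF t] has_vector_derivative_const[of "G T"]] by simp
  then show ?thesis
    by (rule has_vector_derivative_transform[OF t eq, rotated])
qed

lemma test_function_DERIV:
  assumes "\<psi> \<in> test_functions S"
  shows "(\<psi> has_real_derivative frechet_derivative \<psi> (at x) 1) (at x)"
proof -
  have d: "(\<psi> has_derivative frechet_derivative \<psi> (at x)) (at x)"
    by (rule test_function_has_derivative[OF assms])
  then have lin: "linear (frechet_derivative \<psi> (at x))" by (rule has_derivative_linear)
  have "frechet_derivative \<psi> (at x) = (\<lambda>h. frechet_derivative \<psi> (at x) 1 * h)"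
  proof
    fix h :: real
    have "frechet_derivative \<psi> (at x) (h *\<^sub>R 1) = h *\<^sub>R frechet_derivative \<psi> (at x) 1"
      by (rule linear_scale[OF lin])
    then show "frechet_derivative \<psi> (at x) h = frechet_derivative \<psi> (at x) 1 * h"
      by (simp only: real_scaleR_def mult_1_right mult_1_left mult.commute)
  qed
  with d show ?thesis unfolding has_field_derivative_def by (rule subst[rotated])
qed

lemma inner_curve_class_test_function:
  assumes "continuous_on {0..T} g" "square_integrable \<psi>"
  shows "curve_class T g \<bullet> abs_L2 \<psi> = (\<integral>t. indicator {0<..<T} t * (g t * \<psi> t) \<partial>lborel)"
  unfolding curve_class_def
  using inner_abs_L2[OF square_integrable_interval_curve[OF assms(1)] assms(2)]
  by (simp add: mult.assoc)

text \<open>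
  For continuous \<open>p\<close> this is the fundamental theorem of calculus. Both sides of the weak identity are
  continuous in \<open>p\<close> for the \<open>L\<^sub>2\<close> norm, and continuous functions are dense.
\<close>

lemma end_primitive_class_weak_partial:
  assumes T: "0 < T" and p: "p \<in> L2_on {0<..<T}"
  shows "is_weak_partial {0<..<T} 1 (end_primitive_class T p) p"
proof (subst is_weak_partial_iff, simp, intro conjI ballI)
  show "end_primitive_class T p \<in> L2_on {0<..<T}"
    unfolding end_primitive_class_def by (rule curve_class_L2_on[OF end_primitive_continuous])
  show "p \<in> L2_on {0<..<T}" by (rule p)
  fix \<psi> assume \<psi>: "\<psi> \<in> test_functions {0<..<T}"
  let ?\<psi>' = "\<lambda>t. frechet_derivative \<psi> (at t) 1"
  have \<psi>': "?\<psi>' \<in> test_functions {0<..<T}" by (rule test_function_partial[OF \<psi>]) simp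
  obtain g where g: "\<And>n. continuous_on UNIV (g n)" and lim: "(\<lambda>n. curve_class T (g n)) \<longlonglongrightarrow> p"
    using continuous_seq_L2_interval[OF p T] by blast
  obtain K where "K \<subseteq> {0<..<T}" "\<And>x. x \<notin> K \<Longrightarrow> \<psi> x = 0"
    using test_functionE[OF \<psi>] by metis
  then have zero: "\<psi> 0 = 0" "\<psi> T = 0" by force+
  have "end_primitive_class T (curve_class T (g n)) \<bullet> abs_L2 ?\<psi>' = - (curve_class T (g n) \<bullet> abs_L2 \<psi>)" for n
  proof -
    let ?P = "end_primitive T (curve_class T (g n))"
    have gn: "continuous_on {0..T} (g n)" using g by (rule continuous_on_subset) simp
    have "(\<integral>t. indicator {0<..<T} t * (?P t * ?\<psi>' t + g n t * \<psi> t) \<partial>lborel) = ?P T * \<psi> T - ?P 0 * \<psi> 0"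
    proof (rule integral_FTC_Ioo)
      show "((\<lambda>t. ?P t * \<psi> t) has_vector_derivative ?P t * ?\<psi>' t + g n t * \<psi> t) (at t within {0..T})"
        if "t \<in> {0..T}" for t
        using end_primitive_curve_class[OF T gn that]
          has_field_derivative_at_within[OF test_function_DERIV[OF \<psi>, of t]]
        unfolding has_real_derivative_iff_has_vector_derivative[symmetric]
        by (auto intro!: derivative_eq_intros)
      show "continuous_on {0..T} (\<lambda>t. ?P t * ?\<psi>' t + g n t * \<psi> t)"
        by (intro continuous_intros end_primitive_continuous gn test_function_continuous[OF \<psi>] test_function_continuous[OF \<psi>'])
    qed (use T in simp)
    moreover have "(\<integral>t. indicator {0<..<T} t * (?P t * ?\<psi>' t + g n t * \<psi> t) \<partial>lborel)
        = (\<integral>t. indicator {0<..<T} t * (?P t * ?\<psi>' t) \<partial>lborel) + (\<integral>t. indicator {0<..<T} t * (g n t * \<psi> t) \<partial>lborel)"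
    proof -
      have "integrable lborel (\<lambda>t. indicator {0<..<T} t * (?P t * ?\<psi>' t))"
        "integrable lborel (\<lambda>t. indicator {0<..<T} t * (g n t * \<psi> t))"
        using square_integrable_inner[OF square_integrable_interval_curve[OF end_primitive_continuous]
              test_function_square_integrable[OF \<psi>']]
          square_integrable_inner[OF square_integrable_interval_curve[OF gn] test_function_square_integrable[OF \<psi>]]
        by (simp_all add: mult.assoc)
      then show ?thesis by (simp add: distrib_left)
    qed
    ultimately show ?thesis
      unfolding end_primitive_class_def
      by (simp add: zero inner_curve_class_test_function[OF end_primitive_continuous test_function_square_integrable[OF \<psi>']]
          inner_curve_class_test_function[OF gn test_function_square_integrable[OF \<psi>]])
  qed
  moreover have "(\<lambda>n. end_primitive_class T (curve_class T (g n)) \<bullet> abs_L2 ?\<psi>') \<longlonglongrightarrow> end_primitive_class T p \<bullet> abs_L2 ?\<psi>'"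
    by (intro tendsto_intros end_primitive_class_tendsto[OF T lim])
  moreover have "(\<lambda>n. - (curve_class T (g n) \<bullet> abs_L2 \<psi>)) \<longlonglongrightarrow> - (p \<bullet> abs_L2 \<psi>)"
    by (intro tendsto_intros lim)
  ultimately show "end_primitive_class T p \<bullet> abs_L2 ?\<psi>' = - (p \<bullet> abs_L2 \<psi>)"
    using LIMSEQ_unique by simp
qed

section \<open>Functions with a weak derivative on an interval\<close>

text \<open>
  If the integral vanishes, the primitive of a function supported in \<open>[a,b]\<close> is again
  supported in \<open>[a,b]\<close>.
\<close>

lemma test_function_primitive:
  fixes T :: real
  assumes T: "0 < T" and \<theta>: "\<theta> \<in> test_functions {0<..<T}" and zero: "(\<integral>t. \<theta> t \<partial>lborel) = 0"
  obtains \<Theta> where "\<Theta> \<in> test_functions {0<..<T}" "\<And>t. frechet_derivative \<Theta> (at t) 1 = \<theta> t"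
proof -
  obtain K where K: "compact K" "K \<subseteq> {0<..<T}" "\<And>x. x \<notin> K \<Longrightarrow> \<theta> x = 0"
    using test_functionE[OF \<theta>] by metis
  obtain a b where ab: "0 < a" "a \<le> b" "b < T" "K \<subseteq> {a..b}"
  proof (cases "K = {}")
    case True
    then show ?thesis using that[of "T/2" "T/2"] T by simp
  next
    case False
    obtain a b where "a \<in> K" "\<forall>t\<in>K. a \<le> t" "b \<in> K" "\<forall>t\<in>K. t \<le> b"
      using compact_attains_inf[OF K(1) False] compact_attains_sup[OF K(1) False] by metis
    then show ?thesis using K(2) by (intro that[of a b]) auto
  qed
  have \<theta>0: "\<theta> t = 0" if "t \<notin> {a..b}" for t using that K(3) ab(4) by blast
  \<comment> \<open>The primitive is taken on a larger interval so that all of \<open>[a,b]\<close> lies in its interior,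
     where one-sided and two-sided derivatives agree.\<close>
  obtain G where G: "\<And>x. x \<in> {-1..T+1} \<Longrightarrow> (G has_vector_derivative \<theta> x) (at x within {-1..T+1})"
    using antiderivative_continuous[OF test_function_continuous[OF \<theta>]] by blast
  have G_sub: "(G has_vector_derivative \<theta> x) (at x within A)" if "x \<in> {-1..T+1}" "A \<subseteq> {-1..T+1}" for x A
    using has_vector_derivative_within_subset[OF G] that by blast
  have "(\<integral>t. indicator {a..b} t *\<^sub>R \<theta> t \<partial>lborel) = G b - G a"
    using ab by (intro integral_FTC_Icc G_sub test_function_continuous[OF \<theta>]) auto
  moreover have "(\<lambda>t. indicator {a..b} t *\<^sub>R \<theta> t) = \<theta>" using \<theta>0 by (auto simp: fun_eq_iff indicator_def)
  ultimately have Gab: "G b = G a" using zero by simp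
  have \<theta>a: "\<theta> a = 0"
  proof -
    have "isCont \<theta> a" using test_function_continuous[OF \<theta>, of UNIV] by (simp add: continuous_on_eq_continuous_at)
    then have "(\<theta> \<longlongrightarrow> \<theta> a) (at_left a)" unfolding isCont_def by (rule filterlim_mono) (auto simp: at_le)
    moreover have "(\<theta> \<longlongrightarrow> 0) (at_left a)"
      by (rule tendsto_eventually) (auto simp: eventually_at_filter \<theta>0)
    ultimately show ?thesis by (rule tendsto_unique[rotated]) simp
  qed
  have \<theta>b: "\<theta> b = 0"
  proof -
    have "isCont \<theta> b" using test_function_continuous[OF \<theta>, of UNIV] by (simp add: continuous_on_eq_continuous_at)
    then have "(\<theta> \<longlongrightarrow> \<theta> b) (at_right b)" unfolding isCont_def by (rule filterlim_mono) (auto simp: at_le)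
    moreover have "(\<theta> \<longlongrightarrow> 0) (at_right b)"
      by (rule tendsto_eventually) (auto simp: eventually_at_filter \<theta>0)
    ultimately show ?thesis by (rule tendsto_unique[rotated]) simp
  qed
  have left: "G x = G a" if "x \<in> {-1..a}" for x
  proof -
    have "\<exists>c. \<forall>x\<in>{-1..a}. G x = c"
    proof (rule has_vector_derivative_zero_constant)
      show "(G has_vector_derivative 0) (at x within {-1..a})" if "x \<in> {-1..a}" for x
        using G_sub[of x "{-1..a}"] that ab \<theta>0[of x] \<theta>a by (cases "x = a") auto
    qed auto
    then show ?thesis using that ab by force
  qed
  have right: "G x = G a" if "x \<in> {b..T+1}" for x
  proof -
    have "\<exists>c. \<forall>x\<in>{b..T+1}. G x = c"
    proof (rule has_vector_derivative_zero_constant)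
      show "(G has_vector_derivative 0) (at x within {b..T+1})" if "x \<in> {b..T+1}" for x
        using G_sub[of x "{b..T+1}"] that ab \<theta>0[of x] \<theta>b by (cases "x = b") auto
    qed auto
    then show ?thesis using that ab Gab by force
  qed
  define \<Theta> where "\<Theta> x = (if x \<in> {a..b} then G x - G a else 0)" for x
  have der: "(\<Theta> has_real_derivative \<theta> x) (at x)" for x
  proof (cases "x \<in> {-1<..<T+1}")
    case True
    have "(G has_real_derivative \<theta> x) (at x)"
      using G[of x] True at_within_Icc_at[of "-1" x "T+1"]
      by (simp add: has_real_derivative_iff_has_vector_derivative)
    then have "((\<lambda>y. G y - G a) has_real_derivative \<theta> x) (at x)" by (auto intro!: derivative_eq_intros)
    then show ?thesis
    proof (rule has_field_derivative_transform_within_open)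
      show "G y - G a = \<Theta> y" if "y \<in> {-1<..<T+1}" for y
        using that left[of y] right[of y] by (auto simp: \<Theta>_def)
    qed (use True in auto)
  next
    case False
    have "((\<lambda>_. 0) has_real_derivative \<theta> x) (at x)" using False ab \<theta>0[of x] by auto
    then show ?thesis
    proof (rule has_field_derivative_transform_within_open[where S="- {a..b}"])
      show "0 = \<Theta> y" if "y \<in> - {a..b}" for y using that by (auto simp: \<Theta>_def)
    qed (use False ab in auto)
  qed
  then have fder: "(\<Theta> has_derivative (\<lambda>h. \<theta> x * h)) (at x)" for x
    by (simp add: has_field_derivative_def)
  have "C_k (Suc k) \<Theta>" for k
    by (rule C_k_SucI[OF fder]) (simp add: test_function_C_k[OF \<theta>])
  then have "C_k k \<Theta>" for k by (rule C_k_Suc_imp)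
  then have "\<Theta> \<in> test_functions {0<..<T}"
    using ab by (intro test_functionI[of _ "{a..b}"]) (auto simp: \<Theta>_def)
  moreover have "frechet_derivative \<Theta> (at t) 1 = \<theta> t" for t
    by (simp add: frechet_derivative_at[OF fder, symmetric])
  ultimately show ?thesis using that by blast
qed

lemma test_function_integrable:
  assumes "\<psi> \<in> test_functions S"
  shows "integrable lborel \<psi>"
proof -
  obtain K where K: "compact K" "\<And>x. x \<notin> K \<Longrightarrow> \<psi> x = 0"
    using test_functionE[OF assms] by metis
  have "(\<lambda>x. indicator K x *\<^sub>R \<psi> x) = \<psi>" by (auto simp: fun_eq_iff indicator_def K)
  then show ?thesis
    using borel_integrable_compact[OF K(1) test_function_continuous[OF assms]] by simp
qed

text \<open>
  Du Bois-Reymond: every test function is a multiple of one fixed \<open>\<psi>\<close> with nonzero integral plus the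
  derivative of a test function, so that \<open>w\<close> is determined by the single number \<open>(w, \<psi>)\<close>.
\<close>

lemma weak_partial_zero_imp_const:
  assumes T: "0 < T" and w: "is_weak_partial {0<..<T} 1 w 0"
  shows "\<exists>c. w = curve_class T (\<lambda>_. c)"
proof -
  define \<psi> where "\<psi> = box_cutoff 1 (T/3) (2*T/3)"
  have \<psi>: "\<psi> \<in> test_functions {0<..<T}"
    unfolding \<psi>_def using T by (intro box_cutoff_test_function) auto
  \<comment> \<open>Any test function with nonzero integral would do; this one is a cutoff on the middle third.\<close>
  define m where "m = (\<integral>t. \<psi> t \<partial>lborel)"
  have "m \<noteq> 0"
  proof
    assume "m = 0"
    then have "AE t in lborel. \<psi> t = 0"
      unfolding m_def
      by (subst (asm) integral_nonneg_eq_0_iff_AE[OF test_function_integrable[OF \<psi>]])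
         (auto simp: \<psi>_def box_cutoff_bounds)
    then have "\<psi> (T/2) = 0"
      using T by (intro continuous_AE_eq[OF T test_function_continuous[OF \<psi>] continuous_on_const]) auto
    moreover have "T/2 \<in> box (T/3) (2*T/3)" using T by simp
    ultimately show False using box_bump_pos[of "T/2" "T/3" "2*T/3"] by (simp add: \<psi>_def box_cutoff_def)
  qed
  define c where "c = (w \<bullet> abs_L2 \<psi>) / m"
  have w_perp: "w \<bullet> abs_L2 (\<lambda>t. frechet_derivative \<Theta> (at t) 1) = 0" if "\<Theta> \<in> test_functions {0<..<T}" for \<Theta>
    using w that by (subst (asm) is_weak_partial_iff) auto
  have inner_c: "curve_class T (\<lambda>_. c) \<bullet> abs_L2 \<eta> = c * (\<integral>t. \<eta> t \<partial>lborel)" if \<eta>: "\<eta> \<in> test_functions {0<..<T}" for \<eta>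
  proof -
    obtain K where K: "K \<subseteq> {0<..<T}" "\<And>x. x \<notin> K \<Longrightarrow> \<eta> x = 0" using test_functionE[OF \<eta>] by metis
    have "(\<lambda>t. indicator {0<..<T} t * (c * \<eta> t)) = (\<lambda>t. c * \<eta> t)"
    proof
      fix t
      have "\<eta> t = 0" if "t \<notin> {0<..<T}" using that K by blast
      then show "indicator {0<..<T} t * (c * \<eta> t) = c * \<eta> t" by (cases "t \<in> {0<..<T}") auto
    qed
    then show ?thesis
      using inner_curve_class_test_function[OF continuous_on_const test_function_square_integrable[OF \<eta>], of T c] by simp
  qed
  have "w - curve_class T (\<lambda>_. c) = 0"
  proof (rule test_functions_total)
    show "w - curve_class T (\<lambda>_. c) \<in> L2_on {0<..<T}"
      using w by (intro subspace_diff[OF subspace_L2_on] curve_class_L2_on) (auto simp: is_weak_partial_def)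
    fix \<eta> assume \<eta>: "\<eta> \<in> test_functions {0<..<T}"
    define s where "s = (\<integral>t. \<eta> t \<partial>lborel) / m"
    let ?\<theta> = "\<lambda>t. \<eta> t + (- s) * \<psi> t"
    have \<theta>: "?\<theta> \<in> test_functions {0<..<T}" by (intro test_function_add test_function_scale \<eta> \<psi>)
    have "(\<integral>t. ?\<theta> t \<partial>lborel) = (\<integral>t. \<eta> t \<partial>lborel) + (- s) * m"
      unfolding m_def
      by (subst Bochner_Integration.integral_add)
         (auto intro: test_function_integrable[OF \<eta>] integrable_mult_right test_function_integrable[OF \<psi>])
    then have "(\<integral>t. ?\<theta> t \<partial>lborel) = 0" using \<open>m \<noteq> 0\<close> by (simp add: s_def)
    then obtain \<Theta> where \<Theta>: "\<Theta> \<in> test_functions {0<..<T}" "\<And>t. frechet_derivative \<Theta> (at t) 1 = ?\<theta> t"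
      using test_function_primitive[OF T \<theta>] by blast
    have "w \<bullet> abs_L2 ?\<theta> = 0" using w_perp[OF \<Theta>(1)] unfolding \<Theta>(2) .
    moreover have "abs_L2 ?\<theta> = abs_L2 \<eta> + (- s) *\<^sub>R abs_L2 \<psi>"
      using abs_L2_add[OF test_function_square_integrable[OF \<eta>] square_integrable_scaleR[OF test_function_square_integrable[OF \<psi>]], of "- s"]
        abs_L2_scaleR[OF test_function_square_integrable[OF \<psi>], of "- s"] by simp
    ultimately have "w \<bullet> abs_L2 \<eta> = s * (w \<bullet> abs_L2 \<psi>)" by (simp add: inner_add_right inner_diff_right)
    also have "\<dots> = c * (\<integral>t. \<eta> t \<partial>lborel)" by (simp add: s_def c_def)
    finally show "(w - curve_class T (\<lambda>_. c)) \<bullet> abs_L2 \<eta> = 0" by (simp add: inner_diff_left inner_c[OF \<eta>])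
  qed simp
  then show ?thesis by auto
qed

text \<open>
  A weak derivative determines the function up to a constant, and the end value fixes the constant.
\<close>

lemma weak_partial_imp_end_primitive:
  assumes T: "0 < T" and u: "is_weak_partial {0<..<T} 1 u p" and "end": "end_value T u 0"
  shows "u = end_primitive_class T p"
proof -
  have p: "p \<in> L2_on {0<..<T}" using u by (simp add: is_weak_partial_def)
  have "is_weak_partial {0<..<T} 1 (u + (-1) *\<^sub>R end_primitive_class T p) (p + (-1) *\<^sub>R p)"
    by (intro is_weak_partial_add is_weak_partial_scaleR u end_primitive_class_weak_partial[OF T p]) auto
  then have "is_weak_partial {0<..<T} 1 (u - end_primitive_class T p) 0" by simp
  then obtain c where c: "u - end_primitive_class T p = curve_class T (\<lambda>_. c)"
    using weak_partial_zero_imp_const[OF T] by blast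
  have cont: "continuous_on {0..T} (\<lambda>t. c + end_primitive T p t)"
    by (intro continuous_intros end_primitive_continuous)
  have u_eq: "u = curve_class T (\<lambda>t. c + end_primitive T p t)"
    using c curve_class_add[OF continuous_on_const[of _ c] end_primitive_continuous[of T p]]
    by (simp add: end_primitive_class_def algebra_simps)
  obtain f where f: "continuous_on {0..T} f" "AE t in lborel. t \<in> {0<..<T} \<longrightarrow> rep_L2 u t = f t" "f T = 0"
    using "end" by (auto simp: end_value_def)
  have "AE t in lborel. t \<in> {0<..<T} \<longrightarrow> f t = c + end_primitive T p t"
    using f(2) rep_curve_class_AE[OF cont] unfolding u_eq[symmetric] by eventually_elim auto
  from continuous_AE_eq[OF T f(1) cont this, of T] have "c = 0"
    using T f(3) by (simp add: end_primitive_end)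
  then show ?thesis by (simp add: u_eq end_primitive_class_def)
qed

text \<open>
  An element of \<open>H\<^sup>2\<close> with vanishing end data is the twofold primitive of its second derivative.
  This representation carries the whole approximation argument: approximating the second derivative
  by continuous functions approximates the function, and the end conditions hold automatically.
\<close>

lemma H2_end_primitive:
  assumes T: "0 < T" and \<rho>: "\<rho> \<in> H2_end T"
  obtains p q where "q \<in> L2_on {0<..<T}" "p = end_primitive_class T q" "\<rho> = end_primitive_class T p"
proof -
  let ?I = "{0<..<T}"
  have H1: "\<rho> \<in> Sobolev_H1 ?I" "weak_partial ?I 1 \<rho> \<in> Sobolev_H1 ?I"
    and ends: "end_value T \<rho> 0" "end_value T (weak_partial ?I 1 \<rho>) 0"
    using \<rho> by (auto simp: H2_end_def Sobolev_H2_def)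
  have wp: "is_weak_partial ?I 1 \<rho> (weak_partial ?I 1 \<rho>)"
    "is_weak_partial ?I 1 (weak_partial ?I 1 \<rho>) (weak_partial ?I 1 (weak_partial ?I 1 \<rho>))"
    by (intro is_weak_partial_weak_partial H1; simp)+
  have "weak_partial ?I 1 (weak_partial ?I 1 \<rho>) \<in> L2_on ?I"
    using wp(2) by (simp add: is_weak_partial_def)
  from that[OF this weak_partial_imp_end_primitive[OF T wp(2) ends(2)]
      weak_partial_imp_end_primitive[OF T wp(1) ends(1)]]
  show ?thesis .
qed

section \<open>Uniqueness for a second-order equation\<close>

text \<open>
  Gronwall: for \<open>C = 1 + \<bar>\<mu>\<bar>\<close> the function \<open>exp(C t) (r\<^sup>2 + s\<^sup>2)\<close> is nondecreasing, and it
  vanishes at the right end.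
\<close>

lemma oscillator_zero:
  fixes r s :: "real \<Rightarrow> real"
  assumes r: "\<And>t. t \<in> {0..T} \<Longrightarrow> (r has_vector_derivative s t) (at t within {0..T})"
    and s: "\<And>t. t \<in> {0..T} \<Longrightarrow> (s has_vector_derivative \<mu> * r t) (at t within {0..T})"
    and "end": "r T = 0" "s T = 0" and t: "t \<in> {0..T}"
  shows "r t = 0"
proof -
  define C where "C = 1 + \<bar>\<mu>\<bar>"
  define E where "E x = exp (C * x) * ((r x)\<^sup>2 + (s x)\<^sup>2)" for x
  have "continuous_on {0..T} r" "continuous_on {0..T} s"
    using r s by (meson continuous_on_eq_continuous_within has_vector_derivative_continuous)+
  then have contE: "continuous_on {t..T} E"
    unfolding E_def using t by (intro continuous_intros) (auto intro: continuous_on_subset)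
  have "E t \<le> E T"
  proof (rule DERIV_nonneg_imp_increasing_open[OF _ _ contE])
    show "t \<le> T" using t by simp
    fix x assume x: "t < x" "x < T"
    then have "at x within {0..T} = at x" "x \<in> {0..T}" using t by (auto intro!: at_within_Icc_at)
    then have dr: "(r has_real_derivative s x) (at x)" and ds: "(s has_real_derivative \<mu> * r x) (at x)"
      using r[of x] s[of x] by (simp_all add: has_real_derivative_iff_has_vector_derivative)
    let ?D = "exp (C * x) * (C * ((r x)\<^sup>2 + (s x)\<^sup>2) + 2 * (1 + \<mu>) * (r x * s x))"
    have "(E has_real_derivative ?D) (at x)"
      unfolding E_def by (auto intro!: derivative_eq_intros dr ds simp: algebra_simps power2_eq_square)
    moreover have "0 \<le> ?D"
    proof -
      have "\<bar>2 * (1 + \<mu>) * (r x * s x)\<bar> = \<bar>1 + \<mu>\<bar> * (2 * \<bar>r x\<bar> * \<bar>s x\<bar>)"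
        by (simp only: abs_mult abs_numeral mult_ac)
      also have "\<dots> \<le> C * ((r x)\<^sup>2 + (s x)\<^sup>2)"
        using sum_squares_bound[of "\<bar>r x\<bar>" "\<bar>s x\<bar>"] by (intro mult_mono) (auto simp: C_def)
      finally show ?thesis by (intro mult_nonneg_nonneg) auto
    qed
    ultimately show "\<exists>y. (E has_real_derivative y) (at x) \<and> 0 \<le> y" by blast
  qed
  then have "exp (C * t) * ((r t)\<^sup>2 + (s t)\<^sup>2) \<le> 0" by (simp add: E_def "end")
  then have "(r t)\<^sup>2 + (s t)\<^sup>2 \<le> 0" by (simp add: mult_le_0_iff)
  then show ?thesis by (simp add: sum_power2_le_zero_iff)
qed

text \<open>
  The relation \<open>\<rho>'' = \<mu> \<rho>\<close> bootstraps: the primitive of a continuous representative of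
  \<open>\<rho>\<close> is differentiable, so \<open>\<rho>\<close> solves the ordinary differential equation classically.
\<close>

lemma H2_end_eigenfunction_zero:
  assumes T: "0 < T" and p: "p = end_primitive_class T q" and \<rho>: "\<rho> = end_primitive_class T p"
    and q: "q = \<mu> *\<^sub>R \<rho>"
  shows "\<rho> = 0"
proof -
  let ?f = "end_primitive T p"
  let ?s = "end_primitive T q"
  have \<rho>_eq: "\<rho> = curve_class T ?f" and p_eq: "p = curve_class T ?s"
    using \<rho> p by (simp_all add: end_primitive_class_def)
  have cont: "continuous_on {0..T} (\<lambda>t. \<mu> *\<^sub>R ?f t)" by (intro continuous_intros end_primitive_continuous)
  have q_eq: "q = curve_class T (\<lambda>t. \<mu> *\<^sub>R ?f t)"
    unfolding curve_class_scaleR[OF end_primitive_continuous] using q \<rho>_eq by simp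
  have zero: "?f t = 0" if "t \<in> {0..T}" for t
  proof (rule oscillator_zero[of T ?f ?s \<mu>])
    show "(?f has_vector_derivative ?s t) (at t within {0..T})" if "t \<in> {0..T}" for t
      using end_primitive_curve_class[OF T end_primitive_continuous that, of q] unfolding p_eq[symmetric] .
    show "(?s has_vector_derivative \<mu> * ?f t) (at t within {0..T})" if "t \<in> {0..T}" for t
      using end_primitive_curve_class[OF T cont that] unfolding q_eq[symmetric] by simp
  qed (use that in \<open>auto simp: end_primitive_end\<close>)
  have "\<rho> = curve_class T (\<lambda>_. 0)"
    unfolding \<rho>_eq by (rule curve_class_cong) (use zero in auto)
  then show ?thesis by (simp add: curve_class_def zero_L2_abs)
qed

section \<open>Differentiable curves in normed subspaces\<close>

lemma seminorm_tendsto_add: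
  assumes N: "seminorm_on X N" and f: "((\<lambda>s. N (f s)) \<longlongrightarrow> 0) F" and g: "((\<lambda>s. N (g s)) \<longlongrightarrow> 0) F"
    and X: "\<forall>\<^sub>F s in F. f s \<in> X" "\<forall>\<^sub>F s in F. g s \<in> X"
  shows "((\<lambda>s. N (f s + g s)) \<longlongrightarrow> 0) F"
proof (rule tendsto_sandwich[of "\<lambda>_. 0" _ _ "\<lambda>s. N (f s) + N (g s)"])
  show "\<forall>\<^sub>F s in F. 0 \<le> N (f s + g s)"
    using X by eventually_elim (use N in \<open>auto simp: seminorm_on_def subspace_add\<close>)
  show "\<forall>\<^sub>F s in F. N (f s + g s) \<le> N (f s) + N (g s)"
    using X by eventually_elim (use N in \<open>auto simp: seminorm_on_def\<close>)
  show "((\<lambda>s. N (f s) + N (g s)) \<longlongrightarrow> 0) F" using tendsto_add[OF f g] by simp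
qed simp

lemma seminorm_tendsto_scaleR:
  assumes N: "seminorm_on X N" and f: "((\<lambda>s. N (f s)) \<longlongrightarrow> 0) F" and X: "\<forall>\<^sub>F s in F. f s \<in> X"
  shows "((\<lambda>s. N (c *\<^sub>R f s)) \<longlongrightarrow> 0) F"
proof (rule Lim_transform_eventually)
  show "((\<lambda>s. \<bar>c\<bar> * N (f s)) \<longlongrightarrow> 0) F" using tendsto_mult_right_zero[OF f, of "\<bar>c\<bar>"] by simp
  show "\<forall>\<^sub>F s in F. \<bar>c\<bar> * N (f s) = N (c *\<^sub>R f s)"
    using X by eventually_elim (use N in \<open>simp add: seminorm_on_def\<close>)
qed

lemma C_k_into_mem: "C_k_into k T X N v \<Longrightarrow> t \<in> {0..T} \<Longrightarrow> v t \<in> X"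
  by (cases k) auto

lemma C_k_into_SucI:
  assumes "\<And>t. t \<in> {0..T} \<Longrightarrow> v t \<in> X" "C_k_into k T X N v'"
    "\<And>t. t \<in> {0..T} \<Longrightarrow> ((\<lambda>s. N ((v s - v t) /\<^sub>R (s - t) - v' t)) \<longlongrightarrow> 0) (at t within {0..T})"
  shows "C_k_into (Suc k) T X N v"
  unfolding C_k_into.simps(2) using assms by blast

lemma C_k_into_SucE:
  assumes "C_k_into (Suc k) T X N v"
  obtains v' where "C_k_into k T X N v'"
    "\<And>t. t \<in> {0..T} \<Longrightarrow> ((\<lambda>s. N ((v s - v t) /\<^sub>R (s - t) - v' t)) \<longlongrightarrow> 0) (at t within {0..T})"
  using assms unfolding C_k_into.simps(2) by blast

lemma eventually_within_interval: "\<forall>\<^sub>F s in at t within {0..T}. s \<in> {0..T::real}"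
  by (simp add: eventually_at_filter)

lemma C_k_into_cong:
  assumes "C_k_into k T X N v" and eq: "\<And>t. t \<in> {0..T} \<Longrightarrow> v t = w t"
  shows "C_k_into k T X N w"
proof (cases k)
  case 0
  have "((\<lambda>s. N (w s - w t)) \<longlongrightarrow> 0) (at t within {0..T})" if t: "t \<in> {0..T}" for t
  proof (rule Lim_transform_eventually)
    show "((\<lambda>s. N (v s - v t)) \<longlongrightarrow> 0) (at t within {0..T})" using assms(1) t 0 by simp
    show "\<forall>\<^sub>F s in at t within {0..T}. N (v s - v t) = N (w s - w t)"
      using eventually_within_interval by eventually_elim (simp only: eq eq[OF t])
  qed
  then show ?thesis using assms 0 by simp
next
  case (Suc m)
  then obtain v' where v': "C_k_into m T X N v'"
    "\<And>t. t \<in> {0..T} \<Longrightarrow> ((\<lambda>s. N ((v s - v t) /\<^sub>R (s - t) - v' t)) \<longlongrightarrow> 0) (at t within {0..T})"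
    using assms(1) by auto
  have "((\<lambda>s. N ((w s - w t) /\<^sub>R (s - t) - v' t)) \<longlongrightarrow> 0) (at t within {0..T})" if t: "t \<in> {0..T}" for t
  proof (rule Lim_transform_eventually[OF v'(2)[OF t]])
    show "\<forall>\<^sub>F s in at t within {0..T}. N ((v s - v t) /\<^sub>R (s - t) - v' t) = N ((w s - w t) /\<^sub>R (s - t) - v' t)"
      using eventually_within_interval by eventually_elim (simp only: eq eq[OF t])
  qed
  moreover have "w t \<in> X" if "t \<in> {0..T}" for t using C_k_into_mem[OF assms(1) that] eq[OF that] by simp
  ultimately show ?thesis unfolding Suc by (intro C_k_into_SucI[OF _ v'(1)])
qed

lemma C_k_into_add:
  assumes N: "seminorm_on X N"
  shows "C_k_into k T X N v \<Longrightarrow> C_k_into k T X N w \<Longrightarrow> C_k_into k T X N (\<lambda>t. v t + w t)"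
proof (induction k arbitrary: v w)
  case 0
  have X: "subspace X" using N by (simp add: seminorm_on_def)
  have "((\<lambda>s. N (v s + w s - (v t + w t))) \<longlongrightarrow> 0) (at t within {0..T})" if t: "t \<in> {0..T}" for t
  proof -
    have "((\<lambda>s. N ((v s - v t) + (w s - w t))) \<longlongrightarrow> 0) (at t within {0..T})"
    proof (rule seminorm_tendsto_add[OF N])
      show "\<forall>\<^sub>F s in at t within {0..T}. v s - v t \<in> X" "\<forall>\<^sub>F s in at t within {0..T}. w s - w t \<in> X"
        using 0 t by (auto intro!: eventually_mono[OF eventually_within_interval] subspace_diff[OF X])
    qed (use 0 t in auto)
    then show ?thesis by (simp add: algebra_simps)
  qed
  then show ?case using 0 by (auto intro: subspace_add[OF X])
next
  case (Suc k)
  have X: "subspace X" using N by (simp add: seminorm_on_def)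
  obtain v' where v': "C_k_into k T X N v'"
    "\<And>t. t \<in> {0..T} \<Longrightarrow> ((\<lambda>s. N ((v s - v t) /\<^sub>R (s - t) - v' t)) \<longlongrightarrow> 0) (at t within {0..T})"
    using C_k_into_SucE[OF Suc.prems(1)] by blast
  obtain w' where w': "C_k_into k T X N w'"
    "\<And>t. t \<in> {0..T} \<Longrightarrow> ((\<lambda>s. N ((w s - w t) /\<^sub>R (s - t) - w' t)) \<longlongrightarrow> 0) (at t within {0..T})"
    using C_k_into_SucE[OF Suc.prems(2)] by blast
  note mem = C_k_into_mem[OF Suc.prems(1)] C_k_into_mem[OF Suc.prems(2)] C_k_into_mem[OF v'(1)] C_k_into_mem[OF w'(1)]
  have "((\<lambda>s. N ((v s + w s - (v t + w t)) /\<^sub>R (s - t) - (v' t + w' t))) \<longlongrightarrow> 0) (at t within {0..T})"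
    if t: "t \<in> {0..T}" for t
  proof -
    have "((\<lambda>s. N (((v s - v t) /\<^sub>R (s - t) - v' t) + ((w s - w t) /\<^sub>R (s - t) - w' t))) \<longlongrightarrow> 0) (at t within {0..T})"
    proof (rule seminorm_tendsto_add[OF N v'(2)[OF t] w'(2)[OF t]])
      show "\<forall>\<^sub>F s in at t within {0..T}. (v s - v t) /\<^sub>R (s - t) - v' t \<in> X"
        "\<forall>\<^sub>F s in at t within {0..T}. (w s - w t) /\<^sub>R (s - t) - w' t \<in> X"
        using t by (auto intro!: eventually_mono[OF eventually_within_interval] subspace_diff[OF X]
            subspace_scale[OF X] mem)
    qed
    then show ?thesis by (simp add: algebra_simps)
  qed
  then show ?case
    using Suc.IH[OF v'(1) w'(1)] mem(1,2) subspace_add[OF X] by (auto intro!: exI[of _ "\<lambda>t. v' t + w' t"])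
qed

lemma C_k_into_scaleR:
  assumes N: "seminorm_on X N"
  shows "C_k_into k T X N v \<Longrightarrow> C_k_into k T X N (\<lambda>t. c *\<^sub>R v t)"
proof (induction k arbitrary: v)
  case 0
  have X: "subspace X" using N by (simp add: seminorm_on_def)
  have "((\<lambda>s. N (c *\<^sub>R (v s - v t))) \<longlongrightarrow> 0) (at t within {0..T})" if t: "t \<in> {0..T}" for t
  proof (rule seminorm_tendsto_scaleR[OF N])
    show "\<forall>\<^sub>F s in at t within {0..T}. v s - v t \<in> X"
      using 0 t by (auto intro!: eventually_mono[OF eventually_within_interval] subspace_diff[OF X])
  qed (use 0 t in auto)
  then show ?case using 0 by (auto simp: scaleR_diff_right intro: subspace_scale[OF X])
next
  case (Suc k)
  have X: "subspace X" using N by (simp add: seminorm_on_def)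
  obtain v' where v': "C_k_into k T X N v'"
    "\<And>t. t \<in> {0..T} \<Longrightarrow> ((\<lambda>s. N ((v s - v t) /\<^sub>R (s - t) - v' t)) \<longlongrightarrow> 0) (at t within {0..T})"
    using C_k_into_SucE[OF Suc.prems(1)] by blast
  note mem = C_k_into_mem[OF Suc.prems(1)] C_k_into_mem[OF v'(1)]
  have "((\<lambda>s. N ((c *\<^sub>R v s - c *\<^sub>R v t) /\<^sub>R (s - t) - c *\<^sub>R v' t)) \<longlongrightarrow> 0) (at t within {0..T})"
    if t: "t \<in> {0..T}" for t
  proof -
    have "((\<lambda>s. N (c *\<^sub>R ((v s - v t) /\<^sub>R (s - t) - v' t))) \<longlongrightarrow> 0) (at t within {0..T})"
    proof (rule seminorm_tendsto_scaleR[OF N v'(2)[OF t]])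
      show "\<forall>\<^sub>F s in at t within {0..T}. (v s - v t) /\<^sub>R (s - t) - v' t \<in> X"
        using t by (auto intro!: eventually_mono[OF eventually_within_interval] subspace_diff[OF X]
            subspace_scale[OF X] mem)
    qed
    then show ?thesis by (simp add: scaleR_diff_right mult.commute)
  qed
  then show ?case
    using Suc.IH[OF v'(1)] mem(1) subspace_scale[OF X] by (auto intro!: exI[of _ "\<lambda>t. c *\<^sub>R v' t"])
qed

lemma C_k_into_scalar_curve:
  fixes r :: "real \<Rightarrow> real"
  assumes N: "seminorm_on X N" and \<phi>: "\<phi> \<in> X"
  shows "C_k_into k T UNIV norm r \<Longrightarrow> C_k_into k T X N (\<lambda>t. r t *\<^sub>R \<phi>)"
proof (induction k arbitrary: r)
  case 0
  have "((\<lambda>s. N (r s *\<^sub>R \<phi> - r t *\<^sub>R \<phi>)) \<longlongrightarrow> 0) (at t within {0..T})" if t: "t \<in> {0..T}" for t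
  proof -
    have "((\<lambda>s. norm (r s - r t) * N \<phi>) \<longlongrightarrow> 0) (at t within {0..T})"
      using 0 t by (intro tendsto_mult_left_zero) auto
    then show ?thesis using N \<phi> by (simp add: scaleR_diff_left[symmetric] seminorm_on_def)
  qed
  then show ?case using N \<phi> by (auto simp: seminorm_on_def subspace_scale)
next
  case (Suc k)
  obtain r' where r': "C_k_into k T UNIV norm r'"
    "\<And>t. t \<in> {0..T} \<Longrightarrow> ((\<lambda>s. norm ((r s - r t) /\<^sub>R (s - t) - r' t)) \<longlongrightarrow> 0) (at t within {0..T})"
    using C_k_into_SucE[OF Suc.prems] by blast
  have "((\<lambda>s. N ((r s *\<^sub>R \<phi> - r t *\<^sub>R \<phi>) /\<^sub>R (s - t) - r' t *\<^sub>R \<phi>)) \<longlongrightarrow> 0) (at t within {0..T})"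
    if t: "t \<in> {0..T}" for t
  proof -
    have eq: "(r s *\<^sub>R \<phi> - r t *\<^sub>R \<phi>) /\<^sub>R (s - t) - r' t *\<^sub>R \<phi> = ((r s - r t) /\<^sub>R (s - t) - r' t) *\<^sub>R \<phi>" for s
      by (simp add: scaleR_diff_left right_diff_distrib scaleR_diff_right)
    have "N (((r s - r t) /\<^sub>R (s - t) - r' t) *\<^sub>R \<phi>) = norm ((r s - r t) /\<^sub>R (s - t) - r' t) * N \<phi>" for s
      using N \<phi> by (simp add: seminorm_on_def)
    moreover have "((\<lambda>s. norm ((r s - r t) /\<^sub>R (s - t) - r' t) * N \<phi>) \<longlongrightarrow> 0) (at t within {0..T})"
      by (rule tendsto_mult_left_zero[OF r'(2)[OF t]])
    ultimately show ?thesis unfolding eq by simp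
  qed
  then show ?case
    using Suc.IH[OF r'(1)] N \<phi> by (auto simp: seminorm_on_def subspace_scale intro!: exI[of _ "\<lambda>t. r' t *\<^sub>R \<phi>"])
qed

lemma C_k_into_0_continuous:
  "C_k_into 0 T UNIV norm v \<longleftrightarrow> continuous_on {0..T} v"
  by (simp add: continuous_on_def LIM_zero_iff tendsto_norm_zero_iff)

lemma C_k_into_Suc_real:
  fixes r :: "real \<Rightarrow> real"
  assumes "\<And>t. t \<in> {0..T} \<Longrightarrow> (r has_vector_derivative r' t) (at t within {0..T})"
    and "C_k_into k T UNIV norm r'"
  shows "C_k_into (Suc k) T UNIV norm r"
proof -
  have "((\<lambda>s. norm ((r s - r t) /\<^sub>R (s - t) - r' t)) \<longlongrightarrow> 0) (at t within {0..T})" if "t \<in> {0..T}" for t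
  proof (rule tendsto_norm_zero, rule LIM_zero)
    show "((\<lambda>s. (r s - r t) /\<^sub>R (s - t)) \<longlongrightarrow> r' t) (at t within {0..T})"
      using assms(1)[OF that]
      by (simp add: has_real_derivative_iff_has_vector_derivative[symmetric] has_field_derivative_iff
          divide_inverse mult.commute)
  qed
  then show ?thesis by (intro C_k_into_SucI[OF UNIV_I assms(2)])
qed

lemma tderiv_eqI:
  assumes "0 < T" "t \<in> {0..T}" "(v has_vector_derivative d) (at t within {0..T})"
  shows "tderiv T v t = d"
  unfolding tderiv_def
  using vector_derivative_within_cbox[of 0 T t v d] assms by simp

text \<open>
  Identifies the derivative hidden in the existential quantifier of \<open>C_k_into\<close> with \<open>tderiv\<close>.
\<close>

lemma C_k_into_Suc_tderiv:
  assumes T: "0 < T" and v: "C_k_into (Suc k) T X norm v"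
  shows "\<And>t. t \<in> {0..T} \<Longrightarrow> (v has_vector_derivative tderiv T v t) (at t within {0..T})"
    and "C_k_into k T X norm (tderiv T v)"
proof -
  obtain v' where v': "C_k_into k T X norm v'"
    "\<And>t. t \<in> {0..T} \<Longrightarrow> ((\<lambda>s. norm ((v s - v t) /\<^sub>R (s - t) - v' t)) \<longlongrightarrow> 0) (at t within {0..T})"
    using C_k_into_SucE[OF v] by blast
  have der: "(v has_vector_derivative v' t) (at t within {0..T})" if t: "t \<in> {0..T}" for t
    unfolding has_vector_derivative_def has_derivative_iff_norm
  proof
    show "bounded_linear (\<lambda>x. x *\<^sub>R v' t)" by (rule bounded_linear_scaleR_left)
    show "((\<lambda>s. norm (v s - v t - (s - t) *\<^sub>R v' t) / norm (s - t)) \<longlongrightarrow> 0) (at t within {0..T})"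
    proof (rule Lim_transform_eventually[OF v'(2)[OF t]])
      have "norm ((v s - v t) /\<^sub>R (s - t) - v' t) = norm (v s - v t - (s - t) *\<^sub>R v' t) / norm (s - t)"
        if "s \<noteq> t" for s
      proof -
        have "(v s - v t) /\<^sub>R (s - t) - v' t = (v s - v t - (s - t) *\<^sub>R v' t) /\<^sub>R (s - t)"
          using that by (simp add: scaleR_diff_right)
        then show ?thesis by (simp add: divide_inverse mult.commute)
      qed
      then show "\<forall>\<^sub>F s in at t within {0..T}. norm ((v s - v t) /\<^sub>R (s - t) - v' t)
          = norm (v s - v t - (s - t) *\<^sub>R v' t) / norm (s - t)"
        by (simp add: eventually_at_filter)
    qed
  qed
  have eq: "tderiv T v t = v' t" if "t \<in> {0..T}" for t
    by (rule tderiv_eqI[OF T that der[OF that]])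
  show "(v has_vector_derivative tderiv T v t) (at t within {0..T})" if "t \<in> {0..T}" for t
    using der eq that by simp
  show "C_k_into k T X norm (tderiv T v)"
    by (rule C_k_into_cong[OF v'(1)]) (simp add: eq)
qed

section \<open>The operator on smooth curves\<close>

text \<open>
  Convergence in the graph norm makes \<open>t \<mapsto> A v(t)\<close> continuous, so the curve that defines \<open>B\<^sup>* v\<close> is a
  continuous one and its class in \<open>L\<^sub>2(I;H)\<close> is meaningful.
\<close>

lemma C2_T_D:
  assumes T: "0 < T" and \<Omega>: "open \<Omega>" and v: "v \<in> C2_T T \<Omega>"
  shows "\<And>t. t \<in> {0..T} \<Longrightarrow> (v has_vector_derivative tderiv T v t) (at t within {0..T})"
    "\<And>t. t \<in> {0..T} \<Longrightarrow> (tderiv T v has_vector_derivative tderiv T (tderiv T v) t) (at t within {0..T})"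
    "continuous_on {0..T} (tderiv T (tderiv T v))"
    "\<And>t. t \<in> {0..T} \<Longrightarrow> tderiv T (tderiv T v) t \<in> L2_on \<Omega>"
    "\<And>t. t \<in> {0..T} \<Longrightarrow> v t \<in> domain_A \<Omega>"
    "continuous_on {0..T} (\<lambda>t. op_A \<Omega> (v t))"
    "v T = 0" "tderiv T v T = 0"
proof -
  have v2: "C_k_into (Suc (Suc 0)) T (L2_on \<Omega>) norm v" and v0: "C_k_into 0 T (domain_A \<Omega>) (graph_norm \<Omega>) v"
    using v by (auto simp: C2_T_def numeral_2_eq_2)
  note d1 = C_k_into_Suc_tderiv[OF T v2]
  note d2 = C_k_into_Suc_tderiv[OF T d1(2)]
  show "\<And>t. t \<in> {0..T} \<Longrightarrow> (v has_vector_derivative tderiv T v t) (at t within {0..T})"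
    "\<And>t. t \<in> {0..T} \<Longrightarrow> (tderiv T v has_vector_derivative tderiv T (tderiv T v) t) (at t within {0..T})"
    using d1(1) d2(1) by blast+
  show "\<And>t. t \<in> {0..T} \<Longrightarrow> tderiv T (tderiv T v) t \<in> L2_on \<Omega>"
    using C_k_into_mem[OF d2(2)] .
  show "continuous_on {0..T} (tderiv T (tderiv T v))"
    using d2(2) by (simp add: continuous_on_def LIM_zero_iff tendsto_norm_zero_iff)
  show dom: "\<And>t. t \<in> {0..T} \<Longrightarrow> v t \<in> domain_A \<Omega>"
    using C_k_into_mem[OF v0] .
  show "v T = 0" "tderiv T v T = 0" using v by (auto simp: C2_T_def)
  show "continuous_on {0..T} (\<lambda>t. op_A \<Omega> (v t))"
    unfolding continuous_on_def
  proof
    fix t assume t: "t \<in> {0..T}"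
    have "((\<lambda>s. op_A \<Omega> (v s) - op_A \<Omega> (v t)) \<longlongrightarrow> 0) (at t within {0..T})"
    proof (rule Lim_null_comparison)
      show "((\<lambda>s. graph_norm \<Omega> (v s - v t)) \<longlongrightarrow> 0) (at t within {0..T})" using v0 t by simp
      show "\<forall>\<^sub>F s in at t within {0..T}. norm (op_A \<Omega> (v s) - op_A \<Omega> (v t)) \<le> graph_norm \<Omega> (v s - v t)"
        using eventually_within_interval
      proof eventually_elim
        case (elim s)
        have m: "(-1) *\<^sub>R v t \<in> domain_A \<Omega>" by (intro subspace_scale[OF subspace_domain_A[OF \<Omega>]] dom t)
        have "op_A \<Omega> (v s - v t) = op_A \<Omega> (v s) - op_A \<Omega> (v t)"
          using op_A_add[OF \<Omega> dom[OF elim] m] op_A_scaleR[OF \<Omega> dom[OF t], of "-1"] by simp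
        then show ?case by (simp add: graph_norm_def flip: real_sqrt_abs)
      qed
    qed
    then show "((\<lambda>t. op_A \<Omega> (v t)) \<longlongrightarrow> op_A \<Omega> (v t)) (at t within {0..T})" by (rule LIM_zero_cancel)
  qed
qed

lemma tderiv_two:
  assumes T: "0 < T"
    and d1: "\<And>t. t \<in> {0..T} \<Longrightarrow> (v has_vector_derivative v' t) (at t within {0..T})"
    and d2: "\<And>t. t \<in> {0..T} \<Longrightarrow> (v' has_vector_derivative v'' t) (at t within {0..T})"
    and t: "t \<in> {0..T}"
  shows "tderiv T v t = v' t" "tderiv T (tderiv T v) t = v'' t"
proof -
  have eq: "tderiv T v s = v' s" if "s \<in> {0..T}" for s by (rule tderiv_eqI[OF T that d1[OF that]])
  show "tderiv T v t = v' t" by (rule eq[OF t])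
  show "tderiv T (tderiv T v) t = v'' t"
    by (rule tderiv_eqI[OF T t has_vector_derivative_transform[OF t eq d2[OF t]]])
qed

lemma Bstar_C2_eq:
  assumes T: "0 < T"
    and d1: "\<And>t. t \<in> {0..T} \<Longrightarrow> (v has_vector_derivative v' t) (at t within {0..T})"
    and d2: "\<And>t. t \<in> {0..T} \<Longrightarrow> (v' has_vector_derivative v'' t) (at t within {0..T})"
  shows "Bstar_C2 T \<Omega> v = curve_class T (\<lambda>t. v'' t + op_A \<Omega> (v t))"
  unfolding Bstar_C2_def
  by (rule curve_class_cong) (use tderiv_two(2)[OF T d1 d2] in auto)

lemma C2_T_add:
  assumes T: "0 < T" and \<Omega>: "open \<Omega>" and v: "v \<in> C2_T T \<Omega>" and w: "w \<in> C2_T T \<Omega>"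
  shows "(\<lambda>t. v t + w t) \<in> C2_T T \<Omega>"
    and "Bstar_C2 T \<Omega> (\<lambda>t. v t + w t) = Bstar_C2 T \<Omega> v + Bstar_C2 T \<Omega> w"
proof -
  note V = C2_T_D[OF T \<Omega> v] and W = C2_T_D[OF T \<Omega> w]
  note d = has_vector_derivative_add[OF V(1) W(1)] has_vector_derivative_add[OF V(2) W(2)]
  note H10 = seminorm_on_Sobolev_H10[OF \<Omega>]
  have "tderiv T (\<lambda>t. v t + w t) T = 0"
    using tderiv_two(1)[OF T d, of T] T V(8) W(8) by simp
  then show "(\<lambda>t. v t + w t) \<in> C2_T T \<Omega>"
    using v w unfolding C2_T_def
    by (auto intro: C_k_into_add[OF seminorm_on_norm[OF subspace_L2_on]] C_k_into_add[OF H10]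
        C_k_into_add[OF seminorm_on_graph_norm[OF \<Omega>]] simp del: C_k_into.simps)
  have "Bstar_C2 T \<Omega> (\<lambda>t. v t + w t)
      = curve_class T (\<lambda>t. (tderiv T (tderiv T v) t + tderiv T (tderiv T w) t) + op_A \<Omega> (v t + w t))"
    by (rule Bstar_C2_eq[OF T d])
  also have "\<dots> = curve_class T (\<lambda>t. (tderiv T (tderiv T v) t + op_A \<Omega> (v t)) + (tderiv T (tderiv T w) t + op_A \<Omega> (w t)))"
    by (rule curve_class_cong) (use V(5) W(5) in \<open>simp add: op_A_add[OF \<Omega>]\<close>)
  also have "\<dots> = Bstar_C2 T \<Omega> v + Bstar_C2 T \<Omega> w"
    unfolding Bstar_C2_def by (intro curve_class_add continuous_on_add V(3,6) W(3,6))
  finally show "Bstar_C2 T \<Omega> (\<lambda>t. v t + w t) = Bstar_C2 T \<Omega> v + Bstar_C2 T \<Omega> w" .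
qed

lemma C2_T_scaleR:
  assumes T: "0 < T" and \<Omega>: "open \<Omega>" and v: "v \<in> C2_T T \<Omega>"
  shows "(\<lambda>t. c *\<^sub>R v t) \<in> C2_T T \<Omega>"
    and "Bstar_C2 T \<Omega> (\<lambda>t. c *\<^sub>R v t) = c *\<^sub>R Bstar_C2 T \<Omega> v"
proof -
  note V = C2_T_D[OF T \<Omega> v]
  have sc: "((\<lambda>t. c *\<^sub>R f t) has_vector_derivative c *\<^sub>R f') F"
    if "(f has_vector_derivative f') F" for f :: "real \<Rightarrow> ('a, real) L2" and f' F
    by (rule bounded_linear.has_vector_derivative[OF bounded_linear_scaleR_right that])
  note d = sc[OF V(1)] sc[OF V(2)]
  note H10 = seminorm_on_Sobolev_H10[OF \<Omega>]
  have "tderiv T (\<lambda>t. c *\<^sub>R v t) T = 0"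
    using tderiv_two(1)[OF T d, of T] T V(8) by simp
  then show "(\<lambda>t. c *\<^sub>R v t) \<in> C2_T T \<Omega>"
    using v unfolding C2_T_def
    by (auto intro: C_k_into_scaleR[OF seminorm_on_norm[OF subspace_L2_on]] C_k_into_scaleR[OF H10]
        C_k_into_scaleR[OF seminorm_on_graph_norm[OF \<Omega>]] simp del: C_k_into.simps)
  have "Bstar_C2 T \<Omega> (\<lambda>t. c *\<^sub>R v t)
      = curve_class T (\<lambda>t. c *\<^sub>R tderiv T (tderiv T v) t + op_A \<Omega> (c *\<^sub>R v t))"
    by (rule Bstar_C2_eq[OF T d])
  also have "\<dots> = curve_class T (\<lambda>t. c *\<^sub>R (tderiv T (tderiv T v) t + op_A \<Omega> (v t)))"
    by (rule curve_class_cong) (use V(5) in \<open>simp add: op_A_scaleR[OF \<Omega>] scaleR_add_right\<close>)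
  also have "\<dots> = c *\<^sub>R Bstar_C2 T \<Omega> v"
    unfolding Bstar_C2_def by (intro curve_class_scaleR continuous_on_add V(3,6))
  finally show "Bstar_C2 T \<Omega> (\<lambda>t. c *\<^sub>R v t) = c *\<^sub>R Bstar_C2 T \<Omega> v" .
qed

text \<open>
  Products of a scalar function with a fixed element of \<open>D(A)\<close>: the norm of a difference quotient is the
  scalar difference quotient times the norm of \<open>\<phi>\<close>, whichever of the three norms is meant.
\<close>

lemma C2_T_scalar_curve:
  fixes r r' r'' :: "real \<Rightarrow> real"
  assumes T: "0 < T" and \<Omega>: "open \<Omega>" and \<phi>: "\<phi> \<in> domain_A \<Omega>"
    and d1: "\<And>t. t \<in> {0..T} \<Longrightarrow> (r has_vector_derivative r' t) (at t within {0..T})"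
    and d2: "\<And>t. t \<in> {0..T} \<Longrightarrow> (r' has_vector_derivative r'' t) (at t within {0..T})"
    and cont: "continuous_on {0..T} r''" and "end": "r T = 0" "r' T = 0"
  shows "(\<lambda>t. r t *\<^sub>R \<phi>) \<in> C2_T T \<Omega>"
    and "Bstar_C2 T \<Omega> (\<lambda>t. r t *\<^sub>R \<phi>) = curve_class T (\<lambda>t. r'' t *\<^sub>R \<phi> + r t *\<^sub>R op_A \<Omega> \<phi>)"
proof -
  have sc: "((\<lambda>t. f t *\<^sub>R \<phi>) has_vector_derivative f' *\<^sub>R \<phi>) F"
    if "(f has_vector_derivative f') F" for f :: "real \<Rightarrow> real" and f' F
    by (rule bounded_linear.has_vector_derivative[OF bounded_linear_scaleR_left that])
  note d = sc[OF d1] sc[OF d2]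
  have dd: "\<phi> \<in> Sobolev_H10 \<Omega>" "\<phi> \<in> L2_on \<Omega>"
    using \<phi> by (auto simp: domain_A_def Sobolev_H10_def Sobolev_H1_def)
  note H10 = seminorm_on_Sobolev_H10[OF \<Omega>]
  have cr': "continuous_on {0..T} r'" and cr: "continuous_on {0..T} r"
    using d1 d2 by (meson continuous_on_eq_continuous_within has_vector_derivative_continuous)+
  have "C_k_into (Suc 0) T UNIV norm r'"
    by (rule C_k_into_Suc_real[OF d2]) (use cont C_k_into_0_continuous[of T r''] in blast)+
  from C_k_into_Suc_real[OF d1 this] have k2: "C_k_into 2 T UNIV norm r" by (simp only: numeral_2_eq_2)
  have "C_k_into (Suc 0) T UNIV norm r"
    by (rule C_k_into_Suc_real[OF d1]) (use cr' C_k_into_0_continuous[of T r'] in blast)+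
  then have k1: "C_k_into 1 T UNIV norm r" by (simp only: One_nat_def)
  have k0: "C_k_into 0 T UNIV norm r" using cr C_k_into_0_continuous[of T r] by blast
  have "tderiv T (\<lambda>t. r t *\<^sub>R \<phi>) T = 0"
    using tderiv_two(1)[OF T d, of T] T "end" by simp
  then show "(\<lambda>t. r t *\<^sub>R \<phi>) \<in> C2_T T \<Omega>"
    unfolding C2_T_def mem_Collect_eq
    by (intro conjI C_k_into_scalar_curve[OF seminorm_on_norm[OF subspace_L2_on] dd(2) k2]
        C_k_into_scalar_curve[OF H10 dd(1) k1] C_k_into_scalar_curve[OF seminorm_on_graph_norm[OF \<Omega>] \<phi> k0])
      (simp_all add: "end")
  show "Bstar_C2 T \<Omega> (\<lambda>t. r t *\<^sub>R \<phi>) = curve_class T (\<lambda>t. r'' t *\<^sub>R \<phi> + r t *\<^sub>R op_A \<Omega> \<phi>)"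
    using Bstar_C2_eq[OF T d, of \<Omega>] by (simp add: op_A_scaleR[OF \<Omega> \<phi>])
qed

section \<open>Tensor products\<close>

lemma square_integrable_tensor:
  fixes h :: "real \<Rightarrow> real" and \<phi> :: "'h::real_inner"
  assumes "square_integrable h"
  shows "square_integrable (\<lambda>t. h t *\<^sub>R \<phi>)"
proof -
  obtain s where s: "\<forall>n. simple_function lborel (s n)" "\<forall>t. (\<lambda>n. s n t) \<longlonglongrightarrow> h t"
    using assms by (auto simp: square_integrable_def strongly_measurable_def)
  have "strongly_measurable (\<lambda>t. h t *\<^sub>R \<phi>)"
    unfolding strongly_measurable_def
    using s by (intro exI[of _ "\<lambda>n t. s n t *\<^sub>R \<phi>"])
      (auto intro!: tendsto_intros simple_function_compose1[where g="\<lambda>c. c *\<^sub>R \<phi>"])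
  moreover have "integrable lborel (\<lambda>t. (norm (h t *\<^sub>R \<phi>))\<^sup>2)"
    using assms by (simp add: square_integrable_real_iff power_mult_distrib)
  ultimately show ?thesis by (simp add: square_integrable_def)
qed

lemma tensor_abs_L2:
  assumes "square_integrable h"
  shows "tensor (abs_L2 h) \<phi> = abs_L2 (\<lambda>t. h t *\<^sub>R \<phi>)"
  unfolding tensor_def
proof (rule abs_L2_eqI)
  show "AE t in lborel. rep_L2 (abs_L2 h) t *\<^sub>R \<phi> = h t *\<^sub>R \<phi>"
    using rep_abs_L2_AE[OF assms] by eventually_elim simp
qed (intro square_integrable_tensor square_integrable_rep assms)+

lemma tensor_curve_class:
  fixes r :: "real \<Rightarrow> real"
  assumes "continuous_on {0..T} r"
  shows "tensor (curve_class T r) \<phi> = curve_class T (\<lambda>t. r t *\<^sub>R \<phi>)"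
  unfolding curve_class_def
  by (subst tensor_abs_L2[OF square_integrable_interval_curve[OF assms]]) simp

lemma norm_tensor: "norm (tensor \<theta> \<phi>) = norm \<theta> * norm \<phi>"
proof -
  have "(norm (tensor \<theta> \<phi>))\<^sup>2 = (\<integral>t. (rep_L2 \<theta> t)\<^sup>2 * (norm \<phi>)\<^sup>2 \<partial>lborel)"
    unfolding tensor_def
    by (subst norm_abs_L2[OF square_integrable_tensor[OF square_integrable_rep]]) (simp add: power_mult_distrib)
  also have "\<dots> = (norm \<theta> * norm \<phi>)\<^sup>2"
    by (simp add: power_mult_distrib norm_L2_eq)
  finally show ?thesis by (rule power2_eq_imp_eq) auto
qed

lemma tensor_diff: "tensor (\<theta> - \<theta>') \<phi> = tensor \<theta> \<phi> - tensor \<theta>' \<phi>"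
proof -
  have "tensor \<theta> \<phi> - tensor \<theta>' \<phi> = abs_L2 (\<lambda>t. rep_L2 \<theta> t *\<^sub>R \<phi> - rep_L2 \<theta>' t *\<^sub>R \<phi>)"
    unfolding tensor_def by (intro abs_L2_diff square_integrable_tensor square_integrable_rep)
  also have "\<dots> = tensor (\<theta> - \<theta>') \<phi>"
    unfolding tensor_def
  proof (rule abs_L2_eqI)
    show "AE t in lborel. rep_L2 \<theta> t *\<^sub>R \<phi> - rep_L2 \<theta>' t *\<^sub>R \<phi> = rep_L2 (\<theta> - \<theta>') t *\<^sub>R \<phi>"
      using rep_L2_diff_AE[of \<theta> \<theta>'] by eventually_elim (simp add: scaleR_diff_left)
  qed (intro square_integrable_diff square_integrable_tensor square_integrable_rep)+
  finally show ?thesis by simp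
qed

lemma tensor_tendsto:
  assumes "\<theta> \<longlonglongrightarrow> l"
  shows "(\<lambda>n. tensor (\<theta> n) \<phi>) \<longlonglongrightarrow> tensor l \<phi>"
proof -
  have "(\<lambda>n. norm (\<theta> n - l) * norm \<phi>) \<longlonglongrightarrow> norm (l - l) * norm \<phi>" by (intro tendsto_intros assms)
  then have "(\<lambda>n. norm (tensor (\<theta> n) \<phi> - tensor l \<phi>)) \<longlonglongrightarrow> 0"
    by (simp add: tensor_diff[symmetric] norm_tensor)
  then have "(\<lambda>n. tensor (\<theta> n) \<phi> - tensor l \<phi>) \<longlonglongrightarrow> 0"
    by (rule tendsto_norm_zero_cancel)
  then show ?thesis by (rule LIM_zero_cancel)
qed

lemma rep_tensor_AE: "AE t in lborel. rep_L2 (tensor \<theta> \<phi>) t = rep_L2 \<theta> t *\<^sub>R \<phi>"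
  unfolding tensor_def by (rule rep_abs_L2_AE[OF square_integrable_tensor[OF square_integrable_rep]])

section \<open>Duality with test functions in space and time\<close>

lemma curve_class_Bochner_L2:
  assumes f: "continuous_on {0..T} f" and mem: "\<And>t. t \<in> {0..T} \<Longrightarrow> f t \<in> L2_on \<Omega>"
  shows "curve_class T f \<in> Bochner_L2 T \<Omega>"
  unfolding Bochner_L2_def mem_Collect_eq
proof
  show "curve_class T f \<in> L2_on {0<..<T}" by (rule curve_class_L2_on[OF f])
  show "AE t in lborel. rep_L2 (curve_class T f) t \<in> L2_on \<Omega>"
    using rep_curve_class_AE[OF f]
  proof eventually_elim
    case (elim t)
    show ?case unfolding elim
      using mem[of t] subspace_0[OF subspace_L2_on] by (cases "t \<in> {0<..<T}") auto
  qed
qed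

lemma C2_T_Bochner_L2:
  assumes T: "0 < T" and \<Omega>: "open \<Omega>" and v: "v \<in> C2_T T \<Omega>"
  shows "curve_class T v \<in> Bochner_L2 T \<Omega>" "Bstar_C2 T \<Omega> v \<in> Bochner_L2 T \<Omega>"
proof -
  note V = C2_T_D[OF T \<Omega> v]
  have "continuous_on {0..T} v"
    by (rule continuous_on_vector_derivative[OF V(1)])
  then show "curve_class T v \<in> Bochner_L2 T \<Omega>"
    by (rule curve_class_Bochner_L2) (use V(5) in \<open>auto simp: domain_A_def Sobolev_H10_def Sobolev_H1_def\<close>)
  show "Bstar_C2 T \<Omega> v \<in> Bochner_L2 T \<Omega>"
    unfolding Bstar_C2_def
    by (intro curve_class_Bochner_L2 continuous_on_add V(3,6) subspace_add[OF subspace_L2_on] V(4) op_A_L2_on[OF \<Omega>] V(5))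
qed

lemma inner_curve_class_tensor:
  assumes "continuous_on {0..T} f" "square_integrable \<eta>"
  shows "curve_class T f \<bullet> tensor (abs_L2 \<eta>) \<xi> = (\<integral>t. indicator {0<..<T} t * (\<eta> t * (f t \<bullet> \<xi>)) \<partial>lborel)"
  unfolding curve_class_def tensor_abs_L2[OF assms(2)]
  by (subst inner_abs_L2[OF square_integrable_interval_curve[OF assms(1)] square_integrable_tensor[OF assms(2)]])
     (simp add: mult.left_commute)

text \<open>
  Integration by parts in time and space moves \<open>B\<^sup>*\<close> to the test function \<open>\<eta> \<otimes> \<psi>\<close>. On the right-hand
  side the curve \<open>v\<close> enters only through its class in \<open>L\<^sub>2(I;H)\<close>; this is what makes
  \<open>B\<^sup>*\<close> closable.
\<close>

lemma Bstar_C2_inner_test: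
  assumes T: "0 < T" and \<Omega>: "open \<Omega>" and v: "v \<in> C2_T T \<Omega>"
    and \<eta>: "\<eta> \<in> test_functions {0<..<T}" and \<psi>: "\<psi> \<in> test_functions \<Omega>"
  defines "\<eta>' \<equiv> \<lambda>t. frechet_derivative \<eta> (at t) 1"
  defines "\<eta>'' \<equiv> \<lambda>t. frechet_derivative \<eta>' (at t) 1"
  shows "Bstar_C2 T \<Omega> v \<bullet> tensor (abs_L2 \<eta>) (abs_L2 \<psi>)
    = curve_class T v \<bullet> (tensor (abs_L2 \<eta>'') (abs_L2 \<psi>) - tensor (abs_L2 \<eta>) (abs_L2 (laplacian \<psi>)))"
proof -
  note V = C2_T_D[OF T \<Omega> v]
  let ?\<psi> = "abs_L2 \<psi>" and ?L = "abs_L2 (laplacian \<psi>)" and ?v' = "tderiv T v" and ?v'' = "tderiv T (tderiv T v)"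
  let ?I = "indicat_real {0<..<T}"
  have \<eta>': "\<eta>' \<in> test_functions {0<..<T}" unfolding \<eta>'_def by (rule test_function_partial[OF \<eta>]) simp
  have \<eta>'': "\<eta>'' \<in> test_functions {0<..<T}" unfolding \<eta>''_def by (rule test_function_partial[OF \<eta>']) simp
  have d\<eta>: "(\<eta> has_real_derivative \<eta>' t) (at t)" and d\<eta>': "(\<eta>' has_real_derivative \<eta>'' t) (at t)" for t
    using test_function_DERIV[OF \<eta>] test_function_DERIV[OF \<eta>'] by (simp_all only: \<eta>'_def \<eta>''_def)
  have cv: "continuous_on {0..T} v"
    by (rule continuous_on_vector_derivative[OF V(1)])
  have zero: "f 0 = 0 \<and> f T = 0" if f: "f \<in> test_functions {0<..<T}" for f :: "real \<Rightarrow> real"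
  proof -
    obtain K where "K \<subseteq> {0<..<T}" "\<And>x. x \<notin> K \<Longrightarrow> f x = 0" using test_functionE[OF f] by metis
    then show ?thesis by force
  qed
  have inn: "((\<lambda>s. f s \<bullet> ?\<psi>) has_real_derivative f' \<bullet> ?\<psi>) F"
    if "(f has_vector_derivative f') F" for f :: "real \<Rightarrow> ('a, real) L2" and f' F
    unfolding has_real_derivative_iff_has_vector_derivative
    by (rule bounded_linear.has_vector_derivative[OF bounded_linear_inner_left that])
  have ibp: "(\<integral>t. ?I t * (\<eta> t * (?v'' t \<bullet> ?\<psi>) - \<eta>'' t * (v t \<bullet> ?\<psi>)) \<partial>lborel) = 0"
  proof -
    have "(\<integral>t. ?I t * (\<eta> t * (?v'' t \<bullet> ?\<psi>) - \<eta>'' t * (v t \<bullet> ?\<psi>)) \<partial>lborel)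
      = (\<eta> T * (?v' T \<bullet> ?\<psi>) - \<eta>' T * (v T \<bullet> ?\<psi>)) - (\<eta> 0 * (?v' 0 \<bullet> ?\<psi>) - \<eta>' 0 * (v 0 \<bullet> ?\<psi>))"
    proof (rule integral_FTC_Ioo)
      fix t assume t: "t \<in> {0..T}"
      have "((\<lambda>s. \<eta> s * (?v' s \<bullet> ?\<psi>) - \<eta>' s * (v s \<bullet> ?\<psi>)) has_real_derivative
          (\<eta>' t * (?v' t \<bullet> ?\<psi>) + (?v'' t \<bullet> ?\<psi>) * \<eta> t) - (\<eta>'' t * (v t \<bullet> ?\<psi>) + (?v' t \<bullet> ?\<psi>) * \<eta>' t)) (at t within {0..T})"
        by (intro DERIV_diff DERIV_mult' DERIV_mult inn[OF V(1)[OF t]] inn[OF V(2)[OF t]]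
            has_field_derivative_at_within[OF d\<eta>'] has_field_derivative_at_within[OF d\<eta>])
      then show "((\<lambda>s. \<eta> s * (?v' s \<bullet> ?\<psi>) - \<eta>' s * (v s \<bullet> ?\<psi>)) has_vector_derivative
          \<eta> t * (?v'' t \<bullet> ?\<psi>) - \<eta>'' t * (v t \<bullet> ?\<psi>)) (at t within {0..T})"
        unfolding has_real_derivative_iff_has_vector_derivative by (simp add: mult.commute)
    next
      show "continuous_on {0..T} (\<lambda>t. \<eta> t * (?v'' t \<bullet> ?\<psi>) - \<eta>'' t * (v t \<bullet> ?\<psi>))"
        by (intro continuous_intros V(3) cv test_function_continuous[OF \<eta>] test_function_continuous[OF \<eta>''])
    qed (use T in simp)
    then show ?thesis using zero[OF \<eta>] zero[OF \<eta>'] by simp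
  qed
  have sq: "square_integrable \<eta>" "square_integrable \<eta>''"
    using \<eta> \<eta>'' by (auto intro: test_function_square_integrable)
  have int: "integrable lborel (\<lambda>t. ?I t * (h t * (f t \<bullet> \<xi>)))"
    if "continuous_on {0..T} f" "square_integrable h" for f :: "real \<Rightarrow> ('a, real) L2" and h \<xi>
    using square_integrable_inner[OF square_integrable_interval_curve[OF that(1)] square_integrable_tensor[OF that(2)], of \<xi>]
    by (simp add: mult.left_commute)
  have A: "?I t * (\<eta> t * (op_A \<Omega> (v t) \<bullet> ?\<psi>)) = - (?I t * (\<eta> t * (v t \<bullet> ?L)))" for t
    using op_A_inner_test_function[OF \<Omega> V(5)[of t] \<psi>] by (cases "t \<in> {0<..<T}") auto
  have "Bstar_C2 T \<Omega> v \<bullet> tensor (abs_L2 \<eta>) ?\<psi>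
      = (\<integral>t. ?I t * (\<eta> t * ((?v'' t + op_A \<Omega> (v t)) \<bullet> ?\<psi>)) \<partial>lborel)"
    unfolding Bstar_C2_def by (intro inner_curve_class_tensor continuous_on_add V(3,6) sq)
  also have "\<dots> = (\<integral>t. ?I t * (\<eta> t * (?v'' t \<bullet> ?\<psi>)) - ?I t * (\<eta> t * (v t \<bullet> ?L)) \<partial>lborel)"
    by (intro Bochner_Integration.integral_cong refl) (simp add: inner_add_left distrib_left A)
  also have "\<dots> = (\<integral>t. ?I t * (\<eta> t * (?v'' t \<bullet> ?\<psi>)) \<partial>lborel) - (\<integral>t. ?I t * (\<eta> t * (v t \<bullet> ?L)) \<partial>lborel)"
    by (intro Bochner_Integration.integral_diff int V(3) cv sq)
  also have "(\<integral>t. ?I t * (\<eta> t * (?v'' t \<bullet> ?\<psi>)) \<partial>lborel) = (\<integral>t. ?I t * (\<eta>'' t * (v t \<bullet> ?\<psi>)) \<partial>lborel)"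
  proof -
    have "(\<integral>t. ?I t * (\<eta> t * (?v'' t \<bullet> ?\<psi>)) - ?I t * (\<eta>'' t * (v t \<bullet> ?\<psi>)) \<partial>lborel)
        = (\<integral>t. ?I t * (\<eta> t * (?v'' t \<bullet> ?\<psi>)) \<partial>lborel) - (\<integral>t. ?I t * (\<eta>'' t * (v t \<bullet> ?\<psi>)) \<partial>lborel)"
      by (intro Bochner_Integration.integral_diff int V(3) cv sq)
    then show ?thesis using ibp by (simp only: right_diff_distrib)
  qed
  finally show ?thesis
    by (simp only: inner_diff_right inner_curve_class_tensor[OF cv sq(1)] inner_curve_class_tensor[OF cv sq(2)])
qed

text \<open>
  For fixed \<open>\<psi>\<close> the scalar function \<open>t \<mapsto> (g(t), \<psi>)\<close> is orthogonal to all test functions in time and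
  vanishes almost everywhere. Letting \<open>\<psi>\<close> range over a countable total family gives
  \<open>g(t) = 0\<close> for almost every \<open>t\<close>.
\<close>

lemma tensor_test_functions_total:
  assumes \<Omega>: "open \<Omega>" and g: "g \<in> Bochner_L2 T \<Omega>"
    and perp: "\<And>\<eta> \<psi>. \<eta> \<in> test_functions {0<..<T} \<Longrightarrow> \<psi> \<in> test_functions \<Omega> \<Longrightarrow>
      g \<bullet> tensor (abs_L2 \<eta>) (abs_L2 \<psi>) = 0"
  shows "g = 0"
proof -
  have ae: "AE t in lborel. rep_L2 g t \<bullet> abs_L2 \<psi> = 0" if \<psi>: "\<psi> \<in> test_functions \<Omega>" for \<psi>
  proof -
    let ?\<theta> = "\<lambda>t. rep_L2 g t \<bullet> abs_L2 \<psi>"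
    have sm: "?\<theta> \<in> borel_measurable borel"
      using borel_measurable_inner_strongly[OF _ strongly_measurable_const, of "rep_L2 g" "abs_L2 \<psi>"]
        square_integrable_rep[of g] by (simp add: square_integrable_def)
    have "integrable lborel (\<lambda>t. (?\<theta> t)\<^sup>2)"
    proof (rule Bochner_Integration.integrable_bound)
      show "integrable lborel (\<lambda>t. (norm (rep_L2 g t))\<^sup>2 * (norm (abs_L2 \<psi>))\<^sup>2)"
        using square_integrable_rep[of g] by (simp add: square_integrable_def)
      show "(\<lambda>t. (?\<theta> t)\<^sup>2) \<in> borel_measurable lborel" using sm by simp
      have "(?\<theta> t)\<^sup>2 \<le> (norm (rep_L2 g t))\<^sup>2 * (norm (abs_L2 \<psi>))\<^sup>2" for t
        using Cauchy_Schwarz_ineq[of "rep_L2 g t" "abs_L2 \<psi>"] by (simp add: power2_norm_eq_inner)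
      then show "AE t in lborel. norm ((?\<theta> t)\<^sup>2) \<le> norm ((norm (rep_L2 g t))\<^sup>2 * (norm (abs_L2 \<psi>))\<^sup>2)"
        by (intro AE_I2) simp
    qed
    then have sq: "square_integrable ?\<theta>" using sm by (simp add: square_integrable_real_iff)
    have "abs_L2 ?\<theta> = 0"
    proof (rule test_functions_total)
      have "AE t in lborel. t \<notin> {0<..<T} \<longrightarrow> rep_L2 g t = 0"
        using g unfolding Bochner_L2_def L2_on_def by blast
      with rep_abs_L2_AE[OF sq] have "AE t in lborel. t \<notin> {0<..<T} \<longrightarrow> rep_L2 (abs_L2 ?\<theta>) t = 0"
        by eventually_elim auto
      then show "abs_L2 ?\<theta> \<in> L2_on {0<..<T}" by (simp add: L2_on_def)
      fix \<eta> assume \<eta>: "\<eta> \<in> test_functions {0<..<T}"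
      have sq\<eta>: "square_integrable \<eta>" by (rule test_function_square_integrable[OF \<eta>])
      have "abs_L2 ?\<theta> \<bullet> abs_L2 \<eta> = (\<integral>t. ?\<theta> t \<bullet> \<eta> t \<partial>lborel)" by (rule inner_abs_L2[OF sq sq\<eta>])
      also have "\<dots> = g \<bullet> tensor (abs_L2 \<eta>) (abs_L2 \<psi>)"
        unfolding tensor_abs_L2[OF sq\<eta>] inner_L2_abs[OF square_integrable_tensor[OF sq\<eta>]]
        by (simp add: mult.commute)
      finally show "abs_L2 ?\<theta> \<bullet> abs_L2 \<eta> = 0" using perp[OF \<eta> \<psi>] by simp
    qed simp
    then have "AE t in lborel. rep_L2 0 t = ?\<theta> t" using rep_abs_L2_AE[OF sq] by simp
    with rep_L2_zero_AE[where 'a=real and 'b=real] show ?thesis by eventually_elim simp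
  qed
  have "AE t in lborel. \<forall>\<psi>\<in>cutoff_family \<Omega>. rep_L2 g t \<bullet> abs_L2 \<psi> = 0"
    using ae cutoff_family_test_functions by (subst AE_ball_countable[OF countable_cutoff_family]) blast
  moreover have "AE t in lborel. rep_L2 g t \<in> L2_on \<Omega>" using g unfolding Bochner_L2_def by blast
  ultimately have "AE t in lborel. rep_L2 g t = rep_L2 0 t"
    using rep_L2_zero_AE[where 'a=real and 'b="('a, real) L2"]
  proof eventually_elim
    case (elim t)
    then show ?case using cutoff_family_total[OF \<Omega>, of "rep_L2 g t"] by simp
  qed
  then show ?thesis by (rule L2_eqI)
qed

section \<open>The closure of the operator\<close>

text \<open>
  The graph of the extended operator: the closure of the graph of \<open>B\<^sup>*\<close> on the smooth curves.
\<close>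

definition Bstar_limit ::
    "real \<Rightarrow> 'a::euclidean_space set \<Rightarrow> (real, ('a, real) L2) L2 \<Rightarrow> (real, ('a, real) L2) L2 \<Rightarrow> bool" where
  "Bstar_limit T \<Omega> w g \<longleftrightarrow> (\<exists>v. (\<forall>n. v n \<in> C2_T T \<Omega>) \<and>
     (\<lambda>n. curve_class T (v n)) \<longlonglongrightarrow> w \<and> (\<lambda>n. Bstar_C2 T \<Omega> (v n)) \<longlonglongrightarrow> g)"

lemma Bstar_limit_Bochner:
  assumes T: "0 < T" and \<Omega>: "open \<Omega>" and lim: "Bstar_limit T \<Omega> w g"
  shows "w \<in> Bochner_L2 T \<Omega>" "g \<in> Bochner_L2 T \<Omega>"
proof -
  obtain v where v: "\<And>n. v n \<in> C2_T T \<Omega>" "(\<lambda>n. curve_class T (v n)) \<longlonglongrightarrow> w"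
    "(\<lambda>n. Bstar_C2 T \<Omega> (v n)) \<longlonglongrightarrow> g" using lim unfolding Bstar_limit_def by blast
  show "w \<in> Bochner_L2 T \<Omega>"
    by (rule Bochner_L2_LIMSEQ[OF C2_T_Bochner_L2(1)[OF T \<Omega> v(1)] v(2)])
  show "g \<in> Bochner_L2 T \<Omega>"
    by (rule Bochner_L2_LIMSEQ[OF C2_T_Bochner_L2(2)[OF T \<Omega> v(1)] v(3)])
qed

lemma Bstar_limit_V_space:
  assumes T: "0 < T" and \<Omega>: "open \<Omega>" and lim: "Bstar_limit T \<Omega> w g"
  shows "w \<in> V_space T \<Omega>"
proof -
  obtain v where v: "\<forall>n. v n \<in> C2_T T \<Omega>" "(\<lambda>n. curve_class T (v n)) \<longlonglongrightarrow> w"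
    "(\<lambda>n. Bstar_C2 T \<Omega> (v n)) \<longlonglongrightarrow> g" using lim unfolding Bstar_limit_def by blast
  with Bstar_limit_Bochner(1)[OF assms] LIMSEQ_imp_Cauchy[OF v(3)]
  show ?thesis unfolding V_space_def by blast
qed

text \<open>
  Closability. Tested against \<open>\<eta> \<otimes> \<psi>\<close>, the limit \<open>g\<close> depends on \<open>w\<close> alone, and these tests separate
  the points of the closed subspace \<open>L\<^sub>2(I;L\<^sub>2(\<Omega>))\<close>.
\<close>

lemma Bstar_limit_unique:
  assumes T: "0 < T" and \<Omega>: "open \<Omega>" and "Bstar_limit T \<Omega> w g" "Bstar_limit T \<Omega> w g'"
  shows "g = g'"
proof -
  have "g - g' = 0"
  proof (rule tensor_test_functions_total[OF \<Omega>])
    show "g - g' \<in> Bochner_L2 T \<Omega>"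
      using Bstar_limit_Bochner(2)[OF T \<Omega>] assms(3,4) by (intro subspace_diff[OF subspace_Bochner_L2])
    fix \<eta> \<psi> assume \<eta>: "\<eta> \<in> test_functions {0<..<T}" and \<psi>: "\<psi> \<in> test_functions \<Omega>"
    let ?u = "tensor (abs_L2 \<eta>) (abs_L2 \<psi>)"
    obtain B where B: "\<And>v. v \<in> C2_T T \<Omega> \<Longrightarrow> Bstar_C2 T \<Omega> v \<bullet> ?u = curve_class T v \<bullet> B"
      using Bstar_C2_inner_test[OF T \<Omega> _ \<eta> \<psi>] by blast
    have "h \<bullet> ?u = w \<bullet> B" if h: "Bstar_limit T \<Omega> w h" for h
    proof -
      obtain v where v: "\<And>n. v n \<in> C2_T T \<Omega>" "(\<lambda>n. curve_class T (v n)) \<longlonglongrightarrow> w"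
        "(\<lambda>n. Bstar_C2 T \<Omega> (v n)) \<longlonglongrightarrow> h" using h unfolding Bstar_limit_def by blast
      have "(\<lambda>n. Bstar_C2 T \<Omega> (v n) \<bullet> ?u) \<longlonglongrightarrow> h \<bullet> ?u" by (intro tendsto_intros v)
      moreover have "(\<lambda>n. curve_class T (v n) \<bullet> B) \<longlonglongrightarrow> w \<bullet> B" by (intro tendsto_intros v)
      ultimately show ?thesis using LIMSEQ_unique unfolding B[OF v(1)] by blast
    qed
    then show "(g - g') \<bullet> ?u = 0" using assms(3,4) by (simp add: inner_diff_left)
  qed
  then show ?thesis by simp
qed

lemma Bstar_eqI:
  assumes "0 < T" "open \<Omega>" "Bstar_limit T \<Omega> w g"
  shows "Bstar T \<Omega> w = g"
  unfolding Bstar_def Bstar_limit_def[symmetric]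
  by (rule the_equality, rule assms(3), rule Bstar_limit_unique[OF assms(1,2) _ assms(3)])

lemma Bstar_limit_add:
  assumes T: "0 < T" and \<Omega>: "open \<Omega>" and "Bstar_limit T \<Omega> w g" "Bstar_limit T \<Omega> w' g'"
  shows "Bstar_limit T \<Omega> (w + w') (g + g')"
proof -
  obtain v where v: "\<And>n. v n \<in> C2_T T \<Omega>" "(\<lambda>n. curve_class T (v n)) \<longlonglongrightarrow> w"
    "(\<lambda>n. Bstar_C2 T \<Omega> (v n)) \<longlonglongrightarrow> g" using assms(3) unfolding Bstar_limit_def by blast
  obtain v' where v': "\<And>n. v' n \<in> C2_T T \<Omega>" "(\<lambda>n. curve_class T (v' n)) \<longlonglongrightarrow> w'"
    "(\<lambda>n. Bstar_C2 T \<Omega> (v' n)) \<longlonglongrightarrow> g'" using assms(4) unfolding Bstar_limit_def by blast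
  have cont: "continuous_on {0..T} u" if "u \<in> C2_T T \<Omega>" for u
    by (rule continuous_on_vector_derivative[OF C2_T_D(1)[OF T \<Omega> that]])
  have "(\<lambda>n. curve_class T (\<lambda>t. v n t + v' n t)) \<longlonglongrightarrow> w + w'"
    unfolding curve_class_add[OF cont[OF v(1)] cont[OF v'(1)]] by (intro tendsto_add v v')
  moreover have "(\<lambda>n. Bstar_C2 T \<Omega> (\<lambda>t. v n t + v' n t)) \<longlonglongrightarrow> g + g'"
    unfolding C2_T_add(2)[OF T \<Omega> v(1) v'(1)] by (intro tendsto_add v v')
  ultimately show ?thesis
    unfolding Bstar_limit_def using C2_T_add(1)[OF T \<Omega> v(1) v'(1)]
    by (intro exI[of _ "\<lambda>n t. v n t + v' n t"]) auto
qed

lemma Bstar_limit_scaleR: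
  assumes T: "0 < T" and \<Omega>: "open \<Omega>" and "Bstar_limit T \<Omega> w g"
  shows "Bstar_limit T \<Omega> (c *\<^sub>R w) (c *\<^sub>R g)"
proof -
  obtain v where v: "\<And>n. v n \<in> C2_T T \<Omega>" "(\<lambda>n. curve_class T (v n)) \<longlonglongrightarrow> w"
    "(\<lambda>n. Bstar_C2 T \<Omega> (v n)) \<longlonglongrightarrow> g" using assms(3) unfolding Bstar_limit_def by blast
  have cont: "continuous_on {0..T} u" if "u \<in> C2_T T \<Omega>" for u
    by (rule continuous_on_vector_derivative[OF C2_T_D(1)[OF T \<Omega> that]])
  have "(\<lambda>n. curve_class T (\<lambda>t. c *\<^sub>R v n t)) \<longlonglongrightarrow> c *\<^sub>R w"
    unfolding curve_class_scaleR[OF cont[OF v(1)]] by (intro tendsto_scaleR tendsto_const v)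
  moreover have "(\<lambda>n. Bstar_C2 T \<Omega> (\<lambda>t. c *\<^sub>R v n t)) \<longlonglongrightarrow> c *\<^sub>R g"
    unfolding C2_T_scaleR(2)[OF T \<Omega> v(1)] by (intro tendsto_scaleR tendsto_const v)
  ultimately show ?thesis
    unfolding Bstar_limit_def using C2_T_scaleR(1)[OF T \<Omega> v(1)]
    by (intro exI[of _ "\<lambda>n t. c *\<^sub>R v n t"]) auto
qed

text \<open>
  The approximating curves are \<open>r\<^sub>n \<phi>\<close> with \<open>r\<^sub>n\<close> the twofold primitive of a continuous \<open>g\<^sub>n\<close>, where
  \<open>g\<^sub>n \<longrightarrow> \<rho>''\<close>.
\<close>

lemma Bstar_limit_tensor:
  assumes T: "0 < T" and \<Omega>: "open \<Omega>" and \<phi>: "\<phi> \<in> domain_A \<Omega>"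
    and q: "q \<in> L2_on {0<..<T}" and p: "p = end_primitive_class T q" and \<rho>: "\<rho> = end_primitive_class T p"
  shows "Bstar_limit T \<Omega> (tensor \<rho> \<phi>) (tensor q \<phi> + tensor \<rho> (op_A \<Omega> \<phi>))"
proof -
  obtain g where gU: "\<And>n. continuous_on UNIV (g n)" and g_lim: "(\<lambda>n. curve_class T (g n)) \<longlonglongrightarrow> q"
    using continuous_seq_L2_interval[OF q T] by blast
  have g: "continuous_on {0..T} (g n)" for n by (rule continuous_on_subset[OF gU]) simp
  \<comment> \<open>Approximants of \<open>\<rho>'\<close> and \<open>\<rho>\<close>, in this order.\<close>
  define s where "s n = end_primitive T (curve_class T (g n))" for n
  define r where "r n = end_primitive T (curve_class T (s n))" for n
  have cs: "continuous_on {0..T} (s n)" and cr: "continuous_on {0..T} (r n)" for n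
    unfolding s_def r_def by (rule end_primitive_continuous)+
  have ds: "(s n has_vector_derivative g n t) (at t within {0..T})" if "t \<in> {0..T}" for n t
    unfolding s_def by (rule end_primitive_curve_class[OF T g that])
  have dr: "(r n has_vector_derivative s n t) (at t within {0..T})" if "t \<in> {0..T}" for n t
    unfolding r_def by (rule end_primitive_curve_class[OF T cs that])
  have ends: "r n T = 0" "s n T = 0" for n by (simp_all add: r_def s_def end_primitive_end)
  have C2: "(\<lambda>t. r n t *\<^sub>R \<phi>) \<in> C2_T T \<Omega>"
    "Bstar_C2 T \<Omega> (\<lambda>t. r n t *\<^sub>R \<phi>) = curve_class T (\<lambda>t. g n t *\<^sub>R \<phi> + r n t *\<^sub>R op_A \<Omega> \<phi>)" for n
    by (rule C2_T_scalar_curve[where r="r n" and r'="s n" and r''="g n", OF T \<Omega> \<phi>],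
        erule dr, erule ds, rule g, rule ends, rule ends)+
  have "(\<lambda>n. curve_class T (s n)) \<longlonglongrightarrow> p"
    using end_primitive_class_tendsto[OF T g_lim] by (simp add: p end_primitive_class_def s_def)
  from end_primitive_class_tendsto[OF T this] have r_lim: "(\<lambda>n. curve_class T (r n)) \<longlonglongrightarrow> \<rho>"
    by (simp add: \<rho> end_primitive_class_def r_def)
  have "(\<lambda>n. curve_class T (\<lambda>t. r n t *\<^sub>R \<phi>)) \<longlonglongrightarrow> tensor \<rho> \<phi>"
    using tensor_tendsto[OF r_lim, of \<phi>] by (simp only: tensor_curve_class[OF cr])
  moreover have "(\<lambda>n. Bstar_C2 T \<Omega> (\<lambda>t. r n t *\<^sub>R \<phi>)) \<longlonglongrightarrow> tensor q \<phi> + tensor \<rho> (op_A \<Omega> \<phi>)"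
  proof -
    have "Bstar_C2 T \<Omega> (\<lambda>t. r n t *\<^sub>R \<phi>) = tensor (curve_class T (g n)) \<phi> + tensor (curve_class T (r n)) (op_A \<Omega> \<phi>)" for n
      unfolding C2(2) tensor_curve_class[OF g] tensor_curve_class[OF cr]
      by (intro curve_class_add continuous_on_scaleR continuous_on_const g cr)
    then show ?thesis by (simp only:) (intro tendsto_add tensor_tendsto g_lim r_lim)
  qed
  ultimately show ?thesis
    unfolding Bstar_limit_def using C2(1) by (intro exI[of _ "\<lambda>n t. r n t *\<^sub>R \<phi>"]) auto
qed

text \<open>
  Taking the inner product of \<open>\<rho>''(t) \<phi> + \<rho>(t) a = 0\<close> with \<open>\<phi>\<close> leaves a linear ordinary differential equation
  for \<open>\<rho>\<close> with zero end data.
\<close>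

lemma Bstar_tensor_nonzero:
  fixes \<phi> a :: "('x::euclidean_space, real) L2"
  assumes T: "0 < T" and p: "p = end_primitive_class T q" and \<rho>: "\<rho> = end_primitive_class T p"
    and nz: "\<rho> \<noteq> 0" "\<phi> \<noteq> 0"
  shows "tensor q \<phi> + tensor \<rho> a \<noteq> 0"
proof
  assume eq: "tensor q \<phi> + tensor \<rho> a = 0"
  \<comment> \<open>The coefficient of the equation \<open>\<rho>'' = \<mu> \<rho>\<close> obtained by pairing with \<open>\<phi>\<close>.\<close>
  define \<mu> where "\<mu> = - ((a \<bullet> \<phi>) / (\<phi> \<bullet> \<phi>))"
  have "AE t in lborel. rep_L2 q t = rep_L2 (\<mu> *\<^sub>R \<rho>) t"
    using rep_L2_add_AE[of "tensor q \<phi>" "tensor \<rho> a"] rep_tensor_AE[of q \<phi>] rep_tensor_AE[of \<rho> a]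
      rep_L2_zero_AE[where 'a=real and 'b="('x, real) L2"] rep_L2_scaleR_AE[of \<mu> \<rho>]
    unfolding eq
  proof eventually_elim
    case (elim t)
    then have "rep_L2 q t *\<^sub>R \<phi> + rep_L2 \<rho> t *\<^sub>R a = 0" by simp
    then have "(rep_L2 q t *\<^sub>R \<phi> + rep_L2 \<rho> t *\<^sub>R a) \<bullet> \<phi> = 0" by simp
    then have "rep_L2 q t * (\<phi> \<bullet> \<phi>) + rep_L2 \<rho> t * (a \<bullet> \<phi>) = 0" by (simp add: inner_add_left)
    then have "rep_L2 q t = \<mu> * rep_L2 \<rho> t" using nz(2) by (simp add: \<mu>_def field_simps)
    with elim show ?case by simp
  qed
  then have "q = \<mu> *\<^sub>R \<rho>" by (rule L2_eqI)
  from H2_end_eigenfunction_zero[OF T p \<rho> this] nz(1) show False by simp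
qed

section \<open>The inf-sup constant\<close>

text \<open>
  The heart of the matter. If \<open>u = B v\<close>, then the quotient at \<open>v\<close> is \<open>\<parallel>u\<parallel>\<^sup>2/\<parallel>u\<parallel>\<^sup>2 = 1\<close>, and
  Cauchy-Schwarz bounds all others by 1. Some \<open>B v\<close> must be nonzero, since otherwise the infimum
  ranges over the empty set.
\<close>

lemma inf_sup_constant_image:
  fixes B :: "'v::real_vector \<Rightarrow> 'u::real_inner"
  assumes "B 0 = 0" and nonempty: "\<exists>v\<in>V. B v \<noteq> 0"
  shows "inf_sup_constant (\<lambda>u v. u \<bullet> B v) norm (\<lambda>v. norm (B v)) (B ` V) V = 1"
proof -
  have "(SUP v\<in>V - {0}. u \<bullet> B v / (norm u * norm (B v))) = 1" if u: "u \<in> B ` V - {0}" for u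
  proof (rule cSup_eq_maximum)
    obtain v where v: "v \<in> V" "u = B v" using u by auto
    then have "v \<in> V - {0}" using u assms(1) by auto
    moreover have "1 = u \<bullet> B v / (norm u * norm (B v))"
      using u v(2) by (simp add: power2_norm_eq_inner[symmetric] power2_eq_square)
    ultimately show "1 \<in> (\<lambda>v. u \<bullet> B v / (norm u * norm (B v))) ` (V - {0})" by (rule rev_image_eqI)
  next
    fix x assume "x \<in> (\<lambda>v. u \<bullet> B v / (norm u * norm (B v))) ` (V - {0})"
    then obtain v where x: "x = u \<bullet> B v / (norm u * norm (B v))" by blast
    show "x \<le> 1"
      unfolding x using norm_cauchy_schwarz[of u "B v"] by (intro divide_le_eq_1[THEN iffD2]) auto
  qed
  moreover have "B ` V - {0} \<noteq> {}" using nonempty by auto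
  ultimately show ?thesis unfolding inf_sup_constant_def by simp
qed

theorem proposition3p3:
  fixes T :: real and \<Omega> :: "'a::euclidean_space set"
    and Nt Nh :: nat
    and \<rho> :: "nat \<Rightarrow> (real, real) L2" and \<phi> :: "nat \<Rightarrow> ('a, real) L2"
    and V\<delta> U\<delta> :: "(real, ('a, real) L2) L2 set"
  assumes "T > 0"
    and "open \<Omega>" and "bounded \<Omega>" and "convex \<Omega>" and "\<Omega> \<noteq> {}"
    and "Nt \<ge> 1" and "Nh \<ge> 1"
    and "\<And>k. k \<in> {1..Nt} \<Longrightarrow> \<rho> k \<in> H2_end T"
    and "inj_on \<rho> {1..Nt}" and "independent (\<rho> ` {1..Nt})"
    and "\<And>i. i \<in> {1..Nh} \<Longrightarrow> \<phi> i \<in> Sobolev_H10 \<Omega> \<inter> Sobolev_H2 \<Omega>"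
    and "inj_on \<phi> {1..Nh}" and "independent (\<phi> ` {1..Nh})"
    and "V\<delta> = tensor_space Nt \<rho> Nh \<phi>"
    and "U\<delta> = Bstar T \<Omega> ` V\<delta>"
  shows "V\<delta> \<subseteq> V_space T \<Omega> \<and> U\<delta> \<subseteq> U_space T \<Omega> \<and>
    inf_sup_constant (form_b T \<Omega>) norm (V_norm T \<Omega>) U\<delta> V\<delta> = 1"
proof -
  note T = assms(1) and \<Omega> = assms(2)
  let ?S = "{tensor (\<rho> k) (\<phi> i) | k i. k \<in> {1..Nt} \<and> i \<in> {1..Nh}}"
  have V: "V\<delta> = span ?S" using assms(14) by (simp add: tensor_space_def)
  have dom: "\<phi> i \<in> domain_A \<Omega>" if "i \<in> {1..Nh}" for i
    using assms(11)[OF that] by (auto simp: domain_A_def)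
  have gen: "\<exists>g. Bstar_limit T \<Omega> w g" if w: "w \<in> ?S" for w
  proof -
    obtain k i where ki: "w = tensor (\<rho> k) (\<phi> i)" "k \<in> {1..Nt}" "i \<in> {1..Nh}" using w by blast
    obtain p q where "q \<in> L2_on {0<..<T}" "p = end_primitive_class T q" "\<rho> k = end_primitive_class T p"
      using H2_end_primitive[OF T assms(8)[OF ki(2)]] by blast
    from Bstar_limit_tensor[OF T \<Omega> dom[OF ki(3)] this] show ?thesis unfolding ki(1) by blast
  qed
  have ex: "\<exists>g. Bstar_limit T \<Omega> w g" if "w \<in> V\<delta>" for w
    using that unfolding V
  proof (induction rule: span_induct_alt)
    case base
    obtain w where "w \<in> ?S" using assms(6,7) by fastforce
    then obtain g where "Bstar_limit T \<Omega> w g" using gen by blast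
    from Bstar_limit_scaleR[OF T \<Omega> this, of 0] show ?case by auto
  next
    case (step c x y)
    then show ?case using gen[OF step(1)] Bstar_limit_add[OF T \<Omega> Bstar_limit_scaleR[OF T \<Omega>]] by blast
  qed
  have lim: "Bstar_limit T \<Omega> w (Bstar T \<Omega> w)" if "w \<in> V\<delta>" for w
    using ex[OF that] Bstar_eqI[OF T \<Omega>] by blast
  have VV: "V\<delta> \<subseteq> V_space T \<Omega>" using lim Bstar_limit_V_space[OF T \<Omega>] by blast
  have UU: "U\<delta> \<subseteq> U_space T \<Omega>" using lim Bstar_limit_Bochner(2)[OF T \<Omega>] unfolding assms(15) by blast
  have B0: "Bstar T \<Omega> 0 = 0"
  proof -
    have "0 \<in> V\<delta>" unfolding V by (rule span_zero)
    from Bstar_limit_scaleR[OF T \<Omega> lim[OF this], of 0] show ?thesis by (intro Bstar_eqI[OF T \<Omega>]) simp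
  qed
  have nz: "\<exists>w\<in>V\<delta>. Bstar T \<Omega> w \<noteq> 0"
  proof -
    have mem: "1 \<in> {1..Nt}" "1 \<in> {1..Nh}" using assms(6,7) by auto
    have "\<rho> 1 \<noteq> 0" "\<phi> 1 \<noteq> 0"
      using dependent_zero[of "\<rho> ` {1..Nt}"] dependent_zero[of "\<phi> ` {1..Nh}"] assms(10,13) mem by force+
    moreover obtain p q where pq: "q \<in> L2_on {0<..<T}" "p = end_primitive_class T q" "\<rho> 1 = end_primitive_class T p"
      using H2_end_primitive[OF T assms(8)[OF mem(1)]] by blast
    ultimately have "tensor q (\<phi> 1) + tensor (\<rho> 1) (op_A \<Omega> (\<phi> 1)) \<noteq> 0"
      by (intro Bstar_tensor_nonzero[OF T pq(2,3)])
    then have "Bstar T \<Omega> (tensor (\<rho> 1) (\<phi> 1)) \<noteq> 0"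
      using Bstar_eqI[OF T \<Omega> Bstar_limit_tensor[OF T \<Omega> dom[OF mem(2)] pq]] by simp
    moreover have "tensor (\<rho> 1) (\<phi> 1) \<in> V\<delta>" unfolding V using mem by (intro span_base) blast
    ultimately show ?thesis by blast
  qed
  have "inf_sup_constant (form_b T \<Omega>) norm (V_norm T \<Omega>) U\<delta> V\<delta> = 1"
    using inf_sup_constant_image[OF B0 nz] unfolding form_b_def[abs_def] V_norm_def[abs_def] assms(15) .
  with VV UU show ?thesis by blast
qed

end
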